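(* Let $d=1$. For all $p\in(0,1)$ and $\mu>0$, the speed function $\lambda\mapsto v(\lambda)=v_{\mu,p}(\lambda)$ of the $\lambda$-biased random walk on dynamical percolation on $\mathbb{Z}$ with parameters $\mu$ and $p$ is strictly increasing for all $\lambda>0$ and satisfies $$\lim_{\lambda\to\infty}v_{\mu,p}(\lambda)=\frac{\mu p}{1-p+\mu}.$$
   Context: Dynamical percolation on $\mathbb{Z}$ (nearest-neighbour graph with edge set $E$) with parameters $\mu>0$ and $p\in(0,1)$ is the Markov process $(\eta_t)_{t\ge0}$ on $\{0,1\}^{E}$ in which each edge carries an independent Poisson process of rate $\mu$; at each point of the process of $e$, the state of $e$ is refreshed: $\eta_t(e)=1$ ($e$ open) with probability $p$ and $\eta_t(e)=0$ ($e$ closed) with probability $1-p$, independently of everything else. The initial state $\eta_0$ has the Bernoulli-$p$ product law $\pi_p$. The $\lambda$-biased random walk $(X_t)_{t\ge0}$ on dynamical percolation on $\mathbb{Z}$, $\lambda>0$, starts at $X_0=0$ and carries an independent rate $1$ Poisson clock. When the clock rings at time $t$ and the walker is at $x$, it chooses $y=x+1$ with probability $e^{\lambda}/(e^{\lambda}+e^{-\lambda})$ and $y=x-1$ with probability $e^{-\lambda}/(e^{\lambda}+e^{-\lambda})$. If $\eta_t(\{x,y\})=1$, the walker moves to $y$; otherwise it stays at $x$. The speed $v(\lambda)=v_{\mu,p}(\lambda)$ is the deterministic number such that $\lim_{t\to\infty}X_t/t=v(\lambda)$ almost surely (this limit exists). *)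

theory Defs
  imports "HOL-Probability.Probability"
begin

text \<open>
  The process is built from its graphical representation on a product probability space. A Poisson
  process of rate \<open>r\<close> is given by its i.i.d. exponential waiting times \<open>g 0, g 1, \<dots>\<close>.
\<close>

definition poisson_gaps :: "real \<Rightarrow> (nat \<Rightarrow> real) measure" where
  "poisson_gaps r = PiM UNIV (\<lambda>_. density lborel (exponential_density r))"

definition coin_flips :: "real \<Rightarrow> (nat \<Rightarrow> bool) measure" where
  "coin_flips q = PiM UNIV (\<lambda>_. measure_pmf (bernoulli_pmf q))"

definition arrival :: "(nat \<Rightarrow> real) \<Rightarrow> nat \<Rightarrow> real" where
  "arrival g n = (\<Sum>i\<le>n. g i)"

text \<open>
  The number of points in \<open>[0, t]\<close>. Almost surely the set is finite for all \<open>t\<close>; on the exceptional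
  null set, \<open>card\<close> may return the irrelevant value 0.
\<close>

definition num_arrivals :: "(nat \<Rightarrow> real) \<Rightarrow> real \<Rightarrow> nat" where
  "num_arrivals g t = card {n. arrival g n \<le> t}"

text \<open>
  The edge \<open>{x, x + 1}\<close> of the integer line is represented by its left endpoint \<open>x\<close>. Each edge
  carries the waiting times of its refresh process and a sequence of states: state 0 is the initial
  state, state \<open>n + 1\<close> is the outcome of the refresh at time \<open>arrival g n\<close>.
\<close>

type_synonym env_sample = "int \<Rightarrow> (nat \<Rightarrow> real) \<times> (nat \<Rightarrow> bool)"

definition env_measure :: "real \<Rightarrow> real \<Rightarrow> env_sample measure" where
  "env_measure \<mu> p = PiM UNIV (\<lambda>_. poisson_gaps \<mu> \<Otimes>\<^sub>M coin_flips p)"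

definition dyn_perc :: "env_sample \<Rightarrow> real \<Rightarrow> int \<Rightarrow> bool" where
  "dyn_perc \<xi> t e = (case \<xi> e of (g, s) \<Rightarrow> s (num_arrivals g t))"

text \<open>
  The walker carries the waiting times of its clock and its proposed directions, where \<open>True\<close>
  stands for a step to the right.
\<close>

type_synonym walker_sample = "(nat \<Rightarrow> real) \<times> (nat \<Rightarrow> bool)"

definition walker_measure :: "real \<Rightarrow> walker_sample measure" where
  "walker_measure l = poisson_gaps 1 \<Otimes>\<^sub>M coin_flips (exp l / (exp l + exp (- l)))"

definition walk_measure :: "real \<Rightarrow> real \<Rightarrow> real \<Rightarrow> (env_sample \<times> walker_sample) measure" where
  "walk_measure \<mu> p l = env_measure \<mu> p \<Otimes>\<^sub>M walker_measure l"

text \<open>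
  The position after \<open>n\<close> rings of the clock; the edge between neighbours \<open>x\<close> and \<open>y\<close> has left
  endpoint \<open>min x y\<close>.
\<close>

fun jump_chain :: "env_sample \<times> walker_sample \<Rightarrow> nat \<Rightarrow> int" where
  "jump_chain \<omega> 0 = 0"
| "jump_chain (\<xi>, (c, d)) (Suc n) =
     (let x = jump_chain (\<xi>, (c, d)) n;
          y = (if d n then x + 1 else x - 1)
      in if dyn_perc \<xi> (arrival c n) (min x y) then y else x)"

definition walk :: "env_sample \<times> walker_sample \<Rightarrow> real \<Rightarrow> int" where
  "walk \<omega> t = jump_chain \<omega> (num_arrivals (fst (snd \<omega>)) t)"

definition speed :: "real \<Rightarrow> real \<Rightarrow> real \<Rightarrow> real" where
  "speed \<mu> p l =
     (THE v. AE \<omega> in walk_measure \<mu> p l. ((\<lambda>t. of_int (walk \<omega> t) / t) \<longlongrightarrow> v) at_top)"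

end

theory Submission
  imports Defs "HOL-Real_Asymp.Real_Asymp"
begin

text \<open>
  The environment is explored lazily: the answer to a query of an edge stays valid for an independent
  exponential time, and a query without a valid earlier answer is a fresh coin. Since an answer is used
  for at most one later query, memorylessness shows that this does not change the law of the walk. The
  remaining validity of all answers is dominated by a load \<open>w' = max w (max l l') - g\<close> that is driven
  by the clock and the validity times only; when it is not positive, the walk starts afresh.

  An exponential Lyapunov function of the load makes the drift converge geometrically fast, uniformly
  in the bias. This yields the law of large numbers through second moments, and the continuity of the
  speed as the bias becomes total. Two walkers with different biases that share clock and environment
  stay ordered, and up to a Lyapunov correction their expected gap grows by a fixed amount per ring;
  hence the speed is strictly increasing. For total bias, the position plus a multiple of the indicator
  that the edge ahead is unexplored has constant drift, which is the limit.
\<close>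

section \<open>Sequences of independent random variables\<close>

text \<open>The obstacle is that the environment remembers: the increments of the walk are
  dependent, and two walkers can be compared only if they see the same environment. Lazy exploration
  replaces the environment by a memory that is driven by i.i.d. input, one entry per ring, so limit
  arguments become inductions that condition on the first ring. Equality in law is not shown by a
  pathwise construction: with clock and directions frozen, every sequence of answers gets the same
  product weight in both models, and the answers determine the positions. Directions come from one
  exponential variable \<open>u\<close> per ring; a walker with threshold \<theta> steps right iff
  \<theta> < \<open>u\<close>. This couples all biases and makes total bias the ordinary parameter
  \<theta> = 0, which no finite \<lambda> attains; the limit \<lambda> to infinity is then
  continuity at \<theta> = 0. The Lyapunov function is integrated over positive loads only, that is,
  killed at renewals. Hence it contracts without an additive constant, and geometric rates follow
  without constructing renewal times.\<close>

definition exp_law :: "real \<Rightarrow> real measure" where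
  "exp_law r = density lborel (exponential_density r)"

abbreviation iid_seq :: "'a measure \<Rightarrow> (nat \<Rightarrow> 'a) measure" where
  "iid_seq M \<equiv> PiM UNIV (\<lambda>_. M)"

lemma sets_exp_law [simp, measurable_cong]: "sets (exp_law r) = sets borel"
  and space_exp_law [simp]: "space (exp_law r) = UNIV"
  by (simp_all add: exp_law_def)

lemma prob_space_exp_law: "0 < r \<Longrightarrow> prob_space (exp_law r)"
  unfolding exp_law_def by (rule prob_space_exponential_density)

lemma poisson_gaps_eq_iid_seq: "poisson_gaps r = iid_seq (exp_law r)"
  by (simp add: poisson_gaps_def exp_law_def)

lemma coin_flips_eq_iid_seq: "coin_flips q = iid_seq (measure_pmf (bernoulli_pmf q))"
  by (simp add: coin_flips_def)

lemma prob_space_iid_seq: "prob_space M \<Longrightarrow> prob_space (iid_seq M)"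
  by (rule prob_space_PiM)

lemma integrable_bounded:
  fixes f :: "'a \<Rightarrow> real"
  assumes "prob_space M" "f \<in> borel_measurable M" "\<And>x. \<bar>f x\<bar> \<le> B"
  shows "integrable M f"
proof -
  interpret prob_space M by fact
  show ?thesis using assms by (intro integrable_const_bound[of _ B]) auto
qed

lemma integral_pair_iterated:
  fixes f :: "'a \<times> 'b \<Rightarrow> real"
  assumes "prob_space M" "prob_space N" "f \<in> borel_measurable (M \<Otimes>\<^sub>M N)" "\<And>x. \<bar>f x\<bar> \<le> B"
  shows "(\<integral>z. f z \<partial>(M \<Otimes>\<^sub>M N)) = (\<integral>x. \<integral>y. f (x, y) \<partial>N \<partial>M)"
    and "(\<integral>z. f z \<partial>(M \<Otimes>\<^sub>M N)) = (\<integral>y. \<integral>x. f (x, y) \<partial>M \<partial>N)"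
proof -
  interpret pair_prob_space M N
    using assms by (simp add: pair_prob_space_def pair_sigma_finite_def prob_space_imp_sigma_finite)
  have "integrable (M \<Otimes>\<^sub>M N) f"
    using assms by (intro integrable_bounded[of _ _ B]) unfold_locales
  then show "(\<integral>z. f z \<partial>(M \<Otimes>\<^sub>M N)) = (\<integral>x. \<integral>y. f (x, y) \<partial>N \<partial>M)"
    "(\<integral>z. f z \<partial>(M \<Otimes>\<^sub>M N)) = (\<integral>y. \<integral>x. f (x, y) \<partial>M \<partial>N)"
    using integral_fst'[of f] integral_snd[of "\<lambda>x y. f (x, y)"] by (simp_all add: case_prod_beta')
qed

lemma integral_prod_fst_snd:
  fixes f :: "'a \<Rightarrow> real" and g :: "'b \<Rightarrow> real"
  assumes M: "prob_space M" and N: "prob_space N" and f: "integrable M f" and g: "integrable N g"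
  shows "integrable (M \<Otimes>\<^sub>M N) (\<lambda>z. f (fst z) * g (snd z))"
    and "(\<integral>z. f (fst z) * g (snd z) \<partial>(M \<Otimes>\<^sub>M N)) = (\<integral>x. f x \<partial>M) * (\<integral>y. g y \<partial>N)"
proof -
  interpret pair_prob_space M N
    using M N by (simp add: pair_prob_space_def pair_sigma_finite_def prob_space_imp_sigma_finite)
  have [measurable]: "f \<in> borel_measurable M" "g \<in> borel_measurable N" using f g by auto
  have i: "integrable (M \<Otimes>\<^sub>M N) (\<lambda>(x, y). f x * g y)"
  proof (rule Fubini_integrable)
    show "integrable M (\<lambda>x. \<integral>y. norm (case (x, y) of (x, y) \<Rightarrow> f x * g y) \<partial>N)"
      using f by (simp add: abs_mult)
    show "AE x in M. integrable N (\<lambda>y. case (x, y) of (x, y) \<Rightarrow> f x * g y)"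
      using g by simp
  qed measurable
  then show "integrable (M \<Otimes>\<^sub>M N) (\<lambda>z. f (fst z) * g (snd z))" by (simp add: case_prod_beta')
  show "(\<integral>z. f (fst z) * g (snd z) \<partial>(M \<Otimes>\<^sub>M N)) = (\<integral>x. f x \<partial>M) * (\<integral>y. g y \<partial>N)"
    using integral_fst[OF i] by (simp add: case_prod_beta')
qed

lemma integral_fst_component:
  fixes f :: "'a \<Rightarrow> real"
  assumes M: "prob_space M" and N: "prob_space N" and f: "integrable M f"
  shows "integrable (M \<Otimes>\<^sub>M N) (\<lambda>z. f (fst z))" "(\<integral>z. f (fst z) \<partial>(M \<Otimes>\<^sub>M N)) = (\<integral>x. f x \<partial>M)"
proof -
  interpret N: prob_space N by fact
  show "integrable (M \<Otimes>\<^sub>M N) (\<lambda>z. f (fst z))" "(\<integral>z. f (fst z) \<partial>(M \<Otimes>\<^sub>M N)) = (\<integral>x. f x \<partial>M)"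
    using integral_prod_fst_snd[OF M N f, of "\<lambda>_. 1"] by (simp_all add: N.prob_space)
qed

lemma integral_snd_component:
  fixes g :: "'b \<Rightarrow> real"
  assumes M: "prob_space M" and N: "prob_space N" and g: "integrable N g"
  shows "integrable (M \<Otimes>\<^sub>M N) (\<lambda>z. g (snd z))" "(\<integral>z. g (snd z) \<partial>(M \<Otimes>\<^sub>M N)) = (\<integral>y. g y \<partial>N)"
proof -
  interpret M: prob_space M by fact
  show "integrable (M \<Otimes>\<^sub>M N) (\<lambda>z. g (snd z))" "(\<integral>z. g (snd z) \<partial>(M \<Otimes>\<^sub>M N)) = (\<integral>y. g y \<partial>N)"
    using integral_prod_fst_snd[OF M N _ g, of "\<lambda>_. 1"] by (simp_all add: M.prob_space)
qed

lemma distr_pair_snd: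
  assumes "prob_space M" "prob_space N"
  shows "distr (M \<Otimes>\<^sub>M N) N snd = N"
proof (rule measure_eqI)
  interpret M: prob_space M by fact
  interpret N: prob_space N by fact
  fix B assume "B \<in> sets (distr (M \<Otimes>\<^sub>M N) N snd)"
  then have B: "B \<in> sets N" by simp
  have "emeasure (distr (M \<Otimes>\<^sub>M N) N snd) B = emeasure (M \<Otimes>\<^sub>M N) (snd -` B \<inter> space (M \<Otimes>\<^sub>M N))"
    using B by (intro emeasure_distr) auto
  also have "snd -` B \<inter> space (M \<Otimes>\<^sub>M N) = space M \<times> B"
    using sets.sets_into_space[OF B] by (auto simp: space_pair_measure)
  finally show "emeasure (distr (M \<Otimes>\<^sub>M N) N snd) B = emeasure N B"
    using B by (simp add: N.emeasure_pair_measure_Times M.emeasure_space_1)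
qed simp

lemma AE_snd_component: "prob_space M \<Longrightarrow> prob_space N \<Longrightarrow> AE y in N. P y \<Longrightarrow> AE z in M \<Otimes>\<^sub>M N. P (snd z)"
  by (rule AE_distrD[of snd _ N]) (simp, subst distr_pair_snd)

lemma AE_fst_component: "prob_space N \<Longrightarrow> AE x in M. P x \<Longrightarrow> AE z in M \<Otimes>\<^sub>M N. P (fst z)"
  by (rule AE_distrD[of fst _ M]) (simp, subst prob_space.distr_pair_fst)

text \<open>The Bochner integral of a non-integrable function is 0, a case that
  \<open>0 \<le> B\<close> covers; so the bound applies before integrability has been
  established.\<close>

lemma abs_integral_le:
  fixes h :: "'a \<Rightarrow> real"
  assumes "prob_space M" "AE x in M. \<bar>h x\<bar> \<le> B" "0 \<le> B"
  shows "\<bar>\<integral>x. h x \<partial>M\<bar> \<le> B"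
proof -
  interpret prob_space M by fact
  have "norm (\<integral>x. h x \<partial>M) \<le> (\<integral>x. norm (h x) \<partial>M)" by (rule integral_norm_bound)
  also have "\<dots> \<le> (\<integral>x. B \<partial>M)"
  proof (cases "integrable M (\<lambda>x. norm (h x))")
    case True
    then show ?thesis using assms(2) by (intro integral_mono_AE) auto
  next
    case False
    then show ?thesis using assms(3) by (simp add: not_integrable_integral_eq)
  qed
  finally show ?thesis by (simp add: prob_space)
qed

section \<open>Infinite products of one law: first entry, zipping, mapping\<close>

lemma integral_iid_seq_first_integrable:
  fixes f :: "(nat \<Rightarrow> 'a) \<Rightarrow> real"
  assumes M: "prob_space M" and f: "integrable (iid_seq M) f"
  shows "(\<integral>w. f w \<partial>iid_seq M) = (\<integral>x. \<integral>w. f (case_nat x w) \<partial>iid_seq M \<partial>M)"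
proof -
  interpret sequence_space M
    using M by (simp add: sequence_space_def product_prob_space_def product_sigma_finite_def
        product_prob_space_axioms_def prob_space_imp_sigma_finite)
  interpret P: pair_prob_space M "iid_seq M"
    using M by (simp add: pair_prob_space_def pair_sigma_finite_def prob_space_imp_sigma_finite
        prob_space_iid_seq)
  have d: "distr (M \<Otimes>\<^sub>M iid_seq M) (iid_seq M) (\<lambda>(x, w). case_nat x w) = iid_seq M"
    by (rule PiM_iter)
  have f' [measurable]: "f \<in> borel_measurable (iid_seq M)"
    using f by auto
  have "integrable (M \<Otimes>\<^sub>M iid_seq M) (\<lambda>z. f (case_nat (fst z) (snd z)))"
    using f by (subst (asm) d[symmetric], subst (asm) integrable_distr_eq) (auto simp: case_prod_beta')
  then have "(\<integral>z. f (case_nat (fst z) (snd z)) \<partial>(M \<Otimes>\<^sub>M iid_seq M))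
      = (\<integral>x. \<integral>w. f (case_nat x w) \<partial>iid_seq M \<partial>M)"
    using P.integral_fst'[of "\<lambda>z. f (case_nat (fst z) (snd z))"] by simp
  moreover have "(\<integral>w. f w \<partial>iid_seq M) = (\<integral>z. f (case_nat (fst z) (snd z)) \<partial>(M \<Otimes>\<^sub>M iid_seq M))"
    by (subst d[symmetric], subst integral_distr) (auto simp: case_prod_beta')
  ultimately show ?thesis by simp
qed

lemma integral_iid_seq_first:
  fixes f :: "(nat \<Rightarrow> 'a) \<Rightarrow> real"
  assumes M: "prob_space M" and f: "f \<in> borel_measurable (iid_seq M)" "\<And>x. \<bar>f x\<bar> \<le> B"
  shows "(\<integral>w. f w \<partial>iid_seq M) = (\<integral>x. \<integral>w. f (case_nat x w) \<partial>iid_seq M \<partial>M)"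
  by (rule integral_iid_seq_first_integrable[OF M]) (rule integrable_bounded[OF prob_space_iid_seq[OF M] f])

lemma AE_iid_seq_all:
  assumes "prob_space M" "AE x in M. P x"
  shows "AE w in iid_seq M. \<forall>i. P (w i)"
  unfolding AE_all_countable using assms by (auto intro!: AE_PiM_component)

lemma nn_integral_iid_seq_prod:
  assumes M: "prob_space M" and J: "finite J" and h: "\<And>j. j \<in> J \<Longrightarrow> h j \<in> borel_measurable M"
  shows "(\<integral>\<^sup>+w. (\<Prod>j\<in>J. h j (w j)) \<partial>iid_seq M) = (\<Prod>j\<in>J. \<integral>\<^sup>+x. h j x \<partial>M)"
proof -
  interpret sequence_space M
    using M by (simp add: sequence_space_def product_prob_space_def product_sigma_finite_def
        product_prob_space_axioms_def prob_space_imp_sigma_finite)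
  have "(\<Prod>j\<in>J. \<integral>\<^sup>+x. h j x \<partial>M) = (\<integral>\<^sup>+w. (\<Prod>j\<in>J. h j (w j)) \<partial>PiM J (\<lambda>_. M))"
    using J h by (intro product_nn_integral_prod[symmetric]) auto
  also have "\<dots> = (\<integral>\<^sup>+w. (\<Prod>j\<in>J. h j (w j)) \<partial>distr (iid_seq M) (PiM J (\<lambda>_. M)) (\<lambda>x. restrict x J))"
    using distr_PiM_restrict_finite[OF J] by simp
  also have "\<dots> = (\<integral>\<^sup>+w. (\<Prod>j\<in>J. h j (w j)) \<partial>iid_seq M)"
  proof -
    have "(\<lambda>w. \<Prod>j\<in>J. h j (w j)) \<in> borel_measurable (PiM J (\<lambda>_. M))"
      using measurable_compose[OF measurable_component_singleton[of _ J "\<lambda>_. M"] h]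
      by (intro borel_measurable_prod_ennreal[where f="\<lambda>j w. h j (w j)"]) auto
    then show ?thesis
      by (subst nn_integral_distr) (auto intro!: nn_integral_cong prod.cong)
  qed
  finally show ?thesis by simp
qed

text \<open>Product measures are determined by finite cylinders. The lemma serves to split the
  sequence of rings into independent sequences of clock gaps, direction variables and tokens, so
  that the first two can be frozen.\<close>

lemma distr_iid_seq_zip:
  assumes M: "prob_space M" and N: "prob_space N"
  shows "distr (iid_seq M \<Otimes>\<^sub>M iid_seq N) (iid_seq (M \<Otimes>\<^sub>M N)) (\<lambda>z i. (fst z i, snd z i)) = iid_seq (M \<Otimes>\<^sub>M N)"
    (is "?D = _")
proof -
  interpret M: prob_space M by fact
  interpret N: prob_space N by fact
  interpret SM: prob_space "iid_seq M" by (rule prob_space_iid_seq[OF M])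
  interpret SN: prob_space "iid_seq N" by (rule prob_space_iid_seq[OF N])
  interpret P: pair_prob_space M N ..
  interpret product_prob_space "\<lambda>_. M \<Otimes>\<^sub>M N" "UNIV :: nat set" ..
  interpret PN: product_prob_space "\<lambda>_. N" "UNIV :: nat set" ..
  have zm [measurable]: "(\<lambda>z i. (fst z i, snd z i)) \<in> measurable (iid_seq M \<Otimes>\<^sub>M iid_seq N) (iid_seq (M \<Otimes>\<^sub>M N))"
    by (rule measurable_PiM_single')
       (auto simp: space_pair_measure space_PiM)
  show ?thesis
  proof (rule PiM_eq)
    fix J :: "nat set" and F
    assume J: "finite J" "J \<subseteq> UNIV" and F: "\<And>j. j \<in> J \<Longrightarrow> F j \<in> sets (M \<Otimes>\<^sub>M N)"
    let ?X = "prod_emb UNIV (\<lambda>_. M \<Otimes>\<^sub>M N) J (Pi\<^sub>E J F)"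
    have X: "?X \<in> sets (iid_seq (M \<Otimes>\<^sub>M N))" using J F by (intro sets_PiM_I) auto
    have "emeasure ?D ?X = emeasure (iid_seq M \<Otimes>\<^sub>M iid_seq N)
        ((\<lambda>z i. (fst z i, snd z i)) -` ?X \<inter> space (iid_seq M \<Otimes>\<^sub>M iid_seq N))" (is "_ = emeasure _ ?Y")
      using X by (intro emeasure_distr) auto
    also have "\<dots> = (\<integral>\<^sup>+a. emeasure (iid_seq N) (Pair a -` ?Y) \<partial>iid_seq M)"
      using X by (intro SN.emeasure_pair_measure_alt) (rule measurable_sets[OF zm])
    \<comment> \<open>For fixed \<open>a\<close>, the section of the cylinder is again a cylinder,
      whose sides are the sections of \<open>F j\<close> at \<open>a j\<close>.\<close>
    also have "\<dots> = (\<integral>\<^sup>+a. (\<Prod>j\<in>J. emeasure N (Pair (a j) -` F j)) \<partial>iid_seq M)"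
    proof (rule nn_integral_cong)
      fix a assume a: "a \<in> space (iid_seq M)"
      have "Pair a -` ?Y = {b \<in> space (iid_seq N). \<forall>j\<in>J. b j \<in> Pair (a j) -` F j}"
        using a J F[THEN sets.sets_into_space]
        by (auto simp: prod_emb_def space_pair_measure space_PiM PiE_iff)
      also have "emeasure (iid_seq N) \<dots> = (\<Prod>j\<in>J. emeasure N (Pair (a j) -` F j))"
        using J F by (intro PN.emeasure_PiM_Collect) (auto intro: sets_Pair1)
      finally show "emeasure (iid_seq N) (Pair a -` ?Y) = \<dots>" .
    qed
    also have "\<dots> = (\<Prod>j\<in>J. \<integral>\<^sup>+x. emeasure N (Pair x -` F j) \<partial>M)"
      using F by (intro nn_integral_iid_seq_prod[OF M J(1)] N.measurable_emeasure_Pair)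
    also have "\<dots> = (\<Prod>j\<in>J. emeasure (M \<Otimes>\<^sub>M N) (F j))"
      using F by (intro prod.cong refl N.emeasure_pair_measure_alt[symmetric])
    finally show "emeasure ?D ?X = (\<Prod>j\<in>J. emeasure (M \<Otimes>\<^sub>M N) (F j))" .
  qed simp
qed

lemma distr_iid_seq_map:
  assumes M: "prob_space M" and f [measurable]: "f \<in> measurable M N"
  shows "distr (iid_seq M) (iid_seq N) (\<lambda>w i. f (w i)) = iid_seq (distr M N f)"
proof -
  interpret M: prob_space M by fact
  interpret D: prob_space "distr M N f" by (rule M.prob_space_distr[OF f])
  interpret product_prob_space "\<lambda>_. distr M N f" "UNIV :: nat set" ..
  interpret PM: product_prob_space "\<lambda>_. M" "UNIV :: nat set" ..
  have fm: "(\<lambda>w i. f (w i)) \<in> measurable (iid_seq M) (iid_seq N)"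
    by (rule measurable_PiM_single') (auto simp: space_PiM intro: measurable_space[OF f])
  show ?thesis
  proof (rule PiM_eq)
    show "sets (distr (iid_seq M) (iid_seq N) (\<lambda>w i. f (w i))) = sets (iid_seq (distr M N f))"
      by (simp cong: sets_PiM_cong)
    fix J :: "nat set" and F
    assume J: "finite J" "J \<subseteq> UNIV" and F: "\<And>j. j \<in> J \<Longrightarrow> F j \<in> sets (distr M N f)"
    let ?X = "prod_emb UNIV (\<lambda>_. distr M N f) J (Pi\<^sub>E J F)"
    have "?X \<in> sets (iid_seq (distr M N f))" using J F by (intro sets_PiM_I) auto
    then have X: "?X \<in> sets (iid_seq N)" by (simp cong: sets_PiM_cong)
    have "emeasure (distr (iid_seq M) (iid_seq N) (\<lambda>w i. f (w i))) ?X
      = emeasure (iid_seq M) ((\<lambda>w i. f (w i)) -` ?X \<inter> space (iid_seq M))"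
      using X by (intro emeasure_distr fm)
    also have "(\<lambda>w i. f (w i)) -` ?X \<inter> space (iid_seq M)
        = {w \<in> space (iid_seq M). \<forall>j\<in>J. w j \<in> f -` F j \<inter> space M}"
      using measurable_space[OF f] by (auto simp: prod_emb_def space_PiM PiE_iff)
    also have "emeasure (iid_seq M) \<dots> = (\<Prod>j\<in>J. emeasure M (f -` F j \<inter> space M))"
      using J F by (intro PM.emeasure_PiM_Collect) (auto intro: measurable_sets[OF f])
    also have "\<dots> = (\<Prod>j\<in>J. emeasure (distr M N f) (F j))"
      using F by (intro prod.cong refl emeasure_distr[symmetric]) auto
    finally show "emeasure (distr (iid_seq M) (iid_seq N) (\<lambda>w i. f (w i))) ?X
      = (\<Prod>j\<in>J. emeasure (distr M N f) (F j))" .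
  qed
qed

lemma integral_iid_seq_zip:
  fixes f :: "(nat \<Rightarrow> 'a \<times> 'b) \<Rightarrow> real"
  assumes M: "prob_space M" and N: "prob_space N"
    and f [measurable]: "f \<in> borel_measurable (iid_seq (M \<Otimes>\<^sub>M N))" and B: "\<And>w. \<bar>f w\<bar> \<le> B"
  shows "(\<integral>w. f w \<partial>iid_seq (M \<Otimes>\<^sub>M N)) = (\<integral>a. \<integral>b. f (\<lambda>i. (a i, b i)) \<partial>iid_seq N \<partial>iid_seq M)"
proof -
  have zm [measurable]: "(\<lambda>z i. (fst z i, snd z i)) \<in> measurable (iid_seq M \<Otimes>\<^sub>M iid_seq N) (iid_seq (M \<Otimes>\<^sub>M N))"
    by (rule measurable_PiM_single') (auto simp: space_pair_measure space_PiM)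
  have "(\<integral>w. f w \<partial>iid_seq (M \<Otimes>\<^sub>M N)) = (\<integral>z. f (\<lambda>i. (fst z i, snd z i)) \<partial>(iid_seq M \<Otimes>\<^sub>M iid_seq N))"
    by (subst distr_iid_seq_zip[OF M N, symmetric], subst integral_distr) auto
  also have "\<dots> = (\<integral>a. \<integral>b. f (\<lambda>i. (a i, b i)) \<partial>iid_seq N \<partial>iid_seq M)"
    by (subst integral_pair_iterated(1)[where B=B]) (auto intro!: prob_space_iid_seq M N B measurable_compose[OF zm f])
  finally show ?thesis .
qed

subsection \<open>The exponential law\<close>

lemma integral_exp_law_eq:
  fixes f :: "real \<Rightarrow> real"
  assumes "0 < r" "f \<in> borel_measurable borel"
  shows "(\<integral>x. f x \<partial>exp_law r) = (\<integral>x. exponential_density r x * f x \<partial>lborel)"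
  unfolding exp_law_def using assms
  by (subst integral_density) (auto simp: exponential_density_nonneg)

text \<open>Memorylessness: conditionally on exceeding \<open>t\<close>, the overshoot has the
  original law.\<close>

lemma integral_exp_law_tail:
  fixes f :: "real \<Rightarrow> real"
  assumes "0 < r" "0 \<le> t" and f [measurable]: "f \<in> borel_measurable borel"
  shows "(\<integral>x. (if t < x then f (x - t) else 0) \<partial>exp_law r) = exp (- r * t) * (\<integral>x. f x \<partial>exp_law r)"
proof -
  have "(\<integral>x. (if t < x then f (x - t) else 0) \<partial>exp_law r)
     = (\<integral>x. exponential_density r x * (if t < x then f (x - t) else 0) \<partial>lborel)"
    using assms by (subst integral_exp_law_eq) auto
  also have "\<dots> = (\<integral>x. exponential_density r (t + x) * (if t < t + x then f (t + x - t) else 0) \<partial>lborel)"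
    using lborel_integral_real_affine[where c=1 and t=t and f="\<lambda>x. exponential_density r x * (if t < x then f (x - t) else 0)"]
    by (simp del: add_diff_cancel_left' cong: if_cong)
  also have "\<dots> = (\<integral>x. exp (- r * t) * (exponential_density r x * f x) \<partial>lborel)"
  proof (rule integral_cong_AE)
    \<comment> \<open>At \<open>x = 0\<close> the indicator on the left vanishes while the density
      on the right does not.\<close>
    have "AE x in lborel. x \<noteq> (0::real)" by (rule AE_lborel_singleton)
    then show "AE x in lborel. exponential_density r (t + x) * (if t < t + x then f (t + x - t) else 0)
        = exp (- r * t) * (exponential_density r x * f x)"
      by eventually_elim (use assms in \<open>auto simp: exponential_density_def mult_exp_exp algebra_simps\<close>)
  qed auto
  also have "\<dots> = exp (- r * t) * (\<integral>x. f x \<partial>exp_law r)"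
    using assms by (subst integral_exp_law_eq) auto
  finally show ?thesis .
qed

lemma exp_law_prob_gt: "0 < r \<Longrightarrow> 0 \<le> t \<Longrightarrow> measure (exp_law r) {t<..} = exp (- r * t)"
proof -
  assume r: "0 < r" "0 \<le> t"
  interpret prob_space "exp_law r" using r by (intro prob_space_exp_law)
  have "measure (exp_law r) {t<..} = (\<integral>x. indicator {t<..} x \<partial>exp_law r)"
    by simp
  also have "\<dots> = (\<integral>x. (if t < x then 1 else 0) \<partial>exp_law r)"
    by (rule Bochner_Integration.integral_cong) (auto simp: indicator_def)
  also have "\<dots> = exp (- r * t)"
    using integral_exp_law_tail[of r t "\<lambda>_. 1"] r prob_space by simp
  finally show ?thesis .
qed

lemma AE_exp_law_pos: "0 < r \<Longrightarrow> AE x in exp_law r. 0 < x"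
proof -
  assume r: "0 < r"
  interpret prob_space "exp_law r" using r by (intro prob_space_exp_law)
  show ?thesis
    using exp_law_prob_gt[of r 0] r
    by (subst AE_in_set_eq_1[of "{0<..}", simplified]) auto
qed

lemma integral_exp_law_if_less:
  fixes a b :: real
  assumes "0 < r" "0 \<le> t"
  shows "(\<integral>x. (if t < x then a else b) \<partial>exp_law r) = exp (- r * t) * a + (1 - exp (- r * t)) * b"
proof -
  interpret prob_space "exp_law r" using assms by (intro prob_space_exp_law)
  have "(\<integral>x. (if t < x then a else b) \<partial>exp_law r) = (\<integral>x. b + (a - b) * indicator {t<..} x \<partial>exp_law r)"
    by (rule Bochner_Integration.integral_cong) (auto simp: indicator_def)
  also have "\<dots> = b + (a - b) * exp (- r * t)"
  proof (subst Bochner_Integration.integral_add)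
    show "integrable (exp_law r) (\<lambda>x. (a - b) * indicat_real {t<..} x)"
      by (intro integrable_mult_right integrable_bounded[of _ _ 1] prob_space_axioms)
         (auto simp: indicator_def)
  qed (use assms prob_space in \<open>auto simp: exp_law_prob_gt\<close>)
  finally show ?thesis by (simp add: algebra_simps)
qed

text \<open>Exponential tilting: \<open>exp (s * x)\<close> turns the density of rate
  \<open>r\<close> into a multiple of the density of rate \<open>r - s\<close>. Negative
  \<open>s\<close> gives the Laplace transform.\<close>

lemma exp_law_exponential_moment:
  assumes "0 < r" "s < r"
  shows "integrable (exp_law r) (\<lambda>x. exp (s * x))" "(\<integral>x. exp (s * x) \<partial>exp_law r) = r / (r - s)"
proof -
  have rs: "0 < r - s" using assms by simp
  interpret D: prob_space "exp_law (r - s)" by (rule prob_space_exp_law[OF rs])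
  have eq: "exponential_density r x * exp (s * x) = r / (r - s) * exponential_density (r - s) x" for x
  proof -
    have "exp (- x * r) * exp (s * x) = exp (- x * (r - s))" by (simp add: mult_exp_exp algebra_simps)
    then show ?thesis using rs by (simp add: exponential_density_def)
  qed
  have "integrable (exp_law (r - s)) (\<lambda>_. 1 :: real)" by simp
  then have i: "integrable lborel (exponential_density (r - s))"
    unfolding exp_law_def using rs
    by (subst (asm) integrable_density) (auto simp: exponential_density_nonneg)
  have e: "(\<integral>x. exponential_density (r - s) x \<partial>lborel) = 1"
    using integral_exp_law_eq[OF rs, of "\<lambda>_. 1"] D.prob_space by simp
  show "integrable (exp_law r) (\<lambda>x. exp (s * x))"
    unfolding exp_law_def using assms
    by (subst integrable_density) (auto simp: exponential_density_nonneg eq intro!: integrable_mult_right i)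
  show "(\<integral>x. exp (s * x) \<partial>exp_law r) = r / (r - s)"
    using assms by (subst integral_exp_law_eq) (auto simp: eq e)
qed

text \<open>A single exponential variable realises the direction coins of all biases simultaneously
  and monotonically in \<theta>, with the sure step to the right at \<theta> = 0.\<close>

lemma bernoulli_as_exp_threshold:
  assumes "0 \<le> \<theta>"
  shows "distr (exp_law 1) (count_space UNIV) (\<lambda>u. \<theta> < u) = measure_pmf (bernoulli_pmf (exp (- \<theta>)))"
proof (rule measure_eqI_countable[where A=UNIV])
  interpret prob_space "exp_law 1" by (rule prob_space_exp_law) simp
  have gt: "measure (exp_law 1) {\<theta><..} = exp (- \<theta>)"
    using exp_law_prob_gt[of 1 \<theta>] assms by simp
  fix b :: bool
  have q: "exp (- \<theta>) \<le> 1" using assms by simp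
  have e: "emeasure (distr (exp_law 1) (count_space UNIV) (\<lambda>u. \<theta> < u)) {b}
      = ennreal (measure (exp_law 1) ((\<lambda>u. \<theta> < u) -` {b}))"
    by (subst emeasure_distr) (auto simp: emeasure_eq_measure)
  show "emeasure (distr (exp_law 1) (count_space UNIV) (\<lambda>u. \<theta> < u)) {b}
      = emeasure (measure_pmf (bernoulli_pmf (exp (- \<theta>)))) {b}"
  proof (cases b)
    case True
    then have "(\<lambda>u. \<theta> < u) -` {b} = {\<theta><..}" by auto
    then show ?thesis unfolding e using q gt True by (simp add: emeasure_pmf_single)
  next
    case False
    then have "(\<lambda>u. \<theta> < u) -` {b} = UNIV - {\<theta><..}" by auto
    then have "measure (exp_law 1) ((\<lambda>u. \<theta> < u) -` {b}) = 1 - exp (- \<theta>)"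
      using prob_compl[of "{\<theta><..}"] gt by simp
    then show ?thesis unfolding e using q False by (simp add: emeasure_pmf_single)
  qed
qed auto

section \<open>A law of large numbers for monotone sequences\<close>

lemma geometric_increments_converge:
  fixes d :: "nat \<Rightarrow> real"
  assumes \<rho>: "0 \<le> \<rho>" "\<rho> < 1" and d: "\<And>m. \<bar>d (Suc m) - d m\<bar> \<le> c * \<rho> ^ m"
  shows "\<exists>v. \<forall>m. \<bar>d m - v\<bar> \<le> c / (1 - \<rho>) * \<rho> ^ m"
proof -
  define u where "u k = d (Suc k) - d k" for k
  have g: "(\<lambda>k. c * \<rho> ^ (k + m)) sums (c / (1 - \<rho>) * \<rho> ^ m)" for m
  proof -
    have "(\<lambda>k. (c * \<rho> ^ m) * \<rho> ^ k) sums ((c * \<rho> ^ m) * (1 / (1 - \<rho>)))"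
      using \<rho> by (intro sums_mult geometric_sums) simp
    moreover have "(c * \<rho> ^ m) * \<rho> ^ k = c * \<rho> ^ (k + m)" for k by (simp add: power_add)
    ultimately show ?thesis by simp
  qed
  have ub: "\<bar>u k\<bar> \<le> c * \<rho> ^ k" for k unfolding u_def by (rule d)
  have su: "summable (\<lambda>k. \<bar>u (k + m)\<bar>)" for m
    by (rule summable_comparison_test'[OF sums_summable[OF g[of m]], of 0]) (simp add: ub)
  have su0: "summable u"
    using summable_rabs_cancel[of u] su[of 0] by simp
  define v where "v = d 0 + suminf u"
  have dm: "d m = d 0 + (\<Sum>k<m. u k)" for m
    by (induction m) (simp_all add: u_def)
  have "\<bar>d m - v\<bar> \<le> c / (1 - \<rho>) * \<rho> ^ m" for m
  proof -
    have "suminf u = (\<Sum>k. u (k + m)) + (\<Sum>k<m. u k)"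
      by (rule suminf_split_initial_segment[OF su0])
    then have "v - d m = (\<Sum>k. u (k + m))"
      using dm[of m] by (simp add: v_def)
    then have "\<bar>d m - v\<bar> = \<bar>\<Sum>k. u (k + m)\<bar>" by linarith
    also have "\<dots> \<le> (\<Sum>k. \<bar>u (k + m)\<bar>)" by (rule summable_rabs[OF su])
    also have "\<dots> \<le> (\<Sum>k. c * \<rho> ^ (k + m))"
      by (rule suminf_le[OF ub su sums_summable[OF g]])
    also have "\<dots> = c / (1 - \<rho>) * \<rho> ^ m" by (rule sums_unique[OF g, symmetric])
    finally show ?thesis .
  qed
  then show ?thesis by blast
qed

lemma eq_of_linear_bound:
  fixes a b C :: real
  assumes "\<And>n. a * real n \<le> b * real n + C"
  shows "a \<le> b"
proof (rule ccontr)
  assume "\<not> a \<le> b"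
  then obtain n where "C < real n * (a - b)" using ex_less_of_nat_mult[of "a - b" C] by auto
  then show False using assms[of n] by (simp add: algebra_simps)
qed

text \<open>Monotonicity traps \<open>S n\<close> between its values at the neighbouring squares
  \<open>k n\<close> squared and \<open>Suc (k n)\<close> squared, and the ratio of consecutive
  squares tends to 1.\<close>

lemma LIMSEQ_of_squares:
  fixes S :: "nat \<Rightarrow> real"
  assumes mono: "\<And>n. S n \<le> S (Suc n)" and lim: "(\<lambda>k. S (k\<^sup>2) / real (k\<^sup>2)) \<longlonglongrightarrow> a"
  shows "(\<lambda>n. S n / real n) \<longlonglongrightarrow> a"
proof -
  define k where "k n = nat \<lfloor>sqrt (real n)\<rfloor>" for n
  have k1: "real (k n) \<le> sqrt (real n)" and k2: "sqrt (real n) < real (k n) + 1" for n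
    unfolding k_def using of_nat_nat[of "\<lfloor>sqrt (real n)\<rfloor>"] by simp_all
  have kn: "(k n)\<^sup>2 \<le> n" "n \<le> (Suc (k n))\<^sup>2" for n
  proof -
    have "(real (k n))\<^sup>2 \<le> real n"
      using k1[of n] by (metis of_nat_0_le_iff power_mono real_sqrt_pow2)
    then show "(k n)\<^sup>2 \<le> n" by (metis of_nat_le_iff of_nat_power)
    have "real n \<le> (real (k n) + 1)\<^sup>2"
      using k2[of n] by (metis less_imp_le of_nat_0_le_iff power_mono real_sqrt_ge_0_iff real_sqrt_pow2)
    then have "real n \<le> real ((Suc (k n))\<^sup>2)" by (simp add: add.commute)
    then show "n \<le> (Suc (k n))\<^sup>2" by (simp only: of_nat_le_iff)
  qed
  have klim: "filterlim k at_top sequentially"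
    unfolding filterlim_at_top
  proof
    fix Z
    show "\<forall>\<^sub>F n in sequentially. Z \<le> k n"
      using eventually_ge_at_top[of "(Suc Z)\<^sup>2"]
    proof eventually_elim
      case (elim n)
      have "(Suc Z)\<^sup>2 \<le> (Suc (k n))\<^sup>2" using elim kn(2)[of n] by linarith
      then show ?case by (simp add: power2_nat_le_eq_le)
    qed
  qed
  have ratio: "(\<lambda>n. real ((k n)\<^sup>2) / real n) \<longlonglongrightarrow> 1"
  proof (rule tendsto_sandwich)
    show "(\<lambda>n::nat. (sqrt (real n) - 1)\<^sup>2 / real n) \<longlonglongrightarrow> 1" by real_asymp
    show "(\<lambda>n::nat. 1) \<longlonglongrightarrow> (1::real)" by simp
    show "\<forall>\<^sub>F n in sequentially. (sqrt (real n) - 1)\<^sup>2 / real n \<le> real ((k n)\<^sup>2) / real n"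
      using eventually_ge_at_top[of 1]
    proof eventually_elim
      case (elim n)
      have "(sqrt (real n) - 1)\<^sup>2 \<le> (real (k n))\<^sup>2"
        using k2[of n] elim by (intro power_mono) auto
      then show ?case by (simp add: divide_right_mono)
    qed
    show "\<forall>\<^sub>F n in sequentially. real ((k n)\<^sup>2) / real n \<le> 1"
    proof (rule always_eventually, rule allI)
      fix n show "real ((k n)\<^sup>2) / real n \<le> 1"
        using kn(1)[of n] by (metis divide_le_eq_1 of_nat_0_less_iff of_nat_le_iff divide_eq_0_iff gr0I of_nat_0 zero_le_one)
    qed
  qed
  have ratio': "(\<lambda>n. real ((Suc (k n))\<^sup>2) / real n) \<longlonglongrightarrow> 1"
  proof (rule tendsto_sandwich)
    show "(\<lambda>n::nat. 1) \<longlonglongrightarrow> (1::real)" by simp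
    show "(\<lambda>n::nat. (sqrt (real n) + 1)\<^sup>2 / real n) \<longlonglongrightarrow> 1" by real_asymp
    show "\<forall>\<^sub>F n in sequentially. real ((Suc (k n))\<^sup>2) / real n \<le> (sqrt (real n) + 1)\<^sup>2 / real n"
    proof (rule always_eventually, rule allI)
      fix n
      have "(real (Suc (k n)))\<^sup>2 \<le> (sqrt (real n) + 1)\<^sup>2"
        using k1[of n] by (intro power_mono) auto
      then show "real ((Suc (k n))\<^sup>2) / real n \<le> (sqrt (real n) + 1)\<^sup>2 / real n"
        by (simp add: divide_right_mono)
    qed
    show "\<forall>\<^sub>F n in sequentially. 1 \<le> real ((Suc (k n))\<^sup>2) / real n"
      using eventually_ge_at_top[of 1]
    proof eventually_elim
      case (elim n)
      then show ?case using kn(2)[of n]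
        by (simp only: le_divide_eq of_nat_le_iff) (simp del: of_nat_power of_nat_Suc add: of_nat_le_iff)
    qed
  qed
  have mS: "S i \<le> S j" if "i \<le> j" for i j
    using mono that by (rule lift_Suc_mono_le)
  have l1: "(\<lambda>n. S ((k n)\<^sup>2) / real ((k n)\<^sup>2) * (real ((k n)\<^sup>2) / real n)) \<longlonglongrightarrow> a * 1"
    by (intro tendsto_mult ratio filterlim_compose[OF lim klim])
  have l2: "(\<lambda>n. S ((Suc (k n))\<^sup>2) / real ((Suc (k n))\<^sup>2) * (real ((Suc (k n))\<^sup>2) / real n)) \<longlonglongrightarrow> a * 1"
    by (intro tendsto_mult ratio' filterlim_compose[OF LIMSEQ_Suc[OF lim] klim])
  have kpos: "\<forall>\<^sub>F n in sequentially. 1 \<le> k n"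
    using klim unfolding filterlim_at_top by blast
  show ?thesis
  proof (rule tendsto_sandwich)
    show "\<forall>\<^sub>F n in sequentially. S ((k n)\<^sup>2) / real ((k n)\<^sup>2) * (real ((k n)\<^sup>2) / real n) \<le> S n / real n"
      using kpos by eventually_elim (use mS kn(1) in \<open>simp add: divide_right_mono\<close>)
    show "\<forall>\<^sub>F n in sequentially. S n / real n \<le>
       S ((Suc (k n))\<^sup>2) / real ((Suc (k n))\<^sup>2) * (real ((Suc (k n))\<^sup>2) / real n)"
      by (rule always_eventually) (use mS kn(2) in \<open>simp add: divide_right_mono del: of_nat_power of_nat_Suc\<close>)
  qed (use l1 l2 in simp_all)
qed

text \<open>Linear growth of the centred second moment makes the normalised second moments along
  squares summable, so almost sure convergence holds there; monotonicity fills the gaps. Only second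
  moments enter, not independence, so the lemma applies to the dependent increments of the
  walk.\<close>

lemma AE_LIMSEQ_of_second_moment:
  fixes S :: "nat \<Rightarrow> 'a \<Rightarrow> real"
  assumes "prob_space M"
    and int: "\<And>n. integrable M (\<lambda>x. (S n x - a * real n)\<^sup>2)"
    and bound: "\<And>n. (\<integral>x. (S n x - a * real n)\<^sup>2 \<partial>M) \<le> C * real n + D"
    and mono: "AE x in M. \<forall>n. S n x \<le> S (Suc n) x"
  shows "AE x in M. (\<lambda>n. S n x / real n) \<longlonglongrightarrow> a"
proof -
  interpret prob_space M by fact
  \<comment> \<open>The squares start at \<open>Suc 0\<close>, so no denominator is zero.\<close>
  define T where "T k x = ((S ((Suc k)\<^sup>2) x - a * real ((Suc k)\<^sup>2)) / real ((Suc k)\<^sup>2))\<^sup>2" for k x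
  define c where "c k = (\<bar>C\<bar> + \<bar>D\<bar>) / (real (Suc k))\<^sup>2" for k
  have T_int: "integrable M (T k)" for k
    unfolding T_def power_divide by (intro integrable_divide_zero int impI)
  have T_bound: "(\<integral>x. T k x \<partial>M) \<le> c k" for k
  proof -
    define m where "m = (Suc k)\<^sup>2"
    have m: "m \<ge> 1" by (simp add: m_def)
    have "(\<integral>x. T k x \<partial>M) = (\<integral>x. (S m x - a * real m)\<^sup>2 \<partial>M) / (real m)\<^sup>2"
      unfolding T_def m_def[symmetric] power_divide by simp
    also have "\<dots> \<le> (\<bar>C\<bar> * real m + \<bar>D\<bar> * real m) / (real m)\<^sup>2"
    proof (intro divide_right_mono order_trans[OF bound] add_mono)
      show "D \<le> \<bar>D\<bar> * real m"
        using m mult_left_mono[of 1 "real m" "\<bar>D\<bar>"] by auto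
    qed (auto intro!: mult_right_mono)
    also have "\<dots> = (\<bar>C\<bar> + \<bar>D\<bar>) / real m"
      using m by (simp add: power2_eq_square field_simps)
    finally show ?thesis unfolding c_def m_def by simp
  qed
  have sc: "summable c"
  proof -
    have "summable (\<lambda>k. inverse ((real (Suc k))\<^sup>2))"
      using inverse_power_summable[of 2, where 'a=real] by (subst summable_Suc_iff) simp
    then have "summable (\<lambda>k. (\<bar>C\<bar> + \<bar>D\<bar>) * inverse ((real (Suc k))\<^sup>2))"
      by (rule summable_mult)
    then show ?thesis by (simp add: c_def[abs_def] divide_inverse)
  qed
  have T0: "T k x \<ge> 0" for k x by (simp add: T_def)
  have c0: "c k \<ge> 0" for k by (simp add: c_def)
  have "(\<integral>\<^sup>+x. (\<Sum>k. ennreal (T k x)) \<partial>M) = (\<Sum>k. \<integral>\<^sup>+x. ennreal (T k x) \<partial>M)"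
    using T_int by (intro nn_integral_suminf) auto
  also have "\<dots> \<le> (\<Sum>k. ennreal (c k))"
    using T_int T0 T_bound
    by (intro suminf_le) (auto simp: nn_integral_eq_integral intro!: ennreal_leI)
  also have "\<dots> < \<infinity>"
    using sc c0 by (simp add: suminf_ennreal2)
  finally have "(\<integral>\<^sup>+x. (\<Sum>k. ennreal (T k x)) \<partial>M) \<noteq> \<infinity>" by simp
  moreover have "(\<lambda>x. \<Sum>k. ennreal (T k x)) \<in> borel_measurable M"
  proof -
    have [measurable]: "T k \<in> borel_measurable M" for k
      using T_int by (rule borel_measurable_integrable)
    show ?thesis by measurable
  qed
  ultimately have "AE x in M. (\<Sum>k. ennreal (T k x)) \<noteq> \<infinity>"
    by (rule nn_integral_PInf_AE[rotated])
  with mono show ?thesis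
  proof eventually_elim
    case (elim x)
    have "summable (\<lambda>k. T k x)"
      using elim(2) T0 by (intro summable_suminf_not_top) auto
    then have "(\<lambda>k. T k x) \<longlonglongrightarrow> 0" by (rule summable_LIMSEQ_zero)
    then have "(\<lambda>k. sqrt (T k x)) \<longlonglongrightarrow> 0"
      using tendsto_real_sqrt[of _ 0] by fastforce
    then have "(\<lambda>k. (S ((Suc k)\<^sup>2) x - a * real ((Suc k)\<^sup>2)) / real ((Suc k)\<^sup>2)) \<longlonglongrightarrow> 0"
      unfolding T_def real_sqrt_abs by (rule tendsto_rabs_zero_cancel)
    then have "(\<lambda>k. (S ((Suc k)\<^sup>2) x - a * real ((Suc k)\<^sup>2)) / real ((Suc k)\<^sup>2) + a) \<longlonglongrightarrow> 0 + a"
      by (intro tendsto_intros)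
    then have "(\<lambda>k. S ((Suc k)\<^sup>2) x / real ((Suc k)\<^sup>2)) \<longlonglongrightarrow> a"
      by (simp add: diff_divide_distrib del: of_nat_power of_nat_Suc)
    then have "(\<lambda>k. S (k\<^sup>2) x / real (k\<^sup>2)) \<longlonglongrightarrow> a"
      by (subst (asm) filterlim_sequentially_Suc)
    then show ?case using elim(1) by (intro LIMSEQ_of_squares) auto
  qed
qed

subsection \<open>The points of a Poisson process\<close>

lemma exp_law_moments:
  assumes r: "0 < r"
  shows "integrable (exp_law r) (\<lambda>x. x)" "(\<integral>x. x \<partial>exp_law r) = 1 / r"
    "integrable (exp_law r) (\<lambda>x. (x - 1 / r)\<^sup>2)" "(\<integral>x. (x - 1 / r)\<^sup>2 \<partial>exp_law r) = 1 / r\<^sup>2"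
proof -
  interpret prob_space "exp_law r" using r by (rule prob_space_exp_law)
  have D: "distributed (exp_law r) lborel (\<lambda>x. x) (exponential_density r)"
    unfolding distributed_def by (auto simp: exp_law_def[symmetric] exponential_density_nonneg r distr_id2)
  show i1: "integrable (exp_law r) (\<lambda>x. x)"
    using erlang_ith_moment_integrable[OF r D, of 1] by simp
  show e1: "(\<integral>x. x \<partial>exp_law r) = 1 / r"
    using exponential_distributed_expectation[OF r D] .
  have i2: "integrable (exp_law r) (\<lambda>x. x\<^sup>2)"
    using erlang_ith_moment_integrable[OF r D, of 2] by simp
  show "integrable (exp_law r) (\<lambda>x. (x - 1 / r)\<^sup>2)"
    unfolding power2_diff using i1 i2 by simp
  show "(\<integral>x. (x - 1 / r)\<^sup>2 \<partial>exp_law r) = 1 / r\<^sup>2"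
    using exponential_distributed_variance[OF r D] e1 by simp
qed

text \<open>Induction by splitting off the first entry: the cross term vanishes because the
  remaining centred sum has mean 0.\<close>

lemma iid_seq_sum_second_moment:
  assumes M: "prob_space M" "sets M = sets borel"
    and i: "integrable M (\<lambda>x. x - m)" "integrable M (\<lambda>x. (x - m)\<^sup>2)"
    and z: "(\<integral>x. (x - m) \<partial>M) = 0" "(\<integral>x. (x - m)\<^sup>2 \<partial>M) = s"
  shows "integrable (iid_seq M) (\<lambda>w. (\<Sum>i<n. (w i - m)) :: real) \<and> (\<integral>w. (\<Sum>i<n. (w i - m)) \<partial>iid_seq M) = 0 \<and>
    integrable (iid_seq M) (\<lambda>w. (\<Sum>i<n. (w i - m))\<^sup>2) \<and>
    (\<integral>w. (\<Sum>i<n. (w i - m))\<^sup>2 \<partial>iid_seq M) = s * real n"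
proof -
  note [measurable_cong] = M(2)
  interpret M: prob_space M by fact
  interpret P: prob_space "iid_seq M" using M by (intro prob_space_iid_seq)
  have comp: "integrable (iid_seq M) (\<lambda>w. f (w i))" if "integrable M f" for f :: "real \<Rightarrow> real" and i
  proof -
    have "distr (iid_seq M) M (\<lambda>w. w i) = M" by (rule distr_PiM_component) (auto intro: M)
    with that integrable_distr[of "\<lambda>w. w i" "iid_seq M" M f] show ?thesis by simp
  qed
  have I1: "integrable (iid_seq M) (\<lambda>w. (\<Sum>i<n. (w i - m)))" for n
    by (intro Bochner_Integration.integrable_sum comp i)
  have I2: "integrable (iid_seq M) (\<lambda>w. (\<Sum>i<n. (w i - m))\<^sup>2)" for n
  proof (rule Bochner_Integration.integrable_bound)
    show "integrable (iid_seq M) (\<lambda>w. real n * (\<Sum>i<n. (w i - m)\<^sup>2))"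
      by (intro integrable_mult_right Bochner_Integration.integrable_sum comp[of "\<lambda>x. (x - m)\<^sup>2"] i)
    show "AE w in iid_seq M. norm ((\<Sum>i<n. (w i - m))\<^sup>2) \<le> norm (real n * (\<Sum>i<n. (w i - m)\<^sup>2))"
    proof (intro AE_I2)
      fix w :: "nat \<Rightarrow> real"
      show "norm ((\<Sum>i<n. (w i - m))\<^sup>2) \<le> norm (real n * (\<Sum>i<n. (w i - m)\<^sup>2))"
        using sum_squared_le_sum_of_squares[of "\<lambda>i. w i - m" "{..<n}"]
        by (simp add: sum_nonneg abs_mult mult.commute)
    qed
  qed simp
  have split: "(\<Sum>i<Suc n. (case_nat x w i - m)) = (x - m) + (\<Sum>i<n. (w i - m))" for x w n
    by (subst sum.lessThan_Suc_shift) simp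
  have E: "(\<integral>w. (\<Sum>i<n. (w i - m)) \<partial>iid_seq M) = 0 \<and> (\<integral>w. (\<Sum>i<n. (w i - m))\<^sup>2 \<partial>iid_seq M) = s * real n"
  proof (induction n)
    case (Suc n)
    have "(\<integral>w. (\<Sum>i<Suc n. (w i - m)) \<partial>iid_seq M) = (\<integral>x. \<integral>w. (x - m) + (\<Sum>i<n. (w i - m)) \<partial>iid_seq M \<partial>M)"
      by (subst integral_iid_seq_first_integrable[OF M(1) I1]) (simp only: split)
    also have "\<dots> = 0"
      using I1[of n] Suc z by (simp add: P.prob_space)
    finally have 1: "(\<integral>w. (\<Sum>i<Suc n. (w i - m)) \<partial>iid_seq M) = 0" .
    have "(\<integral>w. (\<Sum>i<Suc n. (w i - m))\<^sup>2 \<partial>iid_seq M)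
        = (\<integral>x. \<integral>w. ((x - m) + (\<Sum>i<n. (w i - m)))\<^sup>2 \<partial>iid_seq M \<partial>M)"
      by (subst integral_iid_seq_first_integrable[OF M(1) I2]) (simp only: split)
    also have "\<dots> = (\<integral>x. (x - m)\<^sup>2 + s * real n \<partial>M)"
    proof (rule Bochner_Integration.integral_cong[OF refl])
      fix x
      have "(\<integral>w. ((x - m) + (\<Sum>i<n. (w i - m)))\<^sup>2 \<partial>iid_seq M)
        = (\<integral>w. (x - m)\<^sup>2 + (\<Sum>i<n. (w i - m))\<^sup>2 + 2 * (x - m) * (\<Sum>i<n. (w i - m)) \<partial>iid_seq M)"
        by (simp only: power2_sum)
      also have "\<dots> = (x - m)\<^sup>2 + s * real n"
        using I1[of n] I2[of n] Suc
        by (subst Bochner_Integration.integral_add | intro integrable_add | simp add: P.prob_space del: sum_diff_distrib sum_subtractf)+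
      finally show "(\<integral>w. ((x - m) + (\<Sum>i<n. (w i - m)))\<^sup>2 \<partial>iid_seq M) = (x - m)\<^sup>2 + s * real n" .
    qed
    also have "\<dots> = s * real (Suc n)"
      using i z M.prob_space by (simp add: algebra_simps)
    finally show ?case using 1 by blast
  qed (simp)
  show ?thesis using I1 I2 E by blast
qed

lemma arrival_case_nat:
  "arrival (case_nat r g) 0 = r" "arrival (case_nat r g) (Suc n) = r + arrival g n"
  by (simp_all add: arrival_def sum.atMost_Suc_shift del: sum.atMost_Suc)

lemma AE_arrival_LIMSEQ:
  assumes r: "0 < r"
  shows "AE g in poisson_gaps r. (\<lambda>n. arrival g n / real n) \<longlonglongrightarrow> 1 / r"
proof -
  interpret E: prob_space "exp_law r" using r by (rule prob_space_exp_law)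
  interpret P: prob_space "poisson_gaps r"
    unfolding poisson_gaps_eq_iid_seq by (intro prob_space_iid_seq E.prob_space_axioms)
  have *: "integrable (poisson_gaps r) (\<lambda>w. (\<Sum>i<n. (w i - 1 / r))\<^sup>2) \<and>
    (\<integral>w. (\<Sum>i<n. (w i - 1 / r))\<^sup>2 \<partial>poisson_gaps r) = 1 / r\<^sup>2 * real n" for n
    unfolding poisson_gaps_eq_iid_seq
    using iid_seq_sum_second_moment[of "exp_law r" "1 / r" "1 / r\<^sup>2" n] exp_law_moments[OF r]
      E.prob_space E.prob_space_axioms by simp
  have eq: "(\<Sum>i<n. (w i - 1 / r)) = (\<Sum>i<n. w i) - 1 / r * real n" for w n
    by (simp add: sum_subtractf)
  have pos: "AE g in poisson_gaps r. \<forall>i. 0 < g i"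
    unfolding poisson_gaps_eq_iid_seq by (intro AE_iid_seq_all E.prob_space_axioms AE_exp_law_pos r)
  have "AE w in poisson_gaps r. (\<lambda>n. (\<Sum>i<n. w i) / real n) \<longlonglongrightarrow> 1 / r"
  proof (rule AE_LIMSEQ_of_second_moment[where C="1 / r\<^sup>2" and D=0])
    show "AE x in poisson_gaps r. \<forall>n. sum x {..<n} \<le> sum x {..<Suc n}"
      using pos by eventually_elim (auto intro: less_imp_le)
  qed (use * eq P.prob_space_axioms in auto)
  then show ?thesis
  proof eventually_elim
    case (elim w)
    \<comment> \<open>\<open>arrival g n\<close> is a sum of \<open>n + 1\<close> gaps but is
      divided by \<open>n\<close>.\<close>
    have "(\<lambda>n. (\<Sum>i<Suc n. w i) / real (Suc n) * (real (Suc n) / real n)) \<longlonglongrightarrow> 1 / r * 1"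
      by (intro tendsto_mult LIMSEQ_Suc[OF elim]) real_asymp
    then have "(\<lambda>n. (\<Sum>i<Suc n. w i) / real n) \<longlonglongrightarrow> 1 / r" by simp
    then show ?case by (simp only: arrival_def lessThan_Suc_atMost)
  qed
qed

lemma finite_arrivals:
  assumes "(\<lambda>n. arrival g n / real n) \<longlonglongrightarrow> a" "0 < a"
  shows "finite {n. arrival g n \<le> t}"
proof -
  have "filterlim (\<lambda>n. arrival g n / real n * real n) at_top sequentially"
    by (rule filterlim_tendsto_pos_mult_at_top[OF assms filterlim_real_sequentially])
  then have "\<forall>\<^sub>F n in sequentially. t + 1 \<le> arrival g n / real n * real n"
    unfolding filterlim_at_top by blast
  then obtain N where N: "\<And>n. n \<ge> N \<Longrightarrow> t + 1 \<le> arrival g n / real n * real n"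
    unfolding eventually_sequentially by blast
  have "{n. arrival g n \<le> t} \<subseteq> {..N}"
  proof
    fix n assume n: "n \<in> {n. arrival g n \<le> t}"
    show "n \<in> {..N}"
    proof (rule ccontr)
      assume "n \<notin> {..N}"
      then have "n > N" "n > 0" by auto
      with N[of n] n show False by simp
    qed
  qed
  then show ?thesis by (rule finite_subset) simp
qed

text \<open>On this event \<open>num_arrivals\<close> is a genuine count. Positivity and finiteness
  are what \<open>edge_state_less\<close> and \<open>edge_state_ge\<close> ask for when the process
  of an edge is split at its first refresh.\<close>

lemma AE_poisson_gaps_regular:
  assumes r: "0 < r"
  shows "AE g in poisson_gaps r. (\<forall>i. 0 < g i) \<and> (\<forall>t. finite {n. arrival g n \<le> t})"
proof -
  have "AE g in poisson_gaps r. \<forall>i. 0 < g i"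
    unfolding poisson_gaps_eq_iid_seq by (intro AE_iid_seq_all prob_space_exp_law AE_exp_law_pos r)
  with AE_arrival_LIMSEQ[OF r] show ?thesis
    by eventually_elim (use r in \<open>auto intro!: finite_arrivals\<close>)
qed

section \<open>The states of one edge at the times of its queries\<close>

definition edge_state :: "(nat \<Rightarrow> real) \<times> (nat \<Rightarrow> bool) \<Rightarrow> real \<Rightarrow> bool" where
  "edge_state z t = snd z (num_arrivals (fst z) t)"

lemma dyn_perc_eq: "dyn_perc \<xi> t e = edge_state (\<xi> e) t"
  by (simp add: dyn_perc_def edge_state_def split: prod.split)

lemma sets_poisson_gaps [measurable_cong]: "sets (poisson_gaps r) = sets (PiM UNIV (\<lambda>_. borel))"
  unfolding poisson_gaps_eq_iid_seq by (intro sets_PiM_cong) auto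

lemma sets_coin_flips [measurable_cong]: "sets (coin_flips q) = sets (PiM UNIV (\<lambda>_. count_space UNIV))"
  unfolding coin_flips_eq_iid_seq by (intro sets_PiM_cong) auto

lemma space_poisson_gaps [simp]: "space (poisson_gaps r) = UNIV"
  using sets_eq_imp_space_eq[OF sets_poisson_gaps] by (simp add: space_PiM)

lemma space_coin_flips [simp]: "space (coin_flips r) = UNIV"
  using sets_eq_imp_space_eq[OF sets_coin_flips] by (simp add: space_PiM)

lemma prob_space_poisson_gaps: "0 < r \<Longrightarrow> prob_space (poisson_gaps r)"
  unfolding poisson_gaps_eq_iid_seq by (intro prob_space_iid_seq prob_space_exp_law)

lemma prob_space_coin_flips: "prob_space (coin_flips q)"
  unfolding coin_flips_eq_iid_seq by (intro prob_space_iid_seq measure_pmf.prob_space_axioms)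

lemma case_nat_tail: "case_nat (f 0) (\<lambda>i. f (Suc i)) = f"
  by (auto simp: fun_eq_iff split: nat.split)

lemma sets_edge_law [measurable_cong]:
  "sets (poisson_gaps r \<Otimes>\<^sub>M coin_flips q)
    = sets (PiM UNIV (\<lambda>_. borel) \<Otimes>\<^sub>M PiM UNIV (\<lambda>_. count_space UNIV))"
  by (intro sets_pair_measure_cong sets_poisson_gaps sets_coin_flips)

lemma measurable_arrival [measurable (raw)]:
  assumes [measurable]: "f \<in> measurable N (PiM UNIV (\<lambda>_. borel))"
  shows "(\<lambda>x. arrival (f x) n) \<in> borel_measurable N"
  unfolding arrival_def by measurable

lemma measurable_num_arrivals [measurable (raw)]:
  assumes [measurable]: "f \<in> measurable N (PiM UNIV (\<lambda>_. borel))" "h \<in> borel_measurable N"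
  shows "(\<lambda>x. num_arrivals (f x) (h x)) \<in> measurable N (count_space UNIV)"
  unfolding num_arrivals_def by measurable

lemma measurable_edge_state [measurable (raw)]:
  assumes [measurable]: "f \<in> measurable N (PiM UNIV (\<lambda>_. borel) \<Otimes>\<^sub>M PiM UNIV (\<lambda>_. count_space UNIV))"
    "h \<in> borel_measurable N"
  shows "(\<lambda>x. edge_state (f x) (h x)) \<in> measurable N (count_space UNIV)"
  unfolding edge_state_def
  by (rule measurable_compose_countable[where f="\<lambda>i x. snd (f x) i"]) measurable

lemma edge_state_less:
  assumes "\<And>i. 0 < g i" "t < r"
  shows "edge_state (case_nat r g, case_nat a s) t = a"
proof -
  have "arrival (case_nat r g) n \<ge> r" for n
  proof (cases n)
    case (Suc m)
    have "0 \<le> arrival g m"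
      unfolding arrival_def using assms(1) by (intro sum_nonneg less_imp_le)
    then show ?thesis by (simp add: Suc arrival_case_nat)
  qed (simp add: arrival_case_nat)
  then have "{n. arrival (case_nat r g) n \<le> t} = {}"
    using assms(2) by (auto simp: not_le intro: less_le_trans)
  then show ?thesis by (simp add: edge_state_def num_arrivals_def)
qed

text \<open>Regeneration at the first refresh: afterwards the edge runs on the remaining gaps and
  coins. Without finiteness, \<open>card\<close> would return 0 and the shift by one would
  fail.\<close>

lemma edge_state_ge:
  assumes "finite {n. arrival g n \<le> t - r}" "r \<le> t"
  shows "edge_state (case_nat r g, case_nat a s) t = edge_state (g, s) (t - r)"
proof -
  have "{n. arrival (case_nat r g) n \<le> t} = insert 0 (Suc ` {n. arrival g n \<le> t - r})"
  proof (intro set_eqI)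
    fix n show "n \<in> {n. arrival (case_nat r g) n \<le> t} \<longleftrightarrow> n \<in> insert 0 (Suc ` {n. arrival g n \<le> t - r})"
      using assms(2) by (cases n) (auto simp: arrival_case_nat image_iff)
  qed
  then have "num_arrivals (case_nat r g) t = Suc (num_arrivals g (t - r))"
    unfolding num_arrivals_def using assms(1) by (simp add: card_insert_if card_image)
  then show ?thesis by (simp add: edge_state_def)
qed

text \<open>
  A query \<open>(e, b, g)\<close> records that the state \<open>b\<close> of the edge \<open>e\<close> is observed, and that time \<open>g\<close>
  passes before the next query.
\<close>

type_synonym query = "int \<times> bool \<times> real"

text \<open>Queries of other edges lose their answers but keep their waiting times. In this way a
  list of observations splits into conditions on single edges, which are independent.\<close>

fun obs1 :: "int \<Rightarrow> (real \<Rightarrow> bool) \<Rightarrow> real \<Rightarrow> query list \<Rightarrow> bool" where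
  "obs1 e \<sigma> t [] = True"
| "obs1 e \<sigma> t ((e', b, g) # qs) = ((e' = e \<longrightarrow> \<sigma> t = b) \<and> obs1 e \<sigma> (t + g) qs)"

fun obs :: "(real \<Rightarrow> int \<Rightarrow> bool) \<Rightarrow> real \<Rightarrow> query list \<Rightarrow> bool" where
  "obs \<eta> t [] = True"
| "obs \<eta> t ((e, b, g) # qs) = (\<eta> t e = b \<and> obs \<eta> (t + g) qs)"

definition gaps_nonneg :: "query list \<Rightarrow> bool" where
  "gaps_nonneg qs = (\<forall>q\<in>set qs. 0 \<le> snd (snd q))"

lemma gaps_nonneg_simps [simp]:
  "gaps_nonneg []" "gaps_nonneg ((e, b, g) # qs) \<longleftrightarrow> 0 \<le> g \<and> gaps_nonneg qs"
  by (auto simp: gaps_nonneg_def)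

text \<open>Nonnegative gaps keep all queries at or after the starting time, so agreement from then
  on suffices.\<close>

lemma obs1_cong:
  assumes "gaps_nonneg qs" "\<And>u. u \<ge> 0 \<Longrightarrow> \<sigma> (t + u) = \<sigma>' (t' + u)"
  shows "obs1 e \<sigma> t qs = obs1 e \<sigma>' t' qs"
  using assms
proof (induction qs arbitrary: t t')
  case (Cons q qs)
  obtain e' b g where q: "q = (e', b, g)" by (cases q)
  have "obs1 e \<sigma> (t + g) qs = obs1 e \<sigma>' (t' + g) qs"
  proof (rule Cons.IH)
    fix u :: real assume "u \<ge> 0"
    then show "\<sigma> (t + g + u) = \<sigma>' (t' + g + u)"
      using Cons.prems(2)[of "g + u"] Cons.prems(1) by (simp add: q add.assoc)
  qed (use Cons.prems q in auto)
  then show ?case using Cons.prems(2)[of 0] by (simp add: q)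
qed simp

lemma obs_iff_obs1:
  assumes "fst ` set qs \<subseteq> E"
  shows "obs \<eta> t qs \<longleftrightarrow> (\<forall>e\<in>E. obs1 e (\<lambda>t. \<eta> t e) t qs)"
  using assms by (induction qs arbitrary: t) auto

text \<open>
  What is known about the state of an edge: nothing (its state is a fresh coin), or the state \<open>b\<close>
  observed a time \<open>s\<close> ago, or the state \<open>b\<close> together with the remaining time \<open>l\<close> until the next
  refresh.
\<close>

datatype info = Unknown | Observed bool real | Valid bool real

fun age :: "real \<Rightarrow> info \<Rightarrow> info" where
  "age g Unknown = Unknown"
| "age g (Observed b s) = Observed b (s + g)"
| "age g (Valid b l) = Valid b (l - g)"

locale percolation =
  fixes \<mu> p :: real
  assumes \<mu>: "0 < \<mu>" and p: "0 < p" "p < 1"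
begin

abbreviation "bern \<equiv> measure_pmf (bernoulli_pmf p)"

abbreviation "edge_law \<equiv> poisson_gaps \<mu> \<Otimes>\<^sub>M coin_flips p"

definition coin_prob :: "bool \<Rightarrow> real" where "coin_prob b = (if b then p else 1 - p)"

lemma integral_bern: "(\<integral>a. f a \<partial>bern) = p * f True + (1 - p) * f False" for f :: "bool \<Rightarrow> real"
  using p by simp

text \<open>The clause for \<open>Observed\<close> is the transition probability of the two-state
  chain of one edge: either no refresh occurred during \<open>s\<close>, or the state is a fresh
  coin.\<close>

fun query_prob :: "info \<Rightarrow> bool \<Rightarrow> real" where
  "query_prob Unknown b = coin_prob b"
| "query_prob (Observed b' s) b
    = exp (- \<mu> * s) * of_bool (b = b') + (1 - exp (- \<mu> * s)) * coin_prob b"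
| "query_prob (Valid b' l) b = (if l > 0 then of_bool (b = b') else coin_prob b)"

fun weight1 :: "int \<Rightarrow> info \<Rightarrow> query list \<Rightarrow> real" where
  "weight1 e i [] = 1"
| "weight1 e i ((e', b, g) # qs) =
    (if e' = e then query_prob i b * weight1 e (Observed b g) qs else weight1 e (age g i) qs)"

text \<open>By the Markov property of a single edge only its latest answer matters, so a query
  overwrites the information on its edge, while all other information ages.\<close>

fun weight :: "(int \<Rightarrow> info) \<Rightarrow> query list \<Rightarrow> real" where
  "weight I [] = 1"
| "weight I ((e, b, g) # qs) = query_prob (I e) b * weight ((age g \<circ> I)(e := Observed b g)) qs"

text \<open>Independence of the edges: a query contributes to the factor of its own edge and merely
  ages the others.\<close>

lemma weight_eq_prod:
  assumes "finite E" "fst ` set qs \<subseteq> E"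
  shows "weight I qs = (\<Prod>e\<in>E. weight1 e (I e) qs)"
  using assms(2)
proof (induction qs arbitrary: I)
  case (Cons q qs)
  obtain e' b g where q: "q = (e', b, g)" by (cases q)
  have e': "e' \<in> E" using Cons.prems q by auto
  let ?I = "(age g \<circ> I)(e' := Observed b g)"
  have "weight I (q # qs) = query_prob (I e') b * (\<Prod>e\<in>E. weight1 e (?I e) qs)"
    using Cons by (simp add: q)
  also have "\<dots> = (query_prob (I e') b * weight1 e' (?I e') qs) * (\<Prod>e\<in>E - {e'}. weight1 e (?I e) qs)"
    using e' assms(1) by (simp add: prod.remove)
  also have "\<dots> = weight1 e' (I e') (q # qs) * (\<Prod>e\<in>E - {e'}. weight1 e (I e) (q # qs))"
    by (simp add: q cong: prod.cong) (auto intro!: prod.cong)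
  also have "\<dots> = (\<Prod>e\<in>E. weight1 e (I e) (q # qs))"
    using e' assms(1) by (simp add: prod.remove)
  finally show ?case .
qed simp

lemma prob_space_edge_law: "prob_space edge_law"
  by (intro prob_space_pair prob_space_poisson_gaps prob_space_coin_flips \<mu>)

lemma AE_edge_law:
  "AE z in edge_law. (\<forall>i. 0 < fst z i) \<and> (\<forall>t. finite {n. arrival (fst z) n \<le> t})"
proof -
  interpret C: prob_space "coin_flips p" by (rule prob_space_coin_flips)
  have "AE x in distr edge_law (poisson_gaps \<mu>) fst. (\<forall>i. 0 < x i) \<and> (\<forall>t. finite {n. arrival x n \<le> t})"
    using AE_poisson_gaps_regular[OF \<mu>] by (subst C.distr_pair_fst)
  then show ?thesis by (rule AE_distrD[rotated]) simp
qed

text \<open>Conditioning on the first refresh time and the initial state; what is left has the law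
  of an edge again. This is the source of the renewal equation.\<close>

lemma integral_edge_law_first:
  fixes f :: "(nat \<Rightarrow> real) \<times> (nat \<Rightarrow> bool) \<Rightarrow> real"
  assumes f [measurable]: "f \<in> borel_measurable edge_law" and B: "\<And>x. \<bar>f x\<bar> \<le> B"
  shows "(\<integral>z. f z \<partial>edge_law)
    = (\<integral>r. \<integral>a. \<integral>z. f (case_nat r (fst z), case_nat a (snd z)) \<partial>edge_law \<partial>bern \<partial>exp_law \<mu>)"
proof -
  interpret G: prob_space "poisson_gaps \<mu>" by (rule prob_space_poisson_gaps[OF \<mu>])
  interpret C: prob_space "coin_flips p" by (rule prob_space_coin_flips)
  have B0: "0 \<le> B" using B abs_ge_zero order_trans by blast
  have abs_int: "\<bar>\<integral>x. h x \<partial>M\<bar> \<le> B" if "prob_space M" "\<And>x. \<bar>h x\<bar> \<le> B" for M :: "'x measure" and h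
    using that B0 by (intro abs_integral_le) auto
  have "(\<integral>z. f z \<partial>edge_law) = (\<integral>g. \<integral>s. f (g, s) \<partial>coin_flips p \<partial>poisson_gaps \<mu>)"
    by (intro integral_pair_iterated(1)[OF _ _ f B]) unfold_locales
  also have "\<dots> = (\<integral>r. \<integral>g. \<integral>s. f (case_nat r g, s) \<partial>coin_flips p \<partial>poisson_gaps \<mu> \<partial>exp_law \<mu>)"
    unfolding poisson_gaps_eq_iid_seq
    by (intro integral_iid_seq_first[where B=B] prob_space_exp_law \<mu> abs_int C.prob_space_axioms B)
       (simp add: poisson_gaps_eq_iid_seq[symmetric])
  also have "\<dots> = (\<integral>r. \<integral>a. \<integral>z. f (case_nat r (fst z), case_nat a (snd z)) \<partial>edge_law \<partial>bern \<partial>exp_law \<mu>)"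
  proof (rule Bochner_Integration.integral_cong[OF refl])
    fix r :: real
    have m: "(\<lambda>w. f (case_nat r g, w)) \<in> borel_measurable (coin_flips p)" for g by measurable
    have "(\<integral>g. \<integral>s. f (case_nat r g, s) \<partial>coin_flips p \<partial>poisson_gaps \<mu>)
        = (\<integral>g. \<integral>a. \<integral>s. f (case_nat r g, case_nat a s) \<partial>coin_flips p \<partial>bern \<partial>poisson_gaps \<mu>)"
    proof (rule Bochner_Integration.integral_cong[OF refl])
      fix g
      show "(\<integral>s. f (case_nat r g, s) \<partial>coin_flips p)
          = (\<integral>a. \<integral>s. f (case_nat r g, case_nat a s) \<partial>coin_flips p \<partial>bern)"
        using m[of g] unfolding coin_flips_eq_iid_seq
        by (intro integral_iid_seq_first[where B=B] measure_pmf.prob_space_axioms B)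
    qed
    also have "\<dots> = (\<integral>a. \<integral>g. \<integral>s. f (case_nat r g, case_nat a s) \<partial>coin_flips p \<partial>poisson_gaps \<mu> \<partial>bern)"
    proof -
      define h where "h x = (\<integral>s. f (case_nat r (fst x), case_nat (snd x) s) \<partial>coin_flips p)" for x
      have hm: "h \<in> borel_measurable (poisson_gaps \<mu> \<Otimes>\<^sub>M bern)"
        unfolding h_def by measurable
      have hB: "\<bar>h x\<bar> \<le> B" for x
        unfolding h_def by (intro abs_int C.prob_space_axioms B)
      show ?thesis
        using integral_pair_iterated[OF G.prob_space_axioms measure_pmf.prob_space_axioms hm hB]
        by (simp add: h_def)
    qed
    also have "\<dots> = (\<integral>a. \<integral>z. f (case_nat r (fst z), case_nat a (snd z)) \<partial>edge_law \<partial>bern)"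
    proof (rule Bochner_Integration.integral_cong[OF refl])
      fix a
      show "(\<integral>g. \<integral>s. f (case_nat r g, case_nat a s) \<partial>coin_flips p \<partial>poisson_gaps \<mu>)
         = (\<integral>z. f (case_nat r (fst z), case_nat a (snd z)) \<partial>edge_law)"
        by (subst integral_pair_iterated(1)[where B=B])
          (auto intro!: G.prob_space_axioms C.prob_space_axioms B)
    qed
    finally show "(\<integral>g. \<integral>s. f (case_nat r g, s) \<partial>coin_flips p \<partial>poisson_gaps \<mu>) = \<dots>" .
  qed
  finally show ?thesis .
qed

end

lemma measurable_obs1 [measurable (raw)]:
  assumes [measurable]: "f \<in> measurable N (PiM UNIV (\<lambda>_. borel) \<Otimes>\<^sub>M PiM UNIV (\<lambda>_. count_space UNIV))"
    "h \<in> borel_measurable N"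
  shows "Measurable.pred N (\<lambda>x. obs1 e (edge_state (f x)) (h x) qs)"
  using assms(2)
proof (induction qs arbitrary: h)
  case (Cons q qs)
  obtain e' b g where q: "q = (e', b, g)" by (cases q)
  have [measurable]: "Measurable.pred N (\<lambda>x. obs1 e (edge_state (f x)) (h x + g) qs)"
    "h \<in> borel_measurable N"
    using Cons by (auto intro!: Cons.IH)
  show ?case unfolding q obs1.simps by measurable
qed simp

context percolation
begin

section \<open>Observation probabilities of one edge: renewal equation and stationarity\<close>

definition obs_prob :: "int \<Rightarrow> query list \<Rightarrow> real \<Rightarrow> real" where
  "obs_prob e qs t = (\<integral>z. of_bool (obs1 e (edge_state z) t qs) \<partial>edge_law)"

text \<open>The initial state is fixed at time 0 while the observations start at \<open>t\<close>.
  Together with \<open>obs_prob\<close> this closes the induction over queries: a query at time 0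
  turns the latter into the former.\<close>

definition obs_prob_init :: "int \<Rightarrow> query list \<Rightarrow> bool \<Rightarrow> real \<Rightarrow> real" where
  "obs_prob_init e qs b t = (\<integral>z. of_bool (snd z 0 = b \<and> obs1 e (edge_state z) t qs) \<partial>edge_law)"

lemma obs_prob_bounds: "\<bar>obs_prob e qs t\<bar> \<le> 1"
  unfolding obs_prob_def by (intro abs_integral_le prob_space_edge_law) auto

lemma obs_prob_measurable [measurable]: "obs_prob e qs \<in> borel_measurable borel"
proof -
  interpret prob_space edge_law by (rule prob_space_edge_law)
  show ?thesis
    unfolding obs_prob_def[abs_def]
    by (rule borel_measurable_lebesgue_integral) (simp only: case_prod_beta', measurable)
qed

text \<open>If the first refresh comes after \<open>t\<close>, moving the start to 0 only shortens
  the waiting time to \<open>r - t\<close>; otherwise the initial state is never seen and the edge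
  starts afresh at \<open>r\<close>.\<close>

lemma obs_first_step:
  assumes qs: "gaps_nonneg qs" and t: "0 \<le> t"
  shows "AE r in exp_law \<mu>. \<forall>a. AE z in edge_law.
    obs1 e (edge_state (case_nat r (fst z), case_nat a (snd z))) t qs \<longleftrightarrow>
      (if t < r then obs1 e (edge_state (case_nat (r - t) (fst z), case_nat a (snd z))) 0 qs
       else obs1 e (edge_state z) (t - r) qs)"
  using AE_exp_law_pos[OF \<mu>]
proof eventually_elim
  case (elim r)
  show ?case
  proof (rule allI)
    fix a
    show "AE z in edge_law.
    obs1 e (edge_state (case_nat r (fst z), case_nat a (snd z))) t qs \<longleftrightarrow>
      (if t < r then obs1 e (edge_state (case_nat (r - t) (fst z), case_nat a (snd z))) 0 qs
       else obs1 e (edge_state z) (t - r) qs)"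
      using AE_edge_law
    proof eventually_elim
      case z: (elim z)
      show ?case
      proof (cases "t < r")
        case True
        have "edge_state (case_nat r (fst z), case_nat a (snd z)) (t + u) =
            edge_state (case_nat (r - t) (fst z), case_nat a (snd z)) (0 + u)" if "u \<ge> 0" for u
        proof (cases "t + u < r")
          case True
          then show ?thesis
            using z edge_state_less[of "fst z" "t + u" r] edge_state_less[of "fst z" u "r - t"] by simp
        next
          case False
          have "edge_state (case_nat r (fst z), case_nat a (snd z)) (t + u)
              = edge_state (fst z, snd z) (t + u - r)"
            by (rule edge_state_ge) (use z False in auto)
          moreover have "edge_state (case_nat (r - t) (fst z), case_nat a (snd z)) u
              = edge_state (fst z, snd z) (u - (r - t))"
            by (rule edge_state_ge) (use z False in auto)
          ultimately show ?thesis by (simp add: algebra_simps)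
        qed
        then have "obs1 e (edge_state (case_nat r (fst z), case_nat a (snd z))) t qs
          = obs1 e (edge_state (case_nat (r - t) (fst z), case_nat a (snd z))) 0 qs"
          by (rule obs1_cong[OF qs])
        then show ?thesis using True by simp
      next
        case False
        have "edge_state (case_nat r (fst z), case_nat a (snd z)) (t + u) = edge_state z (t - r + u)"
          if "u \<ge> 0" for u
        proof -
          have "edge_state (case_nat r (fst z), case_nat a (snd z)) (t + u)
              = edge_state (fst z, snd z) (t + u - r)"
            by (rule edge_state_ge) (use z False that in auto)
          then show ?thesis by (simp add: algebra_simps)
        qed
        then have "obs1 e (edge_state (case_nat r (fst z), case_nat a (snd z))) t qs
          = obs1 e (edge_state z) (t - r) qs"
          by (rule obs1_cong[OF qs])
        then show ?thesis using False by simp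
      qed
    qed
  qed
qed

text \<open>The renewal equation, obtained by conditioning on the first refresh.\<close>

lemma obs_prob_renewal:
  assumes qs: "gaps_nonneg qs" and t: "0 \<le> t"
  shows "obs_prob e qs t = exp (- \<mu> * t) * obs_prob e qs 0
      + (\<integral>r. (if t < r then 0 else obs_prob e qs (t - r)) \<partial>exp_law \<mu>)" (is ?A)
    and "obs_prob_init e qs b t = exp (- \<mu> * t) * obs_prob_init e qs b 0
      + coin_prob b * (\<integral>r. (if t < r then 0 else obs_prob e qs (t - r)) \<partial>exp_law \<mu>)" (is ?B)
proof -
  interpret E: prob_space "exp_law \<mu>" by (rule prob_space_exp_law[OF \<mu>])
  interpret L: prob_space edge_law by (rule prob_space_edge_law)
  \<comment> \<open>Both claims are instances: \<open>P\<close> is trivial for the first and fixes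
    the initial state for the second.\<close>
  have gen: "(\<integral>z. of_bool (P (snd z 0) \<and> obs1 e (edge_state z) t qs) \<partial>edge_law)
      = exp (- \<mu> * t) * (\<integral>z. of_bool (P (snd z 0) \<and> obs1 e (edge_state z) 0 qs) \<partial>edge_law)
        + (\<integral>a. of_bool (P a) \<partial>bern) * (\<integral>r. (if t < r then 0 else obs_prob e qs (t - r)) \<partial>exp_law \<mu>)"
    for P :: "bool \<Rightarrow> bool"
  proof -
    \<comment> \<open>\<open>G r\<close> is the contribution of a first refresh at time
      \<open>r\<close> to observations starting at 0. By memorylessness, the event that no refresh
      precedes \<open>t\<close> contributes \<open>exp (- \<mu> * t)\<close> times its mean.\<close>
    define G where "G r = (\<integral>a. \<integral>z. of_bool (P a \<and>
        obs1 e (edge_state (case_nat r (fst z), case_nat a (snd z))) 0 qs) \<partial>edge_law \<partial>bern :: real)" for r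
    have Gm [measurable]: "G \<in> borel_measurable borel"
    proof -
      have "(\<lambda>r. \<integral>z. of_bool (P a \<and>
          obs1 e (edge_state (case_nat r (fst z), case_nat a (snd z))) 0 qs) \<partial>edge_law :: real) \<in> borel_measurable borel" for a
        by (rule L.borel_measurable_lebesgue_integral) (simp only: case_prod_beta', measurable)
      then show ?thesis unfolding G_def integral_bern by measurable
    qed
    have GB: "\<bar>G r\<bar> \<le> 1" for r
      unfolding G_def by (intro abs_integral_le measure_pmf.prob_space_axioms AE_I2 prob_space_edge_law) auto
    have IG: "(\<integral>r. G r \<partial>exp_law \<mu>) = (\<integral>z. of_bool (P (snd z 0) \<and> obs1 e (edge_state z) 0 qs) \<partial>edge_law)"
      unfolding G_def by (subst integral_edge_law_first[where B=1]) auto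
    define c where "c = (\<integral>a. of_bool (P a) \<partial>bern :: real)"
    have "(\<integral>z. of_bool (P (snd z 0) \<and> obs1 e (edge_state z) t qs) \<partial>edge_law :: real)
      = (\<integral>r. \<integral>a. \<integral>z. of_bool (P a \<and> obs1 e (edge_state (case_nat r (fst z), case_nat a (snd z))) t qs)
          \<partial>edge_law \<partial>bern \<partial>exp_law \<mu>)"
      by (subst integral_edge_law_first[where B=1]) auto
    also have "\<dots> = (\<integral>r. (if t < r then G (r - t) else 0)
        + c * (if t < r then 0 else obs_prob e qs (t - r)) \<partial>exp_law \<mu>)"
    proof (rule integral_cong_AE)
      show "AE r in exp_law \<mu>. (\<integral>a. \<integral>z. of_bool (P a \<and>
          obs1 e (edge_state (case_nat r (fst z), case_nat a (snd z))) t qs) \<partial>edge_law \<partial>bern)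
        = (if t < r then G (r - t) else 0) + c * (if t < r then 0 else obs_prob e qs (t - r))"
        using obs_first_step[OF qs t, of e]
      proof eventually_elim
        case (elim r)
        have "(\<integral>z. of_bool (P a \<and> obs1 e (edge_state (case_nat r (fst z), case_nat a (snd z))) t qs) \<partial>edge_law)
          = (\<integral>z. of_bool (P a \<and> (if t < r then obs1 e (edge_state (case_nat (r - t) (fst z), case_nat a (snd z))) 0 qs
            else obs1 e (edge_state z) (t - r) qs)) \<partial>edge_law :: real)" for a
          using elim[rule_format, of a] by (intro integral_cong_AE) (auto elim!: eventually_mono)
        then have "(\<integral>a. \<integral>z. of_bool (P a \<and> obs1 e (edge_state (case_nat r (fst z), case_nat a (snd z))) t qs) \<partial>edge_law \<partial>bern)
          = (\<integral>a. (\<integral>z. of_bool (P a \<and> (if t < r then obs1 e (edge_state (case_nat (r - t) (fst z), case_nat a (snd z))) 0 qs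
            else obs1 e (edge_state z) (t - r) qs)) \<partial>edge_law :: real) \<partial>bern)"
          by simp
        also have "\<dots> = (if t < r then G (r - t) else 0) + c * (if t < r then 0 else obs_prob e qs (t - r))"
          by (cases "P True"; cases "P False")
             (simp_all add: G_def c_def integral_bern obs_prob_def algebra_simps)
        finally show ?case .
      qed
    qed (unfold integral_bern, measurable)
    also have "\<dots> = (\<integral>r. (if t < r then G (r - t) else 0) \<partial>exp_law \<mu>)
        + c * (\<integral>r. (if t < r then 0 else obs_prob e qs (t - r)) \<partial>exp_law \<mu>)"
      by (subst Bochner_Integration.integral_add)
         (auto intro!: integrable_mult_right integrable_bounded[of _ _ 1] E.prob_space_axioms
           simp: GB obs_prob_bounds)
    also have "(\<integral>r. (if t < r then G (r - t) else 0) \<partial>exp_law \<mu>) = exp (- \<mu> * t) * (\<integral>r. G r \<partial>exp_law \<mu>)"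
      by (intro integral_exp_law_tail \<mu> t Gm)
    finally show ?thesis unfolding IG c_def .
  qed
  show ?A using gen[of "\<lambda>_. True"] by (simp add: obs_prob_def)
  show ?B
    using gen[of "\<lambda>a. a = b"] by (cases b) (simp_all add: obs_prob_init_def integral_bern coin_prob_def)
qed

text \<open>By the renewal equation, the deviation from the value at 0 at time \<open>s\<close>
  averages deviations at earlier times with total mass \<open>1 - exp (- \<mu> * s)\<close>, which
  is less than 1. The supremum of the deviation over \<open>{0..t}\<close> is therefore bounded by a
  proper fraction of itself and vanishes.\<close>

lemma obs_prob_stationary:
  assumes qs: "gaps_nonneg qs" and t: "0 \<le> t"
  shows "obs_prob e qs t = obs_prob e qs 0"
proof -
  interpret E: prob_space "exp_law \<mu>" by (rule prob_space_exp_law[OF \<mu>])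
  let ?F = "obs_prob e qs"
  define S where "S = (SUP s\<in>{0..t}. \<bar>?F s - ?F 0\<bar>)"
  have bdd: "bdd_above ((\<lambda>s. \<bar>?F s - ?F 0\<bar>) ` {0..t})"
  proof (rule bdd_aboveI2[of _ _ 2])
    fix s show "\<bar>?F s - ?F 0\<bar> \<le> 2"
      using obs_prob_bounds[of e qs s] obs_prob_bounds[of e qs 0] by linarith
  qed
  have S: "\<bar>?F s - ?F 0\<bar> \<le> S" if "0 \<le> s" "s \<le> t" for s
    unfolding S_def using that bdd by (intro cSUP_upper) auto
  have S0: "0 \<le> S" using S[of 0] t by simp
  have "S \<le> (1 - exp (- \<mu> * t)) * S"
    unfolding S_def[of] proof (rule cSUP_least)
    fix s assume s: "s \<in> {0..t}"
    then have s0: "0 \<le> s" "s \<le> t" by auto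
    have i1: "integrable (exp_law \<mu>) (\<lambda>r. if s < r then 0 else ?F (s - r))"
      by (intro integrable_bounded[of _ _ 1] E.prob_space_axioms)
        (auto simp: obs_prob_bounds)
    have i2: "integrable (exp_law \<mu>) (\<lambda>r. if s < r then 0 else ?F 0)"
      by (intro integrable_bounded[of _ _ 1] E.prob_space_axioms)
        (auto simp: obs_prob_bounds)
    have "?F s - ?F 0 = (\<integral>r. (if s < r then 0 else ?F (s - r)) \<partial>exp_law \<mu>)
        - (\<integral>r. (if s < r then 0 else ?F 0) \<partial>exp_law \<mu>)"
      using obs_prob_renewal(1)[OF qs s0(1), of e] integral_exp_law_if_less[OF \<mu> s0(1), of 0 "?F 0"]
      by (simp add: algebra_simps)
    also have "\<dots> = (\<integral>r. (if s < r then 0 else ?F (s - r)) - (if s < r then 0 else ?F 0) \<partial>exp_law \<mu>)"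
      using i1 i2 by simp
    finally have "\<bar>?F s - ?F 0\<bar> \<le> (\<integral>r. \<bar>(if s < r then 0 else ?F (s - r)) - (if s < r then 0 else ?F 0)\<bar> \<partial>exp_law \<mu>)"
      by (simp add: integral_abs_bound)
    also have "\<dots> \<le> (\<integral>r. (if s < r then 0 else S) \<partial>exp_law \<mu>)"
    proof (rule integral_mono_AE)
      show "integrable (exp_law \<mu>) (\<lambda>r. if s < r then 0 else S)"
        by (intro integrable_bounded[of _ _ S] E.prob_space_axioms) (auto simp: S0)
      show "AE r in exp_law \<mu>. \<bar>(if s < r then 0 else ?F (s - r)) - (if s < r then 0 else ?F 0)\<bar>
          \<le> (if s < r then 0 else S)"
        using AE_exp_law_pos[OF \<mu>] by eventually_elim (use s0 in \<open>auto intro!: S\<close>)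
    qed (use i1 i2 in simp)
    also have "\<dots> = (1 - exp (- \<mu> * s)) * S"
      using integral_exp_law_if_less[OF \<mu> s0(1), of 0 S] by simp
    also have "\<dots> \<le> (1 - exp (- \<mu> * t)) * S"
      using s0 S0 \<mu> by (intro mult_right_mono) auto
    finally show "\<bar>?F s - ?F 0\<bar> \<le> (1 - exp (- \<mu> * t)) * (SUP s\<in>{0..t}. \<bar>?F s - ?F 0\<bar>)"
      by (simp add: S_def)
  qed (use t in auto)
  then have "exp (- \<mu> * t) * S \<le> 0" by (simp add: algebra_simps)
  then have "S \<le> 0" by (simp add: mult_le_0_iff)
  then show ?thesis using S[of t] t by simp
qed

text \<open>Stationarity makes the renewal integral explicit; the result has the shape of
  \<open>query_prob\<close> for \<open>Observed\<close>.\<close>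

lemma obs_prob_init_eq:
  assumes qs: "gaps_nonneg qs" and t: "0 \<le> t"
  shows "obs_prob_init e qs b t = exp (- \<mu> * t) * obs_prob_init e qs b 0
      + (1 - exp (- \<mu> * t)) * coin_prob b * obs_prob e qs 0"
proof -
  interpret E: prob_space "exp_law \<mu>" by (rule prob_space_exp_law[OF \<mu>])
  have "(\<integral>r. (if t < r then 0 else obs_prob e qs (t - r)) \<partial>exp_law \<mu>)
      = (\<integral>r. (if t < r then 0 else obs_prob e qs 0) \<partial>exp_law \<mu>)"
    by (intro Bochner_Integration.integral_cong) (auto intro!: obs_prob_stationary[OF qs])
  also have "\<dots> = (1 - exp (- \<mu> * t)) * obs_prob e qs 0"
    unfolding integral_exp_law_if_less[OF \<mu> t] by simp
  finally show ?thesis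
    unfolding obs_prob_renewal(2)[OF qs t] by simp
qed

text \<open>Induction over the queries. A query of another edge shifts time by \<open>g\<close>,
  which is ageing; for a query of \<open>e\<close> itself, the formulas for general \<open>t\<close>
  reduce both probabilities to \<open>t = 0\<close>.\<close>

lemma obs_prob_eq_weight1:
  assumes "gaps_nonneg qs"
  shows "(\<forall>t\<ge>0. obs_prob e qs t = weight1 e Unknown qs) \<and>
    (\<forall>t\<ge>0. \<forall>b. obs_prob_init e qs b t = coin_prob b * weight1 e (Observed b t) qs)"
  using assms
proof (induction qs)
  case Nil
  interpret L: prob_space edge_law by (rule prob_space_edge_law)
  have "obs_prob_init e [] b t = coin_prob b" for b t
  proof -
    have "obs_prob_init e [] b t = (\<integral>r. \<integral>a. \<integral>z. of_bool (a = b) \<partial>edge_law \<partial>bern \<partial>exp_law \<mu>)"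
      unfolding obs_prob_init_def by (subst integral_edge_law_first[where B=1]) auto
    also have "\<dots> = coin_prob b"
      using prob_space.prob_space[OF prob_space_exp_law[OF \<mu>]]
      by (cases b) (simp_all add: L.prob_space integral_bern coin_prob_def)
    finally show ?thesis .
  qed
  then show ?case by (simp add: obs_prob_def L.prob_space)
next
  case (Cons q qs)
  obtain e' b' g where q: "q = (e', b', g)" by (cases q)
  have g: "0 \<le> g" and qs: "gaps_nonneg qs" using Cons.prems by (auto simp: q)
  note IH = Cons.IH[OF qs]
  show ?case
  proof (cases "e' = e")
    case False
    have "obs_prob e (q # qs) t = obs_prob e qs (t + g)"
      "obs_prob_init e (q # qs) b t = obs_prob_init e qs b (t + g)" for t b
      using False by (simp_all add: obs_prob_def obs_prob_init_def q)
    then show ?thesis using IH False g by (simp add: q)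
  next
    case True
    have s0: "AE z in edge_law. edge_state z 0 = snd z 0"
      using AE_edge_law
    proof eventually_elim
      case (elim z)
      have "edge_state (case_nat (fst z 0) (\<lambda>i. fst z (Suc i)), case_nat (snd z 0) (\<lambda>i. snd z (Suc i))) 0 = snd z 0"
        using elim by (intro edge_state_less) auto
      then show ?case by (simp add: case_nat_tail)
    qed
    \<comment> \<open>At time 0 the query reads the initial state, and the remaining queries start a
      time \<open>g\<close> later.\<close>
    have F0: "obs_prob e (q # qs) 0 = coin_prob b' * weight1 e (Observed b' g) qs"
    proof -
      have "obs_prob e (q # qs) 0 = obs_prob_init e qs b' g"
        unfolding obs_prob_def obs_prob_init_def
        by (rule integral_cong_AE) (use s0 True in \<open>auto simp: q elim!: eventually_mono\<close>)
      then show ?thesis using IH g by simp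
    qed
    have F1: "obs_prob_init e (q # qs) b 0 = of_bool (b = b') * (coin_prob b' * weight1 e (Observed b' g) qs)" for b
    proof -
      have "obs_prob_init e (q # qs) b 0 = of_bool (b = b') * obs_prob_init e qs b' g"
        unfolding obs_prob_init_def integral_mult_right_zero[symmetric]
        by (rule integral_cong_AE) (use s0 True in \<open>auto simp: q elim!: eventually_mono\<close>)
      then show ?thesis using IH g by simp
    qed
    have "obs_prob e (q # qs) t = weight1 e Unknown (q # qs)" if "t \<ge> 0" for t
      using obs_prob_stationary[OF Cons.prems that, of e] F0 True by (simp add: q)
    moreover have "obs_prob_init e (q # qs) b t = coin_prob b * weight1 e (Observed b t) (q # qs)" if "t \<ge> 0" for t b
      using obs_prob_init_eq[OF Cons.prems that, of e b] F0 F1[of b] True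
      by (auto simp add: q algebra_simps)
    ultimately show ?thesis by blast
  qed
qed

lemma env_obs_prob:
  assumes qs: "gaps_nonneg qs" and t: "0 \<le> t"
  shows "measure (env_measure \<mu> p) {\<xi>. obs (dyn_perc \<xi>) t qs} = weight (\<lambda>_. Unknown) qs"
proof -
  interpret L: prob_space edge_law by (rule prob_space_edge_law)
  interpret product_prob_space "\<lambda>_. edge_law" "UNIV :: int set" ..
  define E where "E = fst ` set qs"
  define A where "A e = {z. obs1 e (edge_state z) t qs}" for e
  have nonneg: "0 \<le> weight1 e Unknown qs" for e
    using obs_prob_eq_weight1[OF qs, of e] integral_nonneg_AE[of "\<lambda>z. of_bool (obs1 e (edge_state z) 0 qs)" edge_law]
    by (simp add: obs_prob_def[symmetric])
  have spL: "space edge_law = UNIV" by (simp add: space_pair_measure)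
  have A [measurable]: "A e \<in> sets edge_law" for e
  proof -
    have "{z\<in>space edge_law. obs1 e (edge_state z) t qs} \<in> sets edge_law" by measurable
    then show ?thesis by (simp add: A_def spL)
  qed
  have spE: "space (env_measure \<mu> p) = UNIV"
    by (auto simp: env_measure_def space_PiM space_pair_measure)
  have "{\<xi>. obs (dyn_perc \<xi>) t qs} = {\<xi>\<in>space (PiM UNIV (\<lambda>_. edge_law)). \<forall>e\<in>E. \<xi> e \<in> A e}"
    using obs_iff_obs1[of qs E "dyn_perc \<xi>" t for \<xi>] spE
    by (auto simp: E_def A_def dyn_perc_eq[abs_def] env_measure_def)
  then have "emeasure (env_measure \<mu> p) {\<xi>. obs (dyn_perc \<xi>) t qs} = (\<Prod>e\<in>E. emeasure edge_law (A e))"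
    unfolding env_measure_def using emeasure_PiM_Collect[of E A] by (simp only:) (simp add: E_def)
  also have "\<dots> = (\<Prod>e\<in>E. ennreal (weight1 e Unknown qs))"
  proof (rule prod.cong[OF refl])
    fix e
    have "measure edge_law (A e) = (\<integral>z. indicator (A e) z \<partial>edge_law)" by (simp add: spL)
    also have "\<dots> = obs_prob e qs t"
      unfolding obs_prob_def A_def by (intro Bochner_Integration.integral_cong) (auto simp: indicator_def)
    finally show "emeasure edge_law (A e) = ennreal (weight1 e Unknown qs)"
      using obs_prob_eq_weight1[OF qs, of e] t by (simp add: L.emeasure_eq_measure)
  qed
  also have "\<dots> = ennreal (weight (\<lambda>_. Unknown) qs)"
    using nonneg by (subst prod_ennreal) (auto simp: weight_eq_prod[of E qs] E_def)
  finally show ?thesis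
    using nonneg by (simp add: measure_def weight_eq_prod[of E qs] E_def prod_nonneg)
qed

end

section \<open>Lazy exploration of the environment by two walkers\<close>

text \<open>
  \<open>K e = (b, l)\<close>: the last query of \<open>e\<close> gave \<open>b\<close>, and this remains valid for time \<open>l\<close>.
\<close>

type_synonym memory = "int \<Rightarrow> bool \<times> real"
type_synonym state = "int \<times> int \<times> memory"
type_synonym token = "real \<times> bool"

definition answer :: "memory \<Rightarrow> int \<Rightarrow> bool \<Rightarrow> bool" where
  "answer K e B = (if 0 < snd (K e) then fst (K e) else B)"

definition move :: "int \<Rightarrow> bool \<Rightarrow> bool \<Rightarrow> int" where
  "move x d b = (if b then (if d then x + 1 else x - 1) else x)"

definition edge :: "int \<Rightarrow> bool \<Rightarrow> int" where
  "edge x d = (if d then x else x - 1)"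

definition elapse :: "real \<Rightarrow> memory \<Rightarrow> memory" where
  "elapse g K = (\<lambda>e. (fst (K e), snd (K e) - g))"

text \<open>The second walker queries after the first has written its answer; so on a common edge
  both get the same answer once the first validity time is positive. Every query writes a new
  validity time, even if it was answered from memory: by memorylessness this does not alter the
  law.\<close>

definition step :: "bool \<times> bool \<Rightarrow> real \<Rightarrow> state \<Rightarrow> token \<times> token \<Rightarrow> state" where
  "step d g st tok =
    (let x = fst st; y = fst (snd st); K = snd (snd st);
         e = edge x (fst d); b = answer K e (snd (fst tok)); K1 = K(e := (b, fst (fst tok)));
         e' = edge y (snd d); b' = answer K1 e' (snd (snd tok)); K2 = K1(e' := (b', fst (snd tok)))
     in (move x (fst d) b, move y (snd d) b', elapse g K2))"

fun run :: "(nat \<Rightarrow> bool \<times> bool) \<Rightarrow> (nat \<Rightarrow> real) \<Rightarrow> state \<Rightarrow> (nat \<Rightarrow> token \<times> token) \<Rightarrow> nat \<Rightarrow> state" where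
  "run D G st tok 0 = st"
| "run D G st tok (Suc n) =
    run (\<lambda>i. D (Suc i)) (\<lambda>i. G (Suc i)) (step (D 0) (G 0) st (tok 0)) (\<lambda>i. tok (Suc i)) n"

abbreviation pos :: "state \<Rightarrow> int \<times> int" where
  "pos st \<equiv> (fst st, fst (snd st))"

subsection \<open>Measurability\<close>

abbreviation memory_space :: "memory measure" where
  "memory_space \<equiv> PiM UNIV (\<lambda>_. count_space UNIV \<Otimes>\<^sub>M borel)"

abbreviation state_space :: "state measure" where
  "state_space \<equiv> count_space UNIV \<Otimes>\<^sub>M count_space UNIV \<Otimes>\<^sub>M memory_space"

abbreviation tokens_space :: "(token \<times> token) measure" where
  "tokens_space \<equiv> (borel \<Otimes>\<^sub>M count_space UNIV) \<Otimes>\<^sub>M (borel \<Otimes>\<^sub>M count_space UNIV)"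

lemma measurable_memory_lookup:
  assumes [measurable]: "K \<in> measurable N memory_space" "e \<in> measurable N (count_space UNIV)"
  shows "(\<lambda>x. K x (e x)) \<in> measurable N (count_space UNIV \<Otimes>\<^sub>M borel)"
  by (rule measurable_compose_countable[where f="\<lambda>i x. K x i"]) measurable

lemma measurable_memory_update:
  assumes [measurable]: "K \<in> measurable N memory_space" "e \<in> measurable N (count_space UNIV)"
    "v \<in> measurable N (count_space UNIV \<Otimes>\<^sub>M borel)"
  shows "(\<lambda>x. (K x)(e x := v x)) \<in> measurable N memory_space"
proof -
  have "(\<lambda>x i. if i = e x then v x else K x i) \<in> measurable N memory_space"
    by (rule measurable_PiM_single') (auto simp: space_pair_measure)
  also have "(\<lambda>x i. if i = e x then v x else K x i) = (\<lambda>x. (K x)(e x := v x))"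
    by (auto simp: fun_eq_iff)
  finally show ?thesis .
qed

lemma measurable_answer:
  assumes [measurable]: "K \<in> measurable N memory_space" "e \<in> measurable N (count_space UNIV)"
    "B \<in> measurable N (count_space UNIV)"
  shows "(\<lambda>x. answer (K x) (e x) (B x)) \<in> measurable N (count_space UNIV)"
proof -
  have [measurable]: "(\<lambda>x. K x (e x)) \<in> measurable N (count_space UNIV \<Otimes>\<^sub>M borel)"
    by (rule measurable_memory_lookup) fact+
  show ?thesis unfolding answer_def by measurable
qed

lemma measurable_elapse:
  assumes [measurable]: "K \<in> measurable N memory_space" "g \<in> borel_measurable N"
  shows "(\<lambda>x. elapse (g x) (K x)) \<in> measurable N memory_space"
  unfolding elapse_def by (rule measurable_PiM_single') (auto simp: space_pair_measure)

lemma measurable_edge: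
  assumes [measurable]: "z \<in> measurable N (count_space UNIV)" "c \<in> measurable N (count_space UNIV)"
  shows "(\<lambda>x. edge (z x) (c x)) \<in> measurable N (count_space UNIV)"
  unfolding edge_def by measurable

lemma measurable_move:
  assumes [measurable]: "z \<in> measurable N (count_space UNIV)" "c \<in> measurable N (count_space UNIV)"
    "b \<in> measurable N (count_space UNIV)"
  shows "(\<lambda>x. move (z x) (c x) (b x)) \<in> measurable N (count_space UNIV)"
  unfolding move_def by measurable

lemma measurable_step:
  assumes d: "d \<in> measurable N (count_space UNIV)" and g: "g \<in> borel_measurable N"
    and st: "st \<in> measurable N state_space" and tok: "tok \<in> measurable N tokens_space"
  shows "(\<lambda>x. step (d x) (g x) (st x) (tok x)) \<in> measurable N state_space"
proof -
  have d1: "(\<lambda>x. fst (d x)) \<in> measurable N (count_space UNIV)"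
    and d2: "(\<lambda>x. snd (d x)) \<in> measurable N (count_space UNIV)"
    by (rule measurable_compose[OF d], simp)+
  note f = measurable_compose[OF _ measurable_fst] and s = measurable_compose[OF _ measurable_snd]
  note x = f[OF st] and y = f[OF s[OF st]] and K = s[OF s[OF st]]
  note L1 = f[OF f[OF tok]] and B1 = s[OF f[OF tok]] and L2 = f[OF s[OF tok]] and B2 = s[OF s[OF tok]]
  note e1 = measurable_edge[OF x d1] and e2 = measurable_edge[OF y d2]
  note b1 = measurable_answer[OF K e1 B1]
  note K1 = measurable_memory_update[OF K e1 measurable_Pair[OF b1 L1]]
  note b2 = measurable_answer[OF K1 e2 B2]
  note K2 = measurable_memory_update[OF K1 e2 measurable_Pair[OF b2 L2]]
  show ?thesis
    unfolding step_def Let_def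
    by (rule measurable_Pair[OF measurable_move[OF x d1 b1]
      measurable_Pair[OF measurable_move[OF y d2 b2] measurable_elapse[OF K2 g]]])
qed

lemma measurable_run:
  assumes "\<And>i. (\<lambda>x. D x i) \<in> measurable N (count_space UNIV)" "\<And>i. (\<lambda>x. G x i) \<in> borel_measurable N"
    "st \<in> measurable N state_space" "\<And>i. (\<lambda>x. tok x i) \<in> measurable N tokens_space"
  shows "(\<lambda>x. run (D x) (G x) (st x) (tok x) n) \<in> measurable N state_space"
  using assms
proof (induction n arbitrary: D G st tok)
  case (Suc n)
  show ?case
    unfolding run.simps by (rule Suc.IH, rule Suc.prems, rule Suc.prems,
      rule measurable_step, (rule Suc.prems)+)
qed simp

subsection \<open>Path probabilities\<close>

text \<open>The answers are prescribed, hence the positions and the queried edges are deterministic.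
  Both walkers query at the same ring, whence the gap 0 after the first query.\<close>

fun queries :: "int \<Rightarrow> int \<Rightarrow> (nat \<Rightarrow> bool \<times> bool) \<Rightarrow> (nat \<Rightarrow> real) \<Rightarrow> (bool \<times> bool) list \<Rightarrow> query list" where
  "queries x y D G [] = []"
| "queries x y D G (b # bs) =
    (edge x (fst (D 0)), fst b, 0) # (edge y (snd (D 0)), snd b, G 0) #
    queries (move x (fst (D 0)) (fst b)) (move y (snd (D 0)) (snd b)) (\<lambda>i. D (Suc i)) (\<lambda>i. G (Suc i)) bs"

fun final :: "int \<Rightarrow> int \<Rightarrow> (nat \<Rightarrow> bool \<times> bool) \<Rightarrow> (bool \<times> bool) list \<Rightarrow> int \<times> int" where
  "final x y D [] = (x, y)"
| "final x y D (b # bs) =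
    final (move x (fst (D 0)) (fst b)) (move y (snd (D 0)) (snd b)) (\<lambda>i. D (Suc i)) bs"

abbreviation bits :: "nat \<Rightarrow> (bool \<times> bool) list set" where
  "bits n \<equiv> {bs. length bs = n}"

lemma sum_bits_Suc: "(\<Sum>bs\<in>bits (Suc n). F bs) = (\<Sum>b\<in>UNIV. \<Sum>bs\<in>bits n. F (b # bs))"
proof -
  have "bits (Suc n) = (\<lambda>(b, bs). b # bs) ` (UNIV \<times> bits n)"
    by (auto simp: length_Suc_conv image_iff)
  then have "(\<Sum>bs\<in>bits (Suc n). F bs) = (\<Sum>(b, bs)\<in>UNIV \<times> bits n. F (b # bs))"
    by (simp only:) (subst sum.reindex, auto simp: inj_on_def case_prod_beta)
  then show ?thesis by (simp add: sum.cartesian_product)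
qed

lemma gaps_nonneg_queries: "(\<And>i. 0 \<le> G i) \<Longrightarrow> gaps_nonneg (queries x y D G bs)"
  by (induction x y D G bs rule: queries.induct) auto

fun info_ok :: "info \<Rightarrow> bool" where
  "info_ok (Observed b s) \<longleftrightarrow> 0 \<le> s"
| "info_ok _ \<longleftrightarrow> True"

lemma info_ok_age: "info_ok i \<Longrightarrow> 0 \<le> g \<Longrightarrow> info_ok (age g i)"
  by (cases i) auto

lemma age_0 [simp]: "age 0 = (\<lambda>i. i)"
proof
  fix i show "age 0 i = i" by (cases i) auto
qed

context percolation
begin

lemma query_prob_bounds:
  assumes "info_ok i" shows "0 \<le> query_prob i b" "query_prob i b \<le> 1"
proof -
  have c: "0 \<le> coin_prob b" "coin_prob b \<le> 1" using p by (auto simp: coin_prob_def)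
  have *: "0 \<le> a * z + (1 - a) * c \<and> a * z + (1 - a) * c \<le> 1"
    if "0 \<le> a" "a \<le> 1" "0 \<le> z" "z \<le> 1" "0 \<le> c" "c \<le> 1" for a z c :: real
    using that mult_left_mono[of z 1 a] mult_left_mono[of c 1 "1 - a"] by simp
  have "0 \<le> query_prob i b \<and> query_prob i b \<le> 1"
  proof (cases i)
    case (Observed b' s)
    then have "exp (- \<mu> * s) \<le> 1" using assms \<mu> by simp
    then show ?thesis unfolding Observed query_prob.simps using c by (intro *) auto
  qed (use c in auto)
  then show "0 \<le> query_prob i b" "query_prob i b \<le> 1" by auto
qed

lemma weight_bounds:
  assumes "\<And>e. info_ok (I e)" "gaps_nonneg qs"
  shows "0 \<le> weight I qs \<and> weight I qs \<le> 1"
  using assms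
proof (induction qs arbitrary: I)
  case (Cons q qs)
  obtain e b g where q: "q = (e, b, g)" by (cases q)
  have "0 \<le> weight ((age g \<circ> I)(e := Observed b g)) qs \<and> weight ((age g \<circ> I)(e := Observed b g)) qs \<le> 1"
    using Cons.prems by (intro Cons.IH) (auto simp: q intro!: info_ok_age)
  then show ?case
    using query_prob_bounds[of "I e" b] Cons.prems(1)[of e] by (simp add: q mult_le_one)
qed simp

text \<open>
  Integrating out the validity period of an answer, which is used for at most one later query, turns
  it into the probability that the edge has not been refreshed.
\<close>

lemma integral_weight_Valid:
  assumes "0 \<le> s" "gaps_nonneg qs"
  shows "(\<lambda>l. weight (I(e := Valid b (l - s))) qs) \<in> borel_measurable borel \<and>
    (\<integral>l. weight (I(e := Valid b (l - s))) qs \<partial>exp_law \<mu>) = weight (I(e := Observed b s)) qs"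
  using assms
proof (induction qs arbitrary: I s)
  case Nil
  then show ?case using prob_space.prob_space[OF prob_space_exp_law[OF \<mu>]] by simp
next
  case (Cons q qs)
  obtain e' b' g where q: "q = (e', b', g)" by (cases q)
  have g: "0 \<le> g" and qs: "gaps_nonneg qs" using Cons.prems by (auto simp: q)
  show ?case
  proof (cases "e' = e")
    case True
    define W where "W = weight ((age g \<circ> I)(e := Observed b' g)) qs"
    have eq: "weight (I(e := Valid b (l - s))) (q # qs)
        = (if s < l then of_bool (b' = b) * W else coin_prob b' * W)" for l
      using True by (simp add: q W_def fun_upd_comp)
    have eq': "weight (I(e := Observed b s)) (q # qs) = query_prob (Observed b s) b' * W"
      using True by (simp add: q W_def fun_upd_comp)
    show ?thesis
      unfolding eq eq' integral_exp_law_if_less[OF \<mu> Cons.prems(1)]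
      by (auto simp: algebra_simps)
  next
    case False
    \<comment> \<open>A query elsewhere merely ages the entry of \<open>e\<close>, that is,
      \<open>s\<close> becomes \<open>s + g\<close>; the statement is for all \<open>s\<close> in
      order to absorb this.\<close>
    define I' where "I' = (age g \<circ> I)(e' := Observed b' g)"
    have eq: "weight (I(e := Valid b (l - s))) (q # qs)
        = query_prob (I e') b' * weight (I'(e := Valid b (l - (s + g)))) qs" for l
      using False by (simp add: q I'_def fun_upd_comp fun_upd_twist diff_diff_eq)
    have eq': "weight (I(e := Observed b s)) (q # qs)
        = query_prob (I e') b' * weight (I'(e := Observed b (s + g))) qs"
      using False by (simp add: q I'_def fun_upd_comp fun_upd_twist)
    have "0 \<le> s + g" using Cons.prems g by simp
    from Cons.IH[OF this qs, of I']
    have m: "(\<lambda>l. weight (I'(e := Valid b (l - (s + g)))) qs) \<in> borel_measurable borel"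
      and i: "(\<integral>l. weight (I'(e := Valid b (l - (s + g)))) qs \<partial>exp_law \<mu>)
        = weight (I'(e := Observed b (s + g))) qs"
      by blast+
    show ?thesis
      unfolding eq eq' integral_mult_right_zero i
      by (intro conjI borel_measurable_times borel_measurable_const m refl)
  qed
qed

definition token_law :: "token measure" where
  "token_law = exp_law \<mu> \<Otimes>\<^sub>M bern"

lemma prob_space_token_law: "prob_space token_law"
  unfolding token_law_def by (intro prob_space_pair prob_space_exp_law measure_pmf.prob_space_axioms \<mu>)

lemma sets_token_law [measurable_cong]: "sets token_law = sets (borel \<Otimes>\<^sub>M count_space UNIV)"
  unfolding token_law_def by (intro sets_pair_measure_cong) auto

definition tokens_law :: "(token \<times> token) measure" where
  "tokens_law = token_law \<Otimes>\<^sub>M token_law"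

lemma prob_space_tokens_law: "prob_space tokens_law"
  unfolding tokens_law_def by (intro prob_space_pair prob_space_token_law)

lemma sets_tokens_law [measurable_cong]: "sets tokens_law = sets tokens_space"
  unfolding tokens_law_def by (intro sets_pair_measure_cong sets_token_law)

definition valid_info :: "memory \<Rightarrow> int \<Rightarrow> info" where
  "valid_info K e = Valid (fst (K e)) (snd (K e))"

lemma valid_info_update: "valid_info (K(e := (b, l))) = (valid_info K)(e := Valid b l)"
  by (auto simp: valid_info_def fun_eq_iff)

lemma valid_info_elapse: "valid_info (elapse g K) = age g \<circ> valid_info K"
  by (auto simp: valid_info_def elapse_def fun_eq_iff)

text \<open>The coin of the token averages to \<open>query_prob\<close>, and its validity time
  averages to \<open>Observed\<close> by \<open>integral_weight_Valid\<close>. So one lazy query has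
  exactly the weight of a query of the true environment.\<close>

lemma integral_token_query:
  assumes g: "0 \<le> g" "gaps_nonneg qs" and I: "\<And>e. info_ok (I e)" and Ie: "I e = valid_info K e"
  shows "(\<integral>T. of_bool (answer K e (snd T) = b) * weight ((age g \<circ> I)(e := Valid b (fst T - g))) qs \<partial>token_law)
    = weight I ((e, b, g) # qs)" (is ?A)
    and "(\<lambda>T. of_bool (answer K e (snd T) = b) * weight ((age g \<circ> I)(e := Valid b (fst T - g))) qs)
      \<in> borel_measurable token_law" (is "?f \<in> _")
proof -
  have m: "(\<lambda>l. weight ((age g \<circ> I)(e := Valid b (l - g))) qs) \<in> borel_measurable borel"
    and i: "(\<integral>l. weight ((age g \<circ> I)(e := Valid b (l - g))) qs \<partial>exp_law \<mu>)
      = weight ((age g \<circ> I)(e := Observed b g)) qs"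
    using integral_weight_Valid[OF g, of "age g \<circ> I" e b] by auto
  note [measurable] = m
  show fm: "?f \<in> borel_measurable token_law"
    unfolding answer_def by measurable
  have w: "0 \<le> weight ((age g \<circ> I)(e := Valid b l)) qs \<and> weight ((age g \<circ> I)(e := Valid b l)) qs \<le> 1" for l
    using I g by (intro weight_bounds) (auto intro!: info_ok_age)
  have "(\<integral>T. ?f T \<partial>token_law) = (\<integral>l. \<integral>B. ?f (l, B) \<partial>bern \<partial>exp_law \<mu>)"
    unfolding token_law_def
    by (rule integral_pair_iterated(1)[where B=1])
       (use w fm in \<open>auto simp: token_law_def intro!: prob_space_exp_law \<mu> measure_pmf.prob_space_axioms\<close>)
  also have "\<dots> = (\<integral>l. query_prob (I e) b * weight ((age g \<circ> I)(e := Valid b (l - g))) qs \<partial>exp_law \<mu>)"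
    by (rule Bochner_Integration.integral_cong[OF refl])
       (cases b; simp add: integral_bern answer_def Ie valid_info_def coin_prob_def algebra_simps)
  also have "\<dots> = weight I ((e, b, g) # qs)" using i by simp
  finally show ?A .
qed

end

lemma measurable_fun_of_pos:
  fixes f :: "int \<times> int \<Rightarrow> real"
  shows "(\<lambda>s. f (pos s)) \<in> borel_measurable state_space"
proof -
  have "(\<lambda>s. (fst s, fst (snd s))) \<in> measurable state_space (count_space UNIV \<Otimes>\<^sub>M count_space UNIV)"
    by measurable
  then have "(\<lambda>s. (fst s, fst (snd s))) \<in> measurable state_space (count_space UNIV)"
    by (simp add: pair_measure_countable)
  then show ?thesis by (rule measurable_compose) simp
qed

fun walkers :: "(nat \<Rightarrow> bool \<times> bool) \<Rightarrow> (nat \<Rightarrow> real) \<Rightarrow> (real \<Rightarrow> int \<Rightarrow> bool) \<Rightarrow> real \<Rightarrow> int \<Rightarrow> int \<Rightarrow> nat \<Rightarrow> int \<times> int" where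
  "walkers D G \<eta> t x y 0 = (x, y)"
| "walkers D G \<eta> t x y (Suc n) =
    walkers (\<lambda>i. D (Suc i)) (\<lambda>i. G (Suc i)) \<eta> (t + G 0)
      (move x (fst (D 0)) (\<eta> t (edge x (fst (D 0))))) (move y (snd (D 0)) (\<eta> t (edge y (snd (D 0))))) n"

lemma sum_UNIV_select:
  fixes F :: "'b::finite \<Rightarrow> real"
  assumes "\<And>b. b \<noteq> c \<Longrightarrow> F b = 0"
  shows "(\<Sum>b\<in>UNIV. F b) = F c"
  using assms by (simp add: sum.remove[of UNIV c])

text \<open>For a given environment exactly one sequence of answers is compatible with it; this
  reduces expectations to path probabilities.\<close>

lemma walkers_eq_sum:
  fixes f :: "int \<times> int \<Rightarrow> real"
  shows "f (walkers D G \<eta> t x y n)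
    = (\<Sum>bs\<in>bits n. f (final x y D bs) * of_bool (obs \<eta> t (queries x y D G bs)))"
proof (induction n arbitrary: D G t x y)
  case (Suc n)
  define c where "c = (\<eta> t (edge x (fst (D 0))), \<eta> t (edge y (snd (D 0))))"
  show ?case
    unfolding sum_bits_Suc
    by (subst sum_UNIV_select[of c]) (auto simp: c_def Suc.IH intro!: sum.neutral)
qed simp

lemma measurable_obs:
  "Measurable.pred (env_measure r q) (\<lambda>\<xi>. obs (dyn_perc \<xi>) t qs)"
proof (induction qs arbitrary: t)
  case (Cons q' qs)
  obtain e b g where q: "q' = (e, b, g)" by (cases q')
  have "(\<lambda>\<xi>. \<xi> e) \<in> measurable (env_measure r q) (poisson_gaps r \<Otimes>\<^sub>M coin_flips q)"
    unfolding env_measure_def by measurable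
  then have "(\<lambda>\<xi>. \<xi> e) \<in> measurable (env_measure r q)
      (PiM UNIV (\<lambda>_. borel) \<Otimes>\<^sub>M PiM UNIV (\<lambda>_. count_space UNIV))"
    by (simp cong: measurable_cong_sets add: sets_edge_law)
  then have [measurable]: "(\<lambda>\<xi>. dyn_perc \<xi> t e) \<in> measurable (env_measure r q) (count_space UNIV)"
    unfolding dyn_perc_eq by (rule measurable_edge_state) simp
  note [measurable] = Cons.IH
  show ?case unfolding q obs.simps by measurable
qed simp

context percolation
begin

text \<open>The override \<open>J\<close> is there for the induction: a query replaces an entry of
  the memory by \<open>Observed\<close>, which no memory can represent.\<close>

lemma measurable_weight_memory:
  assumes "K \<in> measurable N memory_space"
  shows "(\<lambda>x. weight (\<lambda>e. case J e of Some i \<Rightarrow> i | None \<Rightarrow> valid_info (K x) e) qs) \<in> borel_measurable N"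
  using assms
proof (induction qs arbitrary: J K)
  case (Cons q qs)
  obtain e b g where q: "q = (e, b, g)" by (cases q)
  have [measurable]: "K \<in> measurable N memory_space" by fact
  have Q: "(\<lambda>x. query_prob (case J e of Some i \<Rightarrow> i | None \<Rightarrow> valid_info (K x) e) b) \<in> borel_measurable N"
    by (cases "J e") (simp_all add: valid_info_def)
  define J' where "J' = ((\<lambda>e. map_option (age g) (J e))(e := Some (Observed b g)))"
  have "(\<lambda>x. weight (\<lambda>e. case J' e of Some i \<Rightarrow> i | None \<Rightarrow> valid_info (elapse g (K x)) e) qs) \<in> borel_measurable N"
    by (intro Cons.IH measurable_elapse) auto
  moreover have "(age g \<circ> (\<lambda>e. case J e of Some i \<Rightarrow> i | None \<Rightarrow> valid_info (K x) e))(e := Observed b g)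
      = (\<lambda>e. case J' e of Some i \<Rightarrow> i | None \<Rightarrow> valid_info (elapse g (K x)) e)" for x
    by (auto simp: J'_def fun_eq_iff valid_info_elapse split: option.split)
  ultimately show ?case using Q unfolding q weight.simps by simp
qed simp

lemma valid_info_ok: "info_ok (valid_info K e)"
  by (simp add: valid_info_def)

text \<open>Both queries of one ring, by two applications of \<open>integral_token_query\<close>:
  the second token is integrated out first, against the memory that the first query leaves.\<close>

lemma integral_tokens_query:
  fixes K :: memory and e e' :: int and b b' :: bool
  assumes g: "0 \<le> g" "gaps_nonneg qs"
  defines "h \<equiv> \<lambda>t. of_bool (answer K e (snd (fst t)) = b) *
      of_bool (answer (K(e := (b, fst (fst t)))) e' (snd (snd t)) = b') *
      weight (valid_info (elapse g (K(e := (b, fst (fst t)), e' := (b', fst (snd t)))))) qs"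
  shows "(\<integral>t. h t \<partial>tokens_law) = weight (valid_info K) ((e, b, 0) # (e', b', g) # qs)"
    and "h \<in> borel_measurable tokens_law" and "\<And>t. \<bar>h t\<bar> \<le> 1"
proof -
  have hm: "h \<in> borel_measurable (token_law \<Otimes>\<^sub>M token_law)"
  proof -
    have t [measurable]: "(\<lambda>t. fst (fst t)) \<in> borel_measurable (token_law \<Otimes>\<^sub>M token_law)"
      "(\<lambda>t. fst (snd t)) \<in> borel_measurable (token_law \<Otimes>\<^sub>M token_law)"
      "(\<lambda>t. snd (fst t)) \<in> measurable (token_law \<Otimes>\<^sub>M token_law) (count_space UNIV)"
      "(\<lambda>t. snd (snd t)) \<in> measurable (token_law \<Otimes>\<^sub>M token_law) (count_space UNIV)"
      by measurable
    have c: "(\<lambda>_. v) \<in> measurable (token_law \<Otimes>\<^sub>M token_law) N'" if "v \<in> space N'" for v N'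
      using that by simp
    have K0: "(\<lambda>_. K) \<in> measurable (token_law \<Otimes>\<^sub>M token_law) memory_space"
      by (rule c) (simp add: space_PiM space_pair_measure)
    have K1: "(\<lambda>t. K(e := (b, fst (fst t)))) \<in> measurable (token_law \<Otimes>\<^sub>M token_law) memory_space"
      by (rule measurable_memory_update[OF K0]) measurable
    have K2: "(\<lambda>t. K(e := (b, fst (fst t)), e' := (b', fst (snd t))))
        \<in> measurable (token_law \<Otimes>\<^sub>M token_law) memory_space"
      by (rule measurable_memory_update[OF K1]) measurable
    have [measurable]: "(\<lambda>t. answer K e (snd (fst t))) \<in> measurable (token_law \<Otimes>\<^sub>M token_law) (count_space UNIV)"
      by (rule measurable_answer[OF K0]) measurable
    have [measurable]: "(\<lambda>t. answer (K(e := (b, fst (fst t)))) e' (snd (snd t)))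
        \<in> measurable (token_law \<Otimes>\<^sub>M token_law) (count_space UNIV)"
      by (rule measurable_answer[OF K1]) measurable
    have [measurable]: "(\<lambda>t. weight (valid_info (elapse g (K(e := (b, fst (fst t)), e' := (b', fst (snd t)))))) qs)
        \<in> borel_measurable (token_law \<Otimes>\<^sub>M token_law)"
      using measurable_weight_memory[OF measurable_elapse[OF K2 borel_measurable_const[of g]], of "\<lambda>_. None" qs]
      by simp
    show ?thesis unfolding h_def by measurable
  qed
  then show "h \<in> borel_measurable tokens_law" by (simp add: tokens_law_def)
  show hB: "\<bar>h t\<bar> \<le> 1" for t
    using weight_bounds[of "valid_info (elapse g (K(e := (b, fst (fst t)), e' := (b', fst (snd t)))))" qs]
      valid_info_ok g(2)
    by (simp add: h_def)
  have inner: "(\<integral>T'. h (T, T') \<partial>token_law) = of_bool (answer K e (snd T) = b) *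
      weight ((age 0 \<circ> valid_info K)(e := Valid b (fst T - 0))) ((e', b', g) # qs)" for T
  proof -
    define K1 where "K1 = K(e := (b, fst T))"
    have "(\<integral>T'. of_bool (answer K1 e' (snd T') = b') *
        weight ((age g \<circ> valid_info K1)(e' := Valid b' (fst T' - g))) qs \<partial>token_law)
      = weight (valid_info K1) ((e', b', g) # qs)"
      by (rule integral_token_query(1)[OF g valid_info_ok refl])
    moreover have "h (T, T') = of_bool (answer K e (snd T) = b) * (of_bool (answer K1 e' (snd T') = b') *
        weight ((age g \<circ> valid_info K1)(e' := Valid b' (fst T' - g))) qs)" for T'
      unfolding h_def K1_def by (simp add: valid_info_elapse valid_info_update fun_upd_comp)
    ultimately show ?thesis
      by (simp add: K1_def valid_info_update comp_def)
  qed
  have "(\<integral>t. h t \<partial>tokens_law) = (\<integral>T. \<integral>T'. h (T, T') \<partial>token_law \<partial>token_law)"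
    unfolding tokens_law_def by (intro integral_pair_iterated(1)[OF _ _ hm hB] prob_space_token_law)
  also have "\<dots> = weight (valid_info K) ((e, b, 0) # (e', b', g) # qs)"
    unfolding inner by (rule integral_token_query(1)) (use g in \<open>auto simp: valid_info_ok\<close>)
  finally show "(\<integral>t. h t \<partial>tokens_law) = weight (valid_info K) ((e, b, 0) # (e', b', g) # qs)" .
qed

text \<open>Path probabilities of the lazy pair, by conditioning on the tokens of the first ring.
  The formula has the same shape as \<open>integral_walkers\<close>; only the initial information
  differs.\<close>

lemma integral_run:
  fixes f :: "int \<times> int \<Rightarrow> real"
  assumes G: "\<And>i. 0 \<le> G i" and B: "\<And>z. \<bar>f z\<bar> \<le> B"
  shows "(\<integral>tok. f (pos (run D G (x, y, K) tok n)) \<partial>iid_seq tokens_law)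
    = (\<Sum>bs\<in>bits n. f (final x y D bs) * weight (valid_info K) (queries x y D G bs))"
  using G
proof (induction n arbitrary: D G x y K)
  case 0
  then show ?case
    using prob_space.prob_space[OF prob_space_iid_seq[OF prob_space_tokens_law]] by simp
next
  case (Suc n)
  let ?D = "\<lambda>i. D (Suc i)" and ?G = "\<lambda>i. G (Suc i)"
  define e where "e = edge x (fst (D 0))"
  define e' where "e' = edge y (snd (D 0))"
  define h where "h b bs t = of_bool (answer K e (snd (fst t)) = fst b) *
      of_bool (answer (K(e := (fst b, fst (fst t)))) e' (snd (snd t)) = snd b) *
      weight (valid_info (elapse (G 0) (K(e := (fst b, fst (fst t)), e' := (snd b, fst (snd t))))))
       (queries (move x (fst (D 0)) (fst b)) (move y (snd (D 0)) (snd b)) ?D ?G bs)" for b bs t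
  have q: "gaps_nonneg (queries x' y' ?D ?G bs)" for x' y' bs
    by (rule gaps_nonneg_queries) (use Suc.prems in auto)
  have h: "(\<integral>t. h b bs t \<partial>tokens_law) = weight (valid_info K) (queries x y D G (b # bs))"
    "integrable tokens_law (h b bs)" for b bs
    using integral_tokens_query[OF Suc.prems[of 0] q, where K=K and e=e and b="fst b" and e'=e' and b'="snd b"]
    by (auto simp: h_def[abs_def] e_def e'_def intro!: integrable_bounded[OF prob_space_tokens_law, where B=1])
  have m: "(\<lambda>tok. f (pos (run D G st tok n))) \<in> borel_measurable (iid_seq tokens_law)" for D G st n
    by (rule measurable_compose[OF measurable_run measurable_fun_of_pos])
      (auto simp: space_pair_measure space_PiM)
  \<comment> \<open>The tokens determine the two answers of the ring; all other summands contain a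
    zero indicator.\<close>
  have step_sum: "(\<integral>w. f (pos (run ?D ?G (step (D 0) (G 0) (x, y, K) t) w n)) \<partial>iid_seq tokens_law)
    = (\<Sum>b\<in>UNIV. \<Sum>bs\<in>bits n. f (final x y D (b # bs)) * h b bs t)" for t
  proof -
    define b1 where "b1 = answer K e (snd (fst t))"
    define b2 where "b2 = answer (K(e := (b1, fst (fst t)))) e' (snd (snd t))"
    have s: "step (D 0) (G 0) (x, y, K) t = (move x (fst (D 0)) b1, move y (snd (D 0)) b2,
        elapse (G 0) (K(e := (b1, fst (fst t)), e' := (b2, fst (snd t)))))"
      by (simp add: step_def Let_def b1_def b2_def e_def e'_def)
    have "(\<Sum>b\<in>UNIV. \<Sum>bs\<in>bits n. f (final x y D (b # bs)) * h b bs t)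
        = (\<Sum>bs\<in>bits n. f (final x y D ((b1, b2) # bs)) * h (b1, b2) bs t)"
      by (rule sum_UNIV_select) (auto simp: h_def b1_def b2_def intro!: sum.neutral)
    then show ?thesis
      unfolding s by (subst Suc.IH) (simp_all add: Suc.prems h_def b1_def[symmetric] b2_def[symmetric])
  qed
  have "(\<integral>tok. f (pos (run D G (x, y, K) tok (Suc n))) \<partial>iid_seq tokens_law)
    = (\<integral>t. \<integral>w. f (pos (run D G (x, y, K) (case_nat t w) (Suc n))) \<partial>iid_seq tokens_law \<partial>tokens_law)"
    by (rule integral_iid_seq_first[OF prob_space_tokens_law m B])
  also have "\<dots> = (\<integral>t. (\<Sum>b\<in>UNIV. \<Sum>bs\<in>bits n. f (final x y D (b # bs)) * h b bs t) \<partial>tokens_law)"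
    using step_sum by simp
  also have "\<dots> = (\<Sum>b\<in>UNIV. \<Sum>bs\<in>bits n. f (final x y D (b # bs)) * (\<integral>t. h b bs t \<partial>tokens_law))"
    using h(2) by (simp add: Bochner_Integration.integral_sum)
  finally show ?case unfolding h(1) sum_bits_Suc .
qed

lemma integral_walkers:
  fixes f :: "int \<times> int \<Rightarrow> real"
  assumes G: "\<And>i. 0 \<le> G i" and t: "0 \<le> t"
  shows "(\<integral>\<xi>. f (walkers D G (dyn_perc \<xi>) t x y n) \<partial>env_measure \<mu> p)
    = (\<Sum>bs\<in>bits n. f (final x y D bs) * weight (\<lambda>_. Unknown) (queries x y D G bs))"
proof -
  interpret prob_space "env_measure \<mu> p"
    unfolding env_measure_def by (intro prob_space_PiM prob_space_edge_law)
  have sp: "space (env_measure \<mu> p) = UNIV"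
    by (auto simp: env_measure_def space_PiM space_pair_measure)
  have i: "integrable (env_measure \<mu> p) (\<lambda>\<xi>. of_bool (obs (dyn_perc \<xi>) t qs) :: real)" for qs
    using measurable_obs by (intro integrable_bounded[of _ _ 1] prob_space_axioms) auto
  have "(\<integral>\<xi>. of_bool (obs (dyn_perc \<xi>) t qs) \<partial>env_measure \<mu> p) = weight (\<lambda>_. Unknown) qs"
    if "gaps_nonneg qs" for qs
  proof -
    have "(\<integral>\<xi>. of_bool (obs (dyn_perc \<xi>) t qs) \<partial>env_measure \<mu> p :: real)
      = (\<integral>\<xi>. indicator {\<xi>. obs (dyn_perc \<xi>) t qs} \<xi> \<partial>env_measure \<mu> p)"
      by (intro Bochner_Integration.integral_cong) (auto simp: indicator_def)
    then show ?thesis using env_obs_prob[OF that t] by (simp add: sp)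
  qed
  then show ?thesis
    unfolding walkers_eq_sum using i by (simp add: gaps_nonneg_queries G)
qed

section \<open>Expired memories and equality of the two laws\<close>

definition forgotten :: "memory \<Rightarrow> bool" where
  "forgotten K \<longleftrightarrow> (\<forall>e. snd (K e) \<le> 0)"

text \<open>An expired answer is queried like a fresh coin, and it stays expired because gaps are
  nonnegative.\<close>

lemma weight_Unknown_cong:
  assumes "\<And>e. I e = J e \<or> (J e = Unknown \<and> (\<exists>b l. I e = Valid b l \<and> l \<le> 0))" "gaps_nonneg qs"
  shows "weight I qs = weight J qs"
  using assms
proof (induction qs arbitrary: I J)
  case (Cons q qs)
  obtain e b g where q: "q = (e, b, g)" by (cases q)
  have "query_prob (I e) b = query_prob (J e) b" using Cons.prems(1)[of e] by auto
  moreover have "weight ((age g \<circ> I)(e := Observed b g)) qs = weight ((age g \<circ> J)(e := Observed b g)) qs"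
  proof (rule Cons.IH)
    fix e1
    show "((age g \<circ> I)(e := Observed b g)) e1 = ((age g \<circ> J)(e := Observed b g)) e1 \<or>
       (((age g \<circ> J)(e := Observed b g)) e1 = Unknown \<and>
        (\<exists>b' l. ((age g \<circ> I)(e := Observed b g)) e1 = Valid b' l \<and> l \<le> 0))"
      using Cons.prems(1)[of e1] Cons.prems(2) by (auto simp: q)
  qed (use Cons.prems(2) q in auto)
  ultimately show ?case by (simp add: q)
qed simp

text \<open>The link between the two models for frozen clock and directions: both sides are the same
  sum over sequences of answers, with equal weights.\<close>

lemma integral_run_forgotten:
  fixes f :: "int \<times> int \<Rightarrow> real"
  assumes G: "\<And>i. 0 \<le> G i" and t: "0 \<le> t" and B: "\<And>z. \<bar>f z\<bar> \<le> B" and K: "forgotten K"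
  shows "(\<integral>tok. f (pos (run D G (x, y, K) tok n)) \<partial>iid_seq tokens_law)
    = (\<integral>\<xi>. f (walkers D G (dyn_perc \<xi>) t x y n) \<partial>env_measure \<mu> p)"
proof -
  have "weight (valid_info K) (queries x y D G bs) = weight (\<lambda>_. Unknown) (queries x y D G bs)" for bs
    using K by (intro weight_Unknown_cong gaps_nonneg_queries G) (auto simp: valid_info_def forgotten_def)
  then show ?thesis unfolding integral_run[of G f B, OF G B] integral_walkers[of G t f, OF G t] by simp
qed

end

section \<open>The walk and its lazy version have the same law\<close>

fun walker :: "(nat \<Rightarrow> bool) \<Rightarrow> (nat \<Rightarrow> real) \<Rightarrow> (real \<Rightarrow> int \<Rightarrow> bool) \<Rightarrow> real \<Rightarrow> int \<Rightarrow> nat \<Rightarrow> int" where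
  "walker d G \<eta> t x 0 = x"
| "walker d G \<eta> t x (Suc n) =
    walker (\<lambda>i. d (Suc i)) (\<lambda>i. G (Suc i)) \<eta> (t + G 0) (move x (d 0) (\<eta> t (edge x (d 0)))) n"

lemma walkers_eq_walker:
  "walkers D G \<eta> t x y n = (walker (\<lambda>i. fst (D i)) G \<eta> t x n, walker (\<lambda>i. snd (D i)) G \<eta> t y n)"
  by (induction n arbitrary: D G t x y) auto

text \<open>\<open>walker\<close> recurses on the first ring, as conditioning requires, whereas
  \<open>jump_chain\<close> recurses on the last one.\<close>

lemma walker_Suc_back:
  "walker d G \<eta> t x (Suc n) =
    (let z = walker d G \<eta> t x n in move z (d n) (\<eta> (t + (\<Sum>i<n. G i)) (edge z (d n))))"
proof (induction n arbitrary: d G t x)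
  case (Suc n)
  show ?case
    by (subst walker.simps, subst Suc.IH) (simp add: Let_def sum.lessThan_Suc_shift add.assoc del: sum.lessThan_Suc)
qed (simp add: Let_def)

lemma arrival_eq: "arrival c n = c 0 + (\<Sum>i<n. c (Suc i))"
  unfolding arrival_def by (simp add: sum.atMost_shift)

lemma jump_chain_eq_walker:
  "jump_chain (\<xi>, (c, d)) n = walker d (\<lambda>i. c (Suc i)) (dyn_perc \<xi>) (c 0) 0 n"
proof (induction n)
  case (Suc n)
  show ?case
    unfolding walker_Suc_back Suc.IH[symmetric]
    by (simp add: Let_def arrival_eq move_def edge_def min_def)
qed simp

lemma walker_shift_bound: "\<bar>walker d G \<eta> t x n - x\<bar> \<le> int n"
proof (induction n)
  case (Suc n)
  then show ?case unfolding walker_Suc_back by (auto simp: Let_def move_def)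
qed simp

section \<open>Translation invariance and the law of a single walk\<close>

lemma queries_shift:
  "queries (x + z) (y + z) D G bs = map (\<lambda>(e, b, g). (e + z, b, g)) (queries x y D G bs)"
proof (induction bs arbitrary: x y D G)
  case (Cons b bs)
  have "edge (a + z) c = edge a c + z" "move (a + z) c b' = move a c b' + z" for a c b'
    by (auto simp: edge_def move_def)
  then show ?case by (simp add: Cons.IH)
qed simp

lemma final_shift:
  "final (x + z) (y + z) D bs = (fst (final x y D bs) + z, snd (final x y D bs) + z)"
proof (induction bs arbitrary: x y D)
  case (Cons b bs)
  have "move (a + z) c b' = move a c b' + z" for a c b'
    by (auto simp: move_def)
  then show ?case by (simp add: Cons.IH)
qed simp

context percolation
begin

lemma weight_shift: "weight I (map (\<lambda>(e, b, g). (e + z, b, g)) qs) = weight (\<lambda>e. I (e + z)) qs"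
proof (induction qs arbitrary: I)
  case (Cons q qs)
  obtain e b g where q: "q = (e, b, g)" by (cases q)
  have "(\<lambda>e'. ((age g \<circ> I)(e + z := Observed b g)) (e' + z)) = (age g \<circ> (\<lambda>e. I (e + z)))(e := Observed b g)"
    by (auto simp: fun_eq_iff)
  then show ?case
    unfolding q list.map prod.case weight.simps Cons.IH by (simp only:)
qed simp

text \<open>The parameter is the probability of a step to the right instead of the bias, so that
  total bias, \<open>q = 1\<close>, is included.\<close>

definition biased_measure :: "real \<Rightarrow> (env_sample \<times> walker_sample) measure" where
  "biased_measure q = env_measure \<mu> p \<Otimes>\<^sub>M (poisson_gaps 1 \<Otimes>\<^sub>M coin_flips q)"

lemma walk_measure_eq: "walk_measure \<mu> p l = biased_measure (exp l / (exp l + exp (- l)))"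
  by (simp add: walk_measure_def walker_measure_def biased_measure_def)

lemma prob_space_env_measure: "prob_space (env_measure \<mu> p)"
  unfolding env_measure_def by (intro prob_space_PiM prob_space_edge_law)

lemma prob_space_biased_measure: "prob_space (biased_measure q)"
  unfolding biased_measure_def
  by (intro prob_space_pair prob_space_env_measure prob_space_poisson_gaps prob_space_coin_flips) simp

lemma measurable_jump_chain:
  "(\<lambda>w. jump_chain w n) \<in> measurable (biased_measure q) (count_space UNIV)"
proof (induction n)
  case (Suc n)
  note [measurable] = Suc.IH
  have fs [measurable]: "fst \<in> measurable (biased_measure q) (env_measure \<mu> p)"
    "(\<lambda>w. fst (snd w)) \<in> measurable (biased_measure q) (poisson_gaps 1)"
    "(\<lambda>w. snd (snd w)) \<in> measurable (biased_measure q) (coin_flips q)"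
    unfolding biased_measure_def by measurable
  have c: "(\<lambda>w. fst (snd w)) \<in> measurable (biased_measure q) (PiM UNIV (\<lambda>_. borel))"
    using fs(2) by (simp cong: measurable_cong_sets add: sets_poisson_gaps)
  have [measurable]: "(\<lambda>w. arrival (fst (snd w)) n) \<in> borel_measurable (biased_measure q)"
    by (rule measurable_arrival[OF c])
  have "(\<lambda>w. snd (snd w)) \<in> measurable (biased_measure q) (PiM UNIV (\<lambda>_. count_space UNIV))"
    using fs(3) by (simp cong: measurable_cong_sets add: sets_coin_flips)
  then have [measurable]: "(\<lambda>w. snd (snd w) n) \<in> measurable (biased_measure q) (count_space UNIV)"
    by (rule measurable_compose) (rule measurable_component_singleton, simp)
  have "(\<lambda>w. fst w e) \<in> measurable (biased_measure q) (poisson_gaps \<mu> \<Otimes>\<^sub>M coin_flips p)" for e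
    using fs(1) unfolding env_measure_def by measurable
  then have "(\<lambda>w. fst w e) \<in> measurable (biased_measure q)
      (PiM UNIV (\<lambda>_. borel) \<Otimes>\<^sub>M PiM UNIV (\<lambda>_. count_space UNIV))" for e
    by (simp cong: measurable_cong_sets add: sets_edge_law)
  then have d [measurable]: "(\<lambda>w. dyn_perc (fst w) (arrival (fst (snd w)) n) e) \<in> measurable (biased_measure q) (count_space UNIV)" for e
    unfolding dyn_perc_eq by (rule measurable_edge_state) measurable
  define y where "y w = (if snd (snd w) n then jump_chain w n + 1 else jump_chain w n - 1)"
    for w :: "env_sample \<times> walker_sample"
  have [measurable]: "y \<in> measurable (biased_measure q) (count_space UNIV)"
    unfolding y_def by measurable
  have [measurable]: "(\<lambda>w. dyn_perc (fst w) (arrival (fst (snd w)) n) (min (jump_chain w n) (y w)))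
      \<in> measurable (biased_measure q) (count_space UNIV)"
    by (rule measurable_compose_countable[where f="\<lambda>e w. dyn_perc (fst w) (arrival (fst (snd w)) n) e"])
       measurable
  have "jump_chain w (Suc n) = (if dyn_perc (fst w) (arrival (fst (snd w)) n) (min (jump_chain w n) (y w))
      then y w else jump_chain w n)" for w
    by (cases w, cases "snd w") (simp add: y_def Let_def)
  then show ?case by simp
qed simp

definition walk_expectation :: "real \<Rightarrow> (int \<Rightarrow> real) \<Rightarrow> nat \<Rightarrow> real" where
  "walk_expectation q h n = (\<integral>w. h (jump_chain w n) \<partial>biased_measure q)"

definition ring_law :: "(real \<times> real \<times> token \<times> token) measure" where
  "ring_law = exp_law 1 \<Otimes>\<^sub>M (exp_law 1 \<Otimes>\<^sub>M tokens_law)"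

lemma prob_space_ring_law: "prob_space ring_law"
  unfolding ring_law_def by (intro prob_space_pair prob_space_exp_law prob_space_tokens_law) auto

text \<open>
  The entries of \<open>w i\<close> are the time after the \<open>i\<close>-th ring of the clock, a variable that determines the
  directions, and the tokens of both walkers. A walker with threshold \<open>\<theta>\<close> goes to the right with
  probability \<open>exp (- \<theta>)\<close>.
\<close>

definition lazy :: "real \<Rightarrow> real \<Rightarrow> state \<Rightarrow> (nat \<Rightarrow> real \<times> real \<times> token \<times> token) \<Rightarrow> nat \<Rightarrow> state" where
  "lazy \<theta> \<theta>' st w n = run (\<lambda>i. (\<theta> < fst (snd (w i)), \<theta>' < fst (snd (w i)))) (\<lambda>i. fst (w i)) st
     (\<lambda>i. snd (snd (w i))) n"

definition ring_step :: "real \<Rightarrow> real \<Rightarrow> state \<Rightarrow> real \<times> real \<times> token \<times> token \<Rightarrow> state" where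
  "ring_step \<theta> \<theta>' st r = step (\<theta> < fst (snd r), \<theta>' < fst (snd r)) (fst r) st (snd (snd r))"

lemma lazy_simps [simp]:
  "lazy \<theta> \<theta>' st w 0 = st"
  "lazy \<theta> \<theta>' st (case_nat r w) (Suc n) = lazy \<theta> \<theta>' (ring_step \<theta> \<theta>' st r) w n"
  by (simp_all add: lazy_def ring_step_def)

end

text \<open>The path formulas need nonnegative gaps everywhere. Truncation provides this and changes
  the clock on a null set only.\<close>

definition pos_seq :: "(nat \<Rightarrow> real) \<Rightarrow> nat \<Rightarrow> real" where
  "pos_seq g i = max 0 (g i)"

lemma pos_seq_nonneg: "0 \<le> pos_seq g i"
  by (simp add: pos_seq_def)

lemma pos_seq_id: "(\<And>i. 0 < g i) \<Longrightarrow> pos_seq g = g"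
  by (auto simp: pos_seq_def fun_eq_iff less_imp_le)

abbreviation "unit_exp_seq \<equiv> iid_seq (exp_law 1)"

lemma AE_unit_exp_seq_pos: "AE g in unit_exp_seq. \<forall>i. 0 < g i"
  by (intro AE_iid_seq_all prob_space_exp_law AE_exp_law_pos) auto

lemma prob_space_unit_exp_seq: "prob_space unit_exp_seq"
  by (intro prob_space_iid_seq prob_space_exp_law) auto

lemma unit_exp_seq_eq: "poisson_gaps 1 = unit_exp_seq"
  by (rule poisson_gaps_eq_iid_seq)

context percolation
begin

lemma measurable_lazy:
  assumes st: "st \<in> measurable N state_space" and w: "w \<in> measurable N (iid_seq ring_law)"
  shows "(\<lambda>x. lazy \<theta> \<theta>' (st x) (w x) n) \<in> measurable N state_space"
proof -
  have c: "(\<lambda>x. w x i) \<in> measurable N ring_law" for i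
    using measurable_compose[OF w measurable_component_singleton[of i UNIV "\<lambda>_. ring_law"]] by simp
  then have "(\<lambda>x. w x i) \<in> measurable N (exp_law 1 \<Otimes>\<^sub>M (exp_law 1 \<Otimes>\<^sub>M tokens_law))" for i
    by (simp add: ring_law_def)
  from measurable_compose[OF this measurable_fst] measurable_compose[OF measurable_compose[OF this measurable_snd] measurable_fst]
    measurable_compose[OF measurable_compose[OF this measurable_snd] measurable_snd]
  have m: "(\<lambda>x. fst (w x i)) \<in> borel_measurable N" "(\<lambda>x. fst (snd (w x i))) \<in> borel_measurable N"
    "(\<lambda>x. snd (snd (w x i))) \<in> measurable N tokens_space" for i
    by (simp_all cong: measurable_cong_sets add: sets_tokens_law)
  note [measurable] = m(2)
  have d: "(\<lambda>x. (\<theta> < fst (snd (w x i)), \<theta>' < fst (snd (w x i)))) \<in> measurable N (count_space UNIV)" for i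
  proof -
    have "(\<lambda>x. (\<theta> < fst (snd (w x i)), \<theta>' < fst (snd (w x i)))) \<in> measurable N (count_space UNIV \<Otimes>\<^sub>M count_space UNIV)"
      by measurable
    then show ?thesis by (simp add: pair_measure_countable)
  qed
  show ?thesis unfolding lazy_def by (rule measurable_run[OF d m(1) st m(3)])
qed

lemma state_in_space: "st \<in> space state_space"
  by (simp add: space_pair_measure space_PiM)

text \<open>Zipping separates clock, directions and tokens; with clock and directions fixed, the
  integral over the tokens is exchanged for one over the environment.\<close>

lemma integral_lazy_forgotten:
  fixes f :: "int \<times> int \<Rightarrow> real"
  assumes K: "forgotten K" and B: "\<And>z. \<bar>f z\<bar> \<le> B"
  shows "(\<integral>w. f (pos (lazy \<theta> \<theta>' (x, y, K) w n)) \<partial>iid_seq ring_law)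
    = (\<integral>g. \<integral>u. \<integral>\<xi>. f (walkers (\<lambda>i. (\<theta> < u i, \<theta>' < u i)) (pos_seq g) (dyn_perc \<xi>) 0 x y n)
        \<partial>env_measure \<mu> p \<partial>unit_exp_seq \<partial>unit_exp_seq)"
proof -
  define F where "F w = f (pos (lazy \<theta> \<theta>' (x, y, K) w n))" for w
  have Fm: "F \<in> borel_measurable (iid_seq ring_law)"
    unfolding F_def
    by (rule measurable_compose[OF measurable_lazy measurable_fun_of_pos]) (use state_in_space in auto)
  have FB: "\<bar>F w\<bar> \<le> B" for w by (simp add: F_def B)
  have E: "prob_space (exp_law 1)" by (rule prob_space_exp_law) simp
  have ET: "prob_space (exp_law 1 \<Otimes>\<^sub>M tokens_law)" by (intro prob_space_pair E prob_space_tokens_law)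
  note P = prob_space_iid_seq[OF ET]
  have B0: "0 \<le> B" using B[of "(0, 0)"] abs_ge_zero order_trans by blast
  have zm: "(\<lambda>z i. (fst z i, snd z i)) \<in> measurable (unit_exp_seq \<Otimes>\<^sub>M iid_seq (exp_law 1 \<Otimes>\<^sub>M tokens_law)) (iid_seq ring_law)"
    unfolding ring_law_def by (rule measurable_PiM_single') (auto simp: space_pair_measure space_PiM PiE_iff)
  have pm: "(\<lambda>z. (pos_seq (fst z), snd z)) \<in> measurable (unit_exp_seq \<Otimes>\<^sub>M iid_seq (exp_law 1 \<Otimes>\<^sub>M tokens_law))
      (unit_exp_seq \<Otimes>\<^sub>M iid_seq (exp_law 1 \<Otimes>\<^sub>M tokens_law))"
  proof (rule measurable_Pair)
    show "(\<lambda>z. pos_seq (fst z)) \<in> measurable (unit_exp_seq \<Otimes>\<^sub>M iid_seq (exp_law 1 \<Otimes>\<^sub>M tokens_law)) unit_exp_seq"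
      unfolding pos_seq_def[abs_def] by (rule measurable_PiM_single') (auto simp: space_PiM)
  qed simp
  have jm: "(\<lambda>z. F (\<lambda>i. (pos_seq (fst z) i, snd z i)))
      \<in> borel_measurable (unit_exp_seq \<Otimes>\<^sub>M iid_seq (exp_law 1 \<Otimes>\<^sub>M tokens_law))"
    using measurable_compose[OF pm measurable_compose[OF zm Fm]] by simp
  have jm0: "(\<lambda>z. F (\<lambda>i. (fst z i, snd z i)))
      \<in> borel_measurable (unit_exp_seq \<Otimes>\<^sub>M iid_seq (exp_law 1 \<Otimes>\<^sub>M tokens_law))"
    using measurable_compose[OF zm Fm] by simp
  interpret SP: prob_space "iid_seq (exp_law 1 \<Otimes>\<^sub>M tokens_law)" by (rule P)
  have "(\<integral>w. F w \<partial>iid_seq ring_law)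
      = (\<integral>g. \<integral>v. F (\<lambda>i. (g i, v i)) \<partial>iid_seq (exp_law 1 \<Otimes>\<^sub>M tokens_law) \<partial>unit_exp_seq)"
    using Fm unfolding ring_law_def by (intro integral_iid_seq_zip[where B=B] E ET FB)
  also have "\<dots> = (\<integral>g. \<integral>v. F (\<lambda>i. (pos_seq g i, v i)) \<partial>iid_seq (exp_law 1 \<Otimes>\<^sub>M tokens_law) \<partial>unit_exp_seq)"
  proof (rule integral_cong_AE)
    show "(\<lambda>g. \<integral>v. F (\<lambda>i. (g i, v i)) \<partial>iid_seq (exp_law 1 \<Otimes>\<^sub>M tokens_law)) \<in> borel_measurable unit_exp_seq"
      using jm0 by (intro SP.borel_measurable_lebesgue_integral) (simp add: case_prod_beta')
    show "(\<lambda>g. \<integral>v. F (\<lambda>i. (pos_seq g i, v i)) \<partial>iid_seq (exp_law 1 \<Otimes>\<^sub>M tokens_law)) \<in> borel_measurable unit_exp_seq"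
      using jm by (intro SP.borel_measurable_lebesgue_integral) (simp add: case_prod_beta')
    show "AE g in unit_exp_seq. (\<integral>v. F (\<lambda>i. (g i, v i)) \<partial>iid_seq (exp_law 1 \<Otimes>\<^sub>M tokens_law))
        = (\<integral>v. F (\<lambda>i. (pos_seq g i, v i)) \<partial>iid_seq (exp_law 1 \<Otimes>\<^sub>M tokens_law))"
      using AE_unit_exp_seq_pos by eventually_elim (simp add: pos_seq_id)
  qed
  also have "\<dots> = (\<integral>g. \<integral>u. \<integral>tok. F (\<lambda>i. (pos_seq g i, u i, tok i)) \<partial>iid_seq tokens_law \<partial>unit_exp_seq \<partial>unit_exp_seq)"
  proof (rule Bochner_Integration.integral_cong[OF refl])
    fix g :: "nat \<Rightarrow> real"
    have "(\<lambda>v. F (\<lambda>i. (pos_seq g i, v i))) \<in> borel_measurable (iid_seq (exp_law 1 \<Otimes>\<^sub>M tokens_law))"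
      using measurable_compose[OF measurable_Pair1'[of g unit_exp_seq] jm] by (simp add: space_PiM)
    then show "(\<integral>v. F (\<lambda>i. (pos_seq g i, v i)) \<partial>iid_seq (exp_law 1 \<Otimes>\<^sub>M tokens_law))
      = (\<integral>u. \<integral>tok. F (\<lambda>i. (pos_seq g i, u i, tok i)) \<partial>iid_seq tokens_law \<partial>unit_exp_seq)"
      by (intro integral_iid_seq_zip[where B=B] E prob_space_tokens_law FB)
  qed
  also have "\<dots> = (\<integral>g. \<integral>u. \<integral>\<xi>. f (walkers (\<lambda>i. (\<theta> < u i, \<theta>' < u i)) (pos_seq g) (dyn_perc \<xi>) 0 x y n)
        \<partial>env_measure \<mu> p \<partial>unit_exp_seq \<partial>unit_exp_seq)"
    unfolding F_def lazy_def fst_conv snd_conv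
    by (intro Bochner_Integration.integral_cong refl integral_run_forgotten[where B=B] pos_seq_nonneg order_refl B K)
  finally show ?thesis by (simp add: F_def)
qed

lemma integral_walkers_shift:
  fixes f :: "int \<times> int \<Rightarrow> real"
  assumes G: "\<And>i. 0 \<le> G i" and t: "0 \<le> t"
  shows "(\<integral>\<xi>. f (walkers D G (dyn_perc \<xi>) t (x + z) (y + z) n) \<partial>env_measure \<mu> p)
    = (\<integral>\<xi>. (\<lambda>v. f (fst v + z, snd v + z)) (walkers D G (dyn_perc \<xi>) t x y n) \<partial>env_measure \<mu> p)"
  using integral_walkers[of G t f D "x + z" "y + z" n, OF G t]
    integral_walkers[of G t "\<lambda>v. f (fst v + z, snd v + z)" D x y n, OF G t]
  unfolding queries_shift final_shift weight_shift by simp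

lemma integral_walker_shift:
  fixes h :: "int \<Rightarrow> real"
  assumes G: "\<And>i. 0 \<le> G i" and t: "0 \<le> t"
  shows "(\<integral>\<xi>. h (walker d G (dyn_perc \<xi>) t x n - x) \<partial>env_measure \<mu> p)
    = (\<integral>\<xi>. h (walker d G (dyn_perc \<xi>) t 0 n) \<partial>env_measure \<mu> p)"
  using integral_walkers_shift[of G t "\<lambda>v. h (fst v - x)" "\<lambda>i. (d i, d i)" 0 x 0 n, OF G t]
  by (simp add: walkers_eq_walker)

text \<open>The walk starts with a ring at time 0, as in the lazy model, instead of after a first
  waiting time.\<close>

definition frozen_expectation :: "(int \<Rightarrow> real) \<Rightarrow> nat \<Rightarrow> (nat \<Rightarrow> real) \<Rightarrow> (nat \<Rightarrow> bool) \<Rightarrow> real" where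
  "frozen_expectation h n g d = (\<integral>\<xi>. h (walker d (pos_seq g) (dyn_perc \<xi>) 0 0 n) \<partial>env_measure \<mu> p)"

lemma integral_walker_time:
  fixes h :: "int \<Rightarrow> real"
  assumes G: "\<And>i. 0 \<le> G i" and t: "0 \<le> t"
  shows "(\<integral>\<xi>. h (walker d G (dyn_perc \<xi>) t x n) \<partial>env_measure \<mu> p)
    = (\<integral>\<xi>. h (walker d G (dyn_perc \<xi>) 0 x n) \<partial>env_measure \<mu> p)"
  using integral_walkers[of G t "\<lambda>v. h (fst v)" "\<lambda>i. (d i, True)" x 0 n, OF G t]
    integral_walkers[of G 0 "\<lambda>v. h (fst v)" "\<lambda>i. (d i, True)" x 0 n, OF G]
  by (simp add: walkers_eq_walker)

text \<open>The environment is stationary, so the waiting time before the first ring does not affect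
  the law of the jump chain and can be integrated out.\<close>

lemma walk_expectation_eq:
  fixes h :: "int \<Rightarrow> real"
  assumes B: "\<And>z. \<bar>h z\<bar> \<le> B"
  shows "walk_expectation q h n = (\<integral>g. \<integral>d. frozen_expectation h n g d \<partial>coin_flips q \<partial>unit_exp_seq)"
    and "frozen_expectation h n g \<in> borel_measurable (coin_flips q)"
proof -
  interpret E: prob_space "env_measure \<mu> p" by (rule prob_space_env_measure)
  interpret C: prob_space "coin_flips q" by (rule prob_space_coin_flips)
  interpret U: prob_space unit_exp_seq by (rule prob_space_unit_exp_seq)
  define F where "F w = h (jump_chain w n)" for w
  have FB: "\<bar>F w\<bar> \<le> B" for w by (simp add: F_def B)
  have B0: "0 \<le> B" using B[of 0] abs_ge_zero order_trans by blast
  have Fm: "F \<in> borel_measurable (env_measure \<mu> p \<Otimes>\<^sub>M (unit_exp_seq \<Otimes>\<^sub>M coin_flips q))"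
    using measurable_jump_chain[of n q]
    unfolding F_def biased_measure_def unit_exp_seq_eq by (rule measurable_compose) simp
  have jm: "(\<lambda>z. \<integral>\<xi>. F (\<xi>, z) \<partial>env_measure \<mu> p) \<in> borel_measurable (unit_exp_seq \<Otimes>\<^sub>M coin_flips q)"
    using measurable_compose[OF measurable_pair_swap' Fm]
    by (intro E.borel_measurable_lebesgue_integral) (simp add: case_prod_beta')
  have jB: "\<bar>\<integral>\<xi>. F (\<xi>, z) \<partial>env_measure \<mu> p\<bar> \<le> B" for z
    by (intro abs_integral_le E.prob_space_axioms) (auto simp: FB B0)
  have 1: "walk_expectation q h n = (\<integral>c. \<integral>d. \<integral>\<xi>. F (\<xi>, c, d) \<partial>env_measure \<mu> p \<partial>coin_flips q \<partial>unit_exp_seq)"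
  proof -
    have "walk_expectation q h n = (\<integral>z. \<integral>\<xi>. F (\<xi>, z) \<partial>env_measure \<mu> p \<partial>(unit_exp_seq \<Otimes>\<^sub>M coin_flips q))"
      unfolding walk_expectation_def biased_measure_def F_def[symmetric] unit_exp_seq_eq
      by (intro integral_pair_iterated(2)[OF _ _ Fm FB] E.prob_space_axioms prob_space_pair
          U.prob_space_axioms C.prob_space_axioms)
    then show ?thesis
      by (simp add: integral_pair_iterated(1)[OF U.prob_space_axioms C.prob_space_axioms jm jB])
  qed
  define H where "H c = (\<integral>d. \<integral>\<xi>. F (\<xi>, c, d) \<partial>env_measure \<mu> p \<partial>coin_flips q)" for c
  have Hm: "H \<in> borel_measurable unit_exp_seq"
    unfolding H_def using jm by (intro C.borel_measurable_lebesgue_integral) (simp add: case_prod_beta')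
  have HB: "\<bar>H c\<bar> \<le> B" for c
    unfolding H_def by (intro abs_integral_le C.prob_space_axioms AE_I2 jB B0)
  \<comment> \<open>Stationarity moves the first ring from time \<open>r\<close> to time 0, for
    positive gaps; \<open>frozen0\<close> is the same identity at \<open>r = 0\<close>.\<close>
  have frozen: "frozen_expectation h n g d = (\<integral>\<xi>. F (\<xi>, case_nat r g, d) \<partial>env_measure \<mu> p)"
    if "0 < r" "\<And>i. 0 < g i" for r g d
    using integral_walker_time[of "pos_seq g" r h d 0 n] that
    by (simp add: frozen_expectation_def F_def jump_chain_eq_walker pos_seq_nonneg pos_seq_id less_imp_le)
  have frozen0: "frozen_expectation h n g d = (\<integral>\<xi>. F (\<xi>, case_nat 0 (pos_seq g), d) \<partial>env_measure \<mu> p)" for g d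
    by (simp add: frozen_expectation_def F_def jump_chain_eq_walker)
  have cm: "case_nat 0 (pos_seq g) \<in> space unit_exp_seq" for g
    by (simp add: space_PiM)
  show fm: "frozen_expectation h n g \<in> borel_measurable (coin_flips q)" for g
    unfolding frozen0[abs_def] using measurable_compose[OF measurable_Pair1'[OF cm[of g]] jm] by simp
  have Hp: "(\<lambda>g. H (case_nat 0 (pos_seq g))) \<in> borel_measurable unit_exp_seq"
  proof -
    have "(\<lambda>g. case_nat 0 (pos_seq g)) \<in> measurable unit_exp_seq unit_exp_seq"
      unfolding pos_seq_def[abs_def]
      by (rule measurable_PiM_single') (auto simp: space_PiM split: nat.split)
    then show ?thesis by (rule measurable_compose[OF _ Hm])
  qed
  have "walk_expectation q h n = (\<integral>r. \<integral>g. H (case_nat r g) \<partial>unit_exp_seq \<partial>exp_law 1)"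
    unfolding 1 H_def[symmetric] by (intro integral_iid_seq_first[OF _ Hm HB] prob_space_exp_law) simp
  also have "\<dots> = (\<integral>r. \<integral>g. H (case_nat 0 (pos_seq g)) \<partial>unit_exp_seq \<partial>exp_law 1)"
  proof (rule integral_cong_AE)
    have cn: "(\<lambda>z. case_nat (fst z) (snd z)) \<in> measurable (exp_law 1 \<Otimes>\<^sub>M unit_exp_seq) unit_exp_seq"
      by measurable
    show "(\<lambda>r. \<integral>g. H (case_nat r g) \<partial>unit_exp_seq) \<in> borel_measurable (exp_law 1)"
      using measurable_compose[OF cn Hm]
      by (intro U.borel_measurable_lebesgue_integral) (simp add: case_prod_beta')
    show "AE r in exp_law 1. (\<integral>g. H (case_nat r g) \<partial>unit_exp_seq) = (\<integral>g. H (case_nat 0 (pos_seq g)) \<partial>unit_exp_seq)"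
      using AE_exp_law_pos[OF zero_less_one]
    proof eventually_elim
      case (elim r)
      have "(\<lambda>g. H (case_nat r g)) \<in> borel_measurable unit_exp_seq"
        using measurable_compose[OF measurable_Pair1'[of r "exp_law 1"] measurable_compose[OF cn Hm]] by simp
      then show ?case
      proof (rule integral_cong_AE[OF _ Hp])
        show "AE g in unit_exp_seq. H (case_nat r g) = H (case_nat 0 (pos_seq g))"
          using AE_unit_exp_seq_pos
          by eventually_elim (use elim in \<open>simp add: H_def frozen[symmetric] frozen0[symmetric]\<close>)
      qed
    qed
  qed simp
  also have "\<dots> = (\<integral>g. H (case_nat 0 (pos_seq g)) \<partial>unit_exp_seq)"
    using prob_space.prob_space[OF prob_space_exp_law[of 1]] by simp
  finally show "walk_expectation q h n = (\<integral>g. \<integral>d. frozen_expectation h n g d \<partial>coin_flips q \<partial>unit_exp_seq)"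
    unfolding H_def frozen0 .
qed

lemma integral_threshold:
  fixes f :: "(nat \<Rightarrow> bool) \<Rightarrow> real"
  assumes "0 \<le> \<theta>" "f \<in> borel_measurable (coin_flips (exp (- \<theta>)))"
  shows "(\<integral>u. f (\<lambda>i. \<theta> < u i) \<partial>unit_exp_seq) = (\<integral>d. f d \<partial>coin_flips (exp (- \<theta>)))"
proof -
  have E: "prob_space (exp_law 1)" by (rule prob_space_exp_law) simp
  have t: "(\<lambda>u. \<theta> < u) \<in> measurable (exp_law 1) (count_space UNIV)" by measurable
  have d: "distr unit_exp_seq (iid_seq (count_space UNIV)) (\<lambda>w i. \<theta> < w i) = coin_flips (exp (- \<theta>))"
    using distr_iid_seq_map[OF E t] bernoulli_as_exp_threshold[OF assms(1)]
    by (simp add: coin_flips_eq_iid_seq)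
  have m: "(\<lambda>w i. \<theta> < w i) \<in> measurable unit_exp_seq (iid_seq (count_space UNIV))"
    by (rule measurable_PiM_single') auto
  have "f \<in> borel_measurable (iid_seq (count_space UNIV))"
    using assms(2) by (simp cong: measurable_cong_sets add: sets_coin_flips)
  then show ?thesis unfolding d[symmetric] by (subst integral_distr[OF m]) auto
qed

text \<open>Each walker of the coupled pair is by itself a single walk: in the true environment, to
  which the integral is transferred, the queries of one walker do not disturb the other. This is far
  from evident in the lazy model, where they share a memory.\<close>

lemma lazy_expectation:
  fixes h :: "int \<Rightarrow> real"
  assumes K: "forgotten K" and B: "\<And>z. \<bar>h z\<bar> \<le> B"
  shows "0 \<le> \<theta> \<Longrightarrow> (\<integral>w. h (fst (lazy \<theta> \<theta>' (x, y, K) w n) - x) \<partial>iid_seq ring_law) = walk_expectation (exp (- \<theta>)) h n"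
    and "0 \<le> \<theta>' \<Longrightarrow> (\<integral>w. h (fst (snd (lazy \<theta> \<theta>' (x, y, K) w n)) - y) \<partial>iid_seq ring_law) = walk_expectation (exp (- \<theta>')) h n"
proof -
  assume \<theta>: "0 \<le> \<theta>"
  have "(\<integral>w. h (fst (lazy \<theta> \<theta>' (x, y, K) w n) - x) \<partial>iid_seq ring_law)
    = (\<integral>g. \<integral>u. \<integral>\<xi>. h (fst (walkers (\<lambda>i. (\<theta> < u i, \<theta>' < u i)) (pos_seq g) (dyn_perc \<xi>) 0 x y n) - x)
        \<partial>env_measure \<mu> p \<partial>unit_exp_seq \<partial>unit_exp_seq)"
    using integral_lazy_forgotten[OF K, of "\<lambda>v. h (fst v - x)" B \<theta> \<theta>' x y n] B by simp
  also have "\<dots> = (\<integral>g. \<integral>u. frozen_expectation h n g (\<lambda>i. \<theta> < u i) \<partial>unit_exp_seq \<partial>unit_exp_seq)"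
    by (simp add: frozen_expectation_def walkers_eq_walker integral_walker_shift pos_seq_nonneg)
  also have "\<dots> = walk_expectation (exp (- \<theta>)) h n"
    unfolding walk_expectation_eq(1)[of h B, OF B] using walk_expectation_eq(2)[of h B, OF B]
    by (simp add: integral_threshold[OF \<theta>])
  finally show "(\<integral>w. h (fst (lazy \<theta> \<theta>' (x, y, K) w n) - x) \<partial>iid_seq ring_law) = walk_expectation (exp (- \<theta>)) h n" .
next
  assume \<theta>: "0 \<le> \<theta>'"
  have "(\<integral>w. h (fst (snd (lazy \<theta> \<theta>' (x, y, K) w n)) - y) \<partial>iid_seq ring_law)
    = (\<integral>g. \<integral>u. \<integral>\<xi>. h (snd (walkers (\<lambda>i. (\<theta> < u i, \<theta>' < u i)) (pos_seq g) (dyn_perc \<xi>) 0 x y n) - y)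
        \<partial>env_measure \<mu> p \<partial>unit_exp_seq \<partial>unit_exp_seq)"
    using integral_lazy_forgotten[OF K, of "\<lambda>v. h (snd v - y)" B \<theta> \<theta>' x y n] B by simp
  also have "\<dots> = (\<integral>g. \<integral>u. frozen_expectation h n g (\<lambda>i. \<theta>' < u i) \<partial>unit_exp_seq \<partial>unit_exp_seq)"
    by (simp add: frozen_expectation_def walkers_eq_walker integral_walker_shift pos_seq_nonneg)
  also have "\<dots> = walk_expectation (exp (- \<theta>')) h n"
    unfolding walk_expectation_eq(1)[of h B, OF B] using walk_expectation_eq(2)[of h B, OF B]
    by (simp add: integral_threshold[OF \<theta>])
  finally show "(\<integral>w. h (fst (snd (lazy \<theta> \<theta>' (x, y, K) w n)) - y) \<partial>iid_seq ring_law) = walk_expectation (exp (- \<theta>')) h n" .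
qed

end

section \<open>A Lyapunov function for the validity of the memory\<close>

context percolation
begin

text \<open>
  The load \<open>w\<close> bounds the remaining validity of all remembered answers. Its evolution depends
  neither on the directions nor on the positions of the walkers.
\<close>

definition next_load :: "real \<Rightarrow> real \<times> real \<times> token \<times> token \<Rightarrow> real" where
  "next_load w r = max w (max (fst (fst (snd (snd r)))) (fst (snd (snd (snd r))))) - fst r"

definition load_le :: "state \<Rightarrow> real \<Rightarrow> bool" where
  "load_le st w \<longleftrightarrow> (\<forall>e. snd (snd (snd st) e) \<le> w)"

lemma load_le_ring_step: "load_le st w \<Longrightarrow> load_le (ring_step \<theta> \<theta>' st r) (next_load w r)"
  by (auto simp: load_le_def ring_step_def step_def Let_def elapse_def next_load_def fun_upd_def le_max_iff_disj)

lemma load_le_forgotten: "load_le st w \<Longrightarrow> w \<le> 0 \<Longrightarrow> forgotten (snd (snd st))"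
  by (auto simp: load_le_def forgotten_def intro: order_trans)

lemma measurable_ring_components [measurable]:
  "fst \<in> borel_measurable ring_law" "(\<lambda>r. fst (snd r)) \<in> borel_measurable ring_law"
  "(\<lambda>r. fst (fst (snd (snd r)))) \<in> borel_measurable ring_law"
  "(\<lambda>r. snd (fst (snd (snd r)))) \<in> measurable ring_law (count_space UNIV)"
  "(\<lambda>r. fst (snd (snd (snd r)))) \<in> borel_measurable ring_law"
  "(\<lambda>r. snd (snd (snd (snd r)))) \<in> measurable ring_law (count_space UNIV)"
proof -
  note f = measurable_compose[OF _ measurable_fst] and s = measurable_compose[OF _ measurable_snd]
  have r: "(\<lambda>r. r) \<in> measurable ring_law (exp_law 1 \<Otimes>\<^sub>M (exp_law 1 \<Otimes>\<^sub>M ((exp_law \<mu> \<Otimes>\<^sub>M bern) \<Otimes>\<^sub>M (exp_law \<mu> \<Otimes>\<^sub>M bern))))"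
    by (simp add: ring_law_def tokens_law_def token_law_def)
  show "fst \<in> borel_measurable ring_law" using f[OF r] by (simp cong: measurable_cong_sets)
  show "(\<lambda>r. fst (snd r)) \<in> borel_measurable ring_law" using f[OF s[OF r]] by (simp cong: measurable_cong_sets)
  note t = s[OF s[OF r]]
  show "(\<lambda>r. fst (fst (snd (snd r)))) \<in> borel_measurable ring_law"
    "(\<lambda>r. snd (fst (snd (snd r)))) \<in> measurable ring_law (count_space UNIV)"
    "(\<lambda>r. fst (snd (snd (snd r)))) \<in> borel_measurable ring_law"
    "(\<lambda>r. snd (snd (snd (snd r)))) \<in> measurable ring_law (count_space UNIV)"
    using f[OF f[OF t]] s[OF f[OF t]] f[OF s[OF t]] s[OF s[OF t]] by (simp_all cong: measurable_cong_sets)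
qed

lemma measurable_next_load [measurable]: "next_load w \<in> borel_measurable ring_law"
  unfolding next_load_def[abs_def] by measurable

lemma prob_spaces: "prob_space (exp_law 1)" "prob_space (exp_law \<mu>)" "prob_space bern"
  by (simp_all add: prob_space_exp_law \<mu> measure_pmf.prob_space_axioms)

lemma integral_ring_product:
  fixes f h h' :: "real \<Rightarrow> real"
  assumes f: "integrable (exp_law 1) f" and h: "integrable (exp_law \<mu>) h" "integrable (exp_law \<mu>) h'"
  shows "integrable ring_law (\<lambda>r. f (fst r) * (h (fst (fst (snd (snd r)))) * h' (fst (snd (snd (snd r))))))"
    and "(\<integral>r. f (fst r) * (h (fst (fst (snd (snd r)))) * h' (fst (snd (snd (snd r))))) \<partial>ring_law)
      = (\<integral>x. f x \<partial>exp_law 1) * ((\<integral>x. h x \<partial>exp_law \<mu>) * (\<integral>x. h' x \<partial>exp_law \<mu>))"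
proof -
  have t: "integrable token_law (\<lambda>t. k (fst t))" "(\<integral>t. k (fst t) \<partial>token_law) = (\<integral>x. k x \<partial>exp_law \<mu>)"
    if "integrable (exp_law \<mu>) k" for k :: "real \<Rightarrow> real"
    unfolding token_law_def using integral_fst_component[OF prob_spaces(2,3) that] by auto
  have tt: "integrable tokens_law (\<lambda>t. h (fst (fst t)) * h' (fst (snd t)))"
    "(\<integral>t. h (fst (fst t)) * h' (fst (snd t)) \<partial>tokens_law) = (\<integral>x. h x \<partial>exp_law \<mu>) * (\<integral>x. h' x \<partial>exp_law \<mu>)"
    unfolding tokens_law_def
    using integral_prod_fst_snd[OF prob_space_token_law prob_space_token_law t(1)[OF h(1)] t(1)[OF h(2)]]
      t(2)[OF h(1)] t(2)[OF h(2)] by auto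
  note u = integral_snd_component[OF prob_spaces(1) prob_space_tokens_law tt(1)]
  note r = integral_prod_fst_snd[OF prob_spaces(1) prob_space_pair[OF prob_spaces(1) prob_space_tokens_law] f u(1)]
  show "integrable ring_law (\<lambda>r. f (fst r) * (h (fst (fst (snd (snd r)))) * h' (fst (snd (snd (snd r))))))"
    using r(1) by (simp add: ring_law_def)
  show "(\<integral>r. f (fst r) * (h (fst (fst (snd (snd r)))) * h' (fst (snd (snd (snd r))))) \<partial>ring_law)
      = (\<integral>x. f x \<partial>exp_law 1) * ((\<integral>x. h x \<partial>exp_law \<mu>) * (\<integral>x. h' x \<partial>exp_law \<mu>))"
    using r(2) u(2) tt(2) by (simp add: ring_law_def)
qed

text \<open>Any value strictly between 0 and \<mu> gives validity times a finite exponential moment;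
  one half of \<mu> makes that moment equal to 2.\<close>

definition rate :: real where "rate = \<mu> / 2"

lemma rate_pos: "0 < rate" using \<mu> by (simp add: rate_def)

text \<open>The exponential of the maximum is at most the sum of three exponentials. The clock gap
  contributes the factor \<open>1 / (1 + rate)\<close>, and the two validity times contribute 2
  each.\<close>

lemma exp_next_load:
  shows "integrable ring_law (\<lambda>r. exp (rate * next_load w r))"
    and "(\<integral>r. exp (rate * next_load w r) \<partial>ring_law) \<le> (exp (rate * w) + 4) / (1 + rate)"
proof -
  interpret prob_space ring_law by (rule prob_space_ring_law)
  let ?G = "\<lambda>r. exp (- rate * fst r)"
  let ?L = "\<lambda>r. fst (fst (snd (snd r)))" and ?L' = "\<lambda>r. fst (snd (snd (snd r)))"
  define b where "b r = exp (rate * w) * (?G r * (1 * 1)) + ?G r * (exp (rate * ?L r) * 1) + ?G r * (1 * exp (rate * ?L' r))"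
    for r :: "real \<times> real \<times> token \<times> token"
  have rp: "0 < rate" by (rule rate_pos)
  have g: "integrable (exp_law 1) (\<lambda>x. exp (- rate * x))" "(\<integral>x. exp (- rate * x) \<partial>exp_law 1) = 1 / (1 + rate)"
    using exp_law_exponential_moment[of 1 "- rate"] rp by simp_all
  have l: "integrable (exp_law \<mu>) (\<lambda>x. exp (rate * x))" "(\<integral>x. exp (rate * x) \<partial>exp_law \<mu>) = 2"
    using exp_law_exponential_moment[of \<mu> rate] \<mu> by (simp_all add: rate_def)
  interpret E\<mu>: prob_space "exp_law \<mu>" by (rule prob_spaces)
  have one: "integrable (exp_law \<mu>) (\<lambda>_. 1 :: real)" "(\<integral>x. (1::real) \<partial>exp_law \<mu>) = 1"
    using E\<mu>.prob_space by simp_all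
  note i1 = integral_ring_product[OF g(1) one(1) one(1)]
    and i2 = integral_ring_product[OF g(1) l(1) one(1)]
    and i3 = integral_ring_product[OF g(1) one(1) l(1)]
  define b1 b2 b3 where "b1 r = exp (rate * w) * (?G r * (1 * 1))" and "b2 r = ?G r * (exp (rate * ?L r) * 1)"
    and "b3 r = ?G r * (1 * exp (rate * ?L' r))" for r :: "real \<times> real \<times> token \<times> token"
  have j: "integrable ring_law b1" "integrable ring_law b2" "integrable ring_law b3"
    unfolding b1_def[abs_def] b2_def[abs_def] b3_def[abs_def]
    by (intro integrable_mult_right i1(1) i2(1) i3(1))+
  have k: "(\<integral>r. b1 r \<partial>ring_law) = exp (rate * w) / (1 + rate)" "(\<integral>r. b2 r \<partial>ring_law) = 2 / (1 + rate)"
    "(\<integral>r. b3 r \<partial>ring_law) = 2 / (1 + rate)"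
    unfolding b1_def b2_def b3_def integral_mult_right_zero i1(2) i2(2) i3(2) g l one by simp_all
  have b: "b r = b1 r + b2 r + b3 r" for r by (simp add: b_def b1_def b2_def b3_def)
  have bi: "integrable ring_law b"
    unfolding b[abs_def] using j by simp
  have be: "(\<integral>r. b r \<partial>ring_law) = (exp (rate * w) + 4) / (1 + rate)"
    unfolding b using j k by (simp add: add_divide_distrib)
  have le: "exp (rate * next_load w r) \<le> b r" for r
  proof -
    define m where "m = max w (max (?L r) (?L' r))"
    have "exp (rate * m) \<le> exp (rate * w) + exp (rate * ?L r) + exp (rate * ?L' r)"
      unfolding m_def max_def by (auto intro: add_nonneg_nonneg order_trans[OF _ add_increasing2])
    then have "exp (- rate * fst r) * exp (rate * m)
      \<le> exp (- rate * fst r) * (exp (rate * w) + exp (rate * ?L r) + exp (rate * ?L' r))"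
      by (intro mult_left_mono) auto
    also have "exp (- rate * fst r) * exp (rate * m) = exp (rate * next_load w r)"
      by (simp add: mult_exp_exp next_load_def m_def algebra_simps)
    finally show ?thesis by (simp add: b_def algebra_simps)
  qed
  show i: "integrable ring_law (\<lambda>r. exp (rate * next_load w r))"
    by (rule Bochner_Integration.integrable_bound[OF bi]) (auto intro!: AE_I2 order_trans[OF le])
  show "(\<integral>r. exp (rate * next_load w r) \<partial>ring_law) \<le> (exp (rate * w) + 4) / (1 + rate)"
    unfolding be[symmetric] by (intro integral_mono i bi le)
qed

text \<open>The witness is the probability that the clock gap exceeds \<open>v\<close> and both
  validity times do not; these are independent, and on this event the load drops below 0.\<close>

lemma reset_probability:
  assumes "0 < v"
  shows "\<exists>\<kappa>>(0::real). \<kappa> \<le> 1 \<and> (\<forall>w\<le>v. (\<integral>r. (if 0 < next_load w r then 1 else 0) \<partial>ring_law) \<le> 1 - \<kappa>)"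
proof -
  interpret prob_space ring_law by (rule prob_space_ring_law)
  interpret E1: prob_space "exp_law 1" by (rule prob_spaces)
  interpret E\<mu>: prob_space "exp_law \<mu>" by (rule prob_spaces)
  let ?f = "\<lambda>x. if v < x then 1 else 0 :: real" and ?h = "\<lambda>x. if v < x then 0 else 1 :: real"
  define \<kappa> where "\<kappa> = exp (- v) * ((1 - exp (- \<mu> * v)) * (1 - exp (- \<mu> * v)))"
  have f: "integrable (exp_law 1) ?f" and h: "integrable (exp_law \<mu>) ?h"
    by (auto intro!: integrable_bounded[of _ _ 1] E1.prob_space_axioms E\<mu>.prob_space_axioms)
  note p = integral_ring_product[OF f h h]
  have val: "(\<integral>r. ?f (fst r) * (?h (fst (fst (snd (snd r)))) * ?h (fst (snd (snd (snd r))))) \<partial>ring_law) = \<kappa>"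
    unfolding p(2) using assms \<mu> by (simp add: integral_exp_law_if_less \<kappa>_def)
  have e: "exp (- \<mu> * v) < 1" using assms \<mu> by simp
  have 1: "0 < \<kappa>" using e by (simp add: \<kappa>_def)
  have 2: "\<kappa> \<le> 1"
    unfolding \<kappa>_def using assms e by (intro mult_le_one) (auto intro!: mult_le_one)
  have 3: "(\<integral>r. (if 0 < next_load w r then 1 else 0) \<partial>ring_law) \<le> 1 - \<kappa>" if w: "w \<le> v" for w
  proof -
    have "(\<integral>r. (if 0 < next_load w r then 1 else 0 :: real) \<partial>ring_law)
      \<le> (\<integral>r. 1 - ?f (fst r) * (?h (fst (fst (snd (snd r)))) * ?h (fst (snd (snd (snd r))))) \<partial>ring_law)"
      using p(1) w by (intro integral_mono integrable_bounded[of _ _ 1] prob_space_axioms) (auto simp: next_load_def)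
    also have "\<dots> = 1 - \<kappa>" using p(1) val by (simp add: prob_space)
    finally show ?thesis .
  qed
  show ?thesis by (intro exI[of _ \<kappa>] conjI allI impI 1 2 3)
qed

text \<open>For large loads the exponential contracts. For loads up to \<open>v\<close> the
  expectation loses a fixed part of the constant \<open>A\<close>, because the integrand is 0 after
  a reset.\<close>

lemma lyapunov_drift:
  "\<exists>A \<rho>. 1 \<le> A \<and> 0 < \<rho> \<and> \<rho> < 1 \<and>
    (\<forall>w. (\<integral>r. (if 0 < next_load w r then A + exp (rate * next_load w r) else 0) \<partial>ring_law)
      \<le> \<rho> * (A + exp (rate * w)))"
proof -
  interpret prob_space ring_law by (rule prob_space_ring_law)
  have rp: "0 < rate" by (rule rate_pos)
  define r1 where "r1 = 1 / (1 + rate)"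
  have r1: "0 < r1" "r1 < 1" using rp by (auto simp: r1_def)
  define \<rho>0 where "\<rho>0 = (1 + r1) / 2"
  have \<rho>0: "r1 < \<rho>0" "\<rho>0 < 1" "0 < \<rho>0" using r1 by (auto simp: \<rho>0_def)
  \<comment> \<open>Beyond \<open>v\<close> the surplus
    \<open>(\<rho>0 - r1) * exp (rate * w)\<close> is at least 6 = 4 + 2: 4 for the additive term of
    \<open>exp_next_load\<close>, 2 for \<open>A * (1 - \<rho>)\<close>.\<close>
  define v where "v = max 1 (ln (6 / (\<rho>0 - r1)) / rate)"
  have v: "0 < v" "6 \<le> exp (rate * v) * (\<rho>0 - r1)"
  proof -
    have "ln (6 / (\<rho>0 - r1)) / rate \<le> v" by (simp add: v_def)
    then have "ln (6 / (\<rho>0 - r1)) \<le> rate * v"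
      using rp by (simp add: pos_divide_le_eq mult.commute)
    then have "exp (ln (6 / (\<rho>0 - r1))) \<le> exp (rate * v)" by simp
    then have "6 / (\<rho>0 - r1) \<le> exp (rate * v)" using \<rho>0 by simp
    then show "6 \<le> exp (rate * v) * (\<rho>0 - r1)" using \<rho>0 by (simp add: pos_divide_le_eq)
  qed (simp add: v_def)
  obtain \<kappa> :: real where \<kappa>: "0 < \<kappa>" "\<kappa> \<le> 1"
    and \<kappa>': "\<forall>w\<le>v. (\<integral>r. (if 0 < next_load w r then 1 else 0) \<partial>ring_law) \<le> 1 - \<kappa>"
    using reset_probability[OF v(1)] by (elim exE conjE)
  \<comment> \<open>For loads up to \<open>v\<close> the gain is \<open>A * \<kappa>\<close>, which
    has to cover the same 6.\<close>
  define A where "A = 6 / \<kappa>"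
  \<comment> \<open>The lower bound \<open>1 - \<kappa> / 3\<close> yields
    \<open>A * (1 - \<rho>) \<le> 2\<close>.\<close>
  define \<rho> where "\<rho> = max \<rho>0 (1 - \<kappa> / 3)"
  have \<rho>: "\<rho>0 \<le> \<rho>" "1 - \<kappa> / 3 \<le> \<rho>" "\<rho> < 1" using \<kappa> \<rho>0 by (auto simp: \<rho>_def)
  have A: "1 \<le> A" "A * \<kappa> = 6" using \<kappa> by (simp_all add: A_def)
  have A1: "A * (1 - \<rho>) \<le> 2"
    using mult_left_mono[of "1 - \<rho>" "\<kappa> / 3" A] A \<rho> by simp
  have drift: "(\<integral>r. (if 0 < next_load w r then A + exp (rate * next_load w r) else 0) \<partial>ring_law)
      \<le> \<rho> * (A + exp (rate * w))" for w
  proof -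
    let ?I = "\<lambda>r. if 0 < next_load w r then 1 else 0 :: real"
    have Ii: "integrable ring_law ?I" by (intro integrable_bounded[of _ _ 1] prob_space_axioms) auto
    have "(\<integral>r. (if 0 < next_load w r then A + exp (rate * next_load w r) else 0) \<partial>ring_law)
      \<le> (\<integral>r. A * ?I r + exp (rate * next_load w r) \<partial>ring_law)"
    proof (rule integral_mono)
      show "integrable ring_law (\<lambda>r. if 0 < next_load w r then A + exp (rate * next_load w r) else 0)"
      proof (rule Bochner_Integration.integrable_bound)
        show "integrable ring_law (\<lambda>r. A + exp (rate * next_load w r))"
          using exp_next_load(1) by simp
      qed (use A in \<open>simp_all\<close>)
      show "integrable ring_law (\<lambda>r. A * ?I r + exp (rate * next_load w r))"
        by (intro Bochner_Integration.integrable_add integrable_mult_right Ii exp_next_load)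
    qed auto
    also have "\<dots> = A * (\<integral>r. ?I r \<partial>ring_law) + (\<integral>r. exp (rate * next_load w r) \<partial>ring_law)"
      using Ii exp_next_load(1) by simp
    also have "\<dots> \<le> A * (\<integral>r. ?I r \<partial>ring_law) + r1 * (exp (rate * w) + 4)"
      using exp_next_load(2)[of w] by (simp add: r1_def)
    also have "\<dots> \<le> \<rho> * (A + exp (rate * w))"
    proof (cases "w \<le> v")
      case True
      have "A * (\<integral>r. ?I r \<partial>ring_law) \<le> A * (1 - \<kappa>)"
        using \<kappa>' True A by (intro mult_left_mono) auto
      moreover have "r1 * exp (rate * w) \<le> \<rho> * exp (rate * w)"
        using \<rho>0 \<rho> by (intro mult_right_mono) auto
      moreover have "A * (1 - \<kappa>) = A - 6" "\<rho> * A = A - A * (1 - \<rho>)"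
        using A(2) by (simp_all add: right_diff_distrib)
      ultimately show ?thesis using A1 r1 unfolding distrib_left by linarith
    next
      case False
      have "(\<integral>r. ?I r \<partial>ring_law) \<le> (\<integral>r. 1 \<partial>ring_law)"
        by (intro integral_mono Ii) auto
      then have "A * (\<integral>r. ?I r \<partial>ring_law) \<le> A * 1"
        using A by (intro mult_left_mono) (auto simp: prob_space)
      moreover have "6 \<le> exp (rate * w) * (\<rho> - r1)"
      proof -
        have "exp (rate * v) * (\<rho>0 - r1) \<le> exp (rate * w) * (\<rho> - r1)"
          using False rp \<rho>0 \<rho> by (intro mult_mono) auto
        then show ?thesis using v(2) by simp
      qed
      moreover have "exp (rate * w) * (\<rho> - r1) = \<rho> * exp (rate * w) - r1 * exp (rate * w)"
        "\<rho> * A = A - A * (1 - \<rho>)"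
        by (simp_all add: right_diff_distrib)
      ultimately show ?thesis using A1 r1 unfolding distrib_left by linarith
    qed
    finally show ?thesis .
  qed
  have "0 < \<rho>" using \<rho>0 \<rho> by linarith
  then show ?thesis by (intro exI[of _ A] exI[of _ \<rho>] conjI allI A(1) \<rho>(3) drift)
qed

end

section \<open>Existence of the speed\<close>

context percolation
begin

lemma lazy_Suc: "lazy \<theta> \<theta>' st w (Suc n) = lazy \<theta> \<theta>' (ring_step \<theta> \<theta>' st (w 0)) (\<lambda>i. w (Suc i)) n"
  by (simp add: lazy_def ring_step_def)

lemma ring_step_range:
  "\<bar>fst (ring_step \<theta> \<theta>' st r) - fst st\<bar> \<le> 1" "\<bar>fst (snd (ring_step \<theta> \<theta>' st r)) - fst (snd st)\<bar> \<le> 1"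
  by (simp_all add: ring_step_def step_def Let_def move_def)

lemma lazy_range:
  "\<bar>fst (lazy \<theta> \<theta>' st w n) - fst st\<bar> \<le> int n \<and> \<bar>fst (snd (lazy \<theta> \<theta>' st w n)) - fst (snd st)\<bar> \<le> int n"
proof (induction n arbitrary: st w)
  case (Suc n)
  show ?case
    unfolding lazy_Suc using Suc.IH[of "ring_step \<theta> \<theta>' st (w 0)" "\<lambda>i. w (Suc i)"]
      ring_step_range[of \<theta> \<theta>' st "w 0"] by linarith
qed simp

section \<open>Expectations along the lazy pair of walkers\<close>

definition expect :: "real \<Rightarrow> real \<Rightarrow> (int \<times> int \<Rightarrow> real) \<Rightarrow> nat \<Rightarrow> state \<Rightarrow> real" where
  "expect \<theta> \<theta>' f n st = (\<integral>w. f (pos (lazy \<theta> \<theta>' st w n)) \<partial>iid_seq ring_law)"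

lemma prob_space_rings: "prob_space (iid_seq ring_law)"
  by (intro prob_space_iid_seq prob_space_ring_law)

text \<open>Positions and their squares are unbounded functions, but in \<open>n\<close> rings only
  finitely many positions are reachable; this is the source of integrability.\<close>

lemma bounded_near:
  fixes f :: "int \<times> int \<Rightarrow> real"
  obtains B where "\<And>v. \<bar>fst v - x\<bar> \<le> int n \<Longrightarrow> \<bar>snd v - y\<bar> \<le> int n \<Longrightarrow> \<bar>f v\<bar> \<le> B" "0 \<le> B"
proof -
  let ?S = "{x - int n..x + int n} \<times> {y - int n..y + int n}"
  have "\<bar>f v\<bar> \<le> Max ((\<lambda>v. \<bar>f v\<bar>) ` ?S)" if "\<bar>fst v - x\<bar> \<le> int n" "\<bar>snd v - y\<bar> \<le> int n" for v
  proof -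
    have "v \<in> ?S" using that by (cases v) auto
    then show ?thesis by (intro Max_ge) auto
  qed
  moreover have "0 \<le> Max ((\<lambda>v. \<bar>f v\<bar>) ` ?S)"
    by (rule order_trans[OF abs_ge_zero calculation[of "(x, y)"]]) auto
  ultimately show ?thesis by (rule that)
qed

lemma measurable_lazy_fun:
  "(\<lambda>w. f (pos (lazy \<theta> \<theta>' st w n))) \<in> borel_measurable (iid_seq ring_law)" for f :: "int \<times> int \<Rightarrow> real"
  by (rule measurable_compose[OF measurable_lazy measurable_fun_of_pos]) (use state_in_space in auto)

lemma integrable_lazy_fun:
  fixes f :: "int \<times> int \<Rightarrow> real"
  shows "integrable (iid_seq ring_law) (\<lambda>w. f (pos (lazy \<theta> \<theta>' st w n)))"
proof -
  obtain B where B: "\<And>v. \<bar>fst v - fst st\<bar> \<le> int n \<Longrightarrow> \<bar>snd v - fst (snd st)\<bar> \<le> int n \<Longrightarrow> \<bar>f v\<bar> \<le> B"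
    using bounded_near by metis
  show ?thesis
    using lazy_range by (intro integrable_bounded[of _ _ B] prob_space_rings measurable_lazy_fun B) auto
qed

lemma expect_0: "expect \<theta> \<theta>' f 0 st = f (pos st)"
  by (simp add: expect_def prob_space.prob_space[OF prob_space_rings])

lemma measurable_ring_step:
  assumes "r \<in> measurable N ring_law"
  shows "(\<lambda>x. ring_step \<theta> \<theta>' st (r x)) \<in> measurable N state_space"
proof -
  note [measurable] = assms
  have m: "(\<lambda>x. fst (r x)) \<in> borel_measurable N"
    and [measurable]: "(\<lambda>x. fst (snd (r x))) \<in> borel_measurable N"
    by (rule measurable_compose[OF assms measurable_ring_components(1)],
        rule measurable_compose[OF assms measurable_ring_components(2)])
  have "(\<lambda>x. r x) \<in> measurable N (exp_law 1 \<Otimes>\<^sub>M (exp_law 1 \<Otimes>\<^sub>M tokens_law))"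
    using assms by (simp add: ring_law_def)
  from measurable_compose[OF measurable_compose[OF this measurable_snd] measurable_snd]
  have t: "(\<lambda>x. snd (snd (r x))) \<in> measurable N tokens_space"
    by (simp cong: measurable_cong_sets add: sets_tokens_law)
  have d: "(\<lambda>x. (\<theta> < fst (snd (r x)), \<theta>' < fst (snd (r x)))) \<in> measurable N (count_space UNIV)"
  proof -
    have "(\<lambda>x. (\<theta> < fst (snd (r x)), \<theta>' < fst (snd (r x)))) \<in> measurable N (count_space UNIV \<Otimes>\<^sub>M count_space UNIV)"
      by measurable
    then show ?thesis by (simp add: pair_measure_countable)
  qed
  show ?thesis
    unfolding ring_step_def by (rule measurable_step[OF d m _ t]) (use state_in_space in auto)
qed

lemma integrable_expect_step:
  "integrable ring_law (\<lambda>r. expect \<theta> \<theta>' f n (ring_step \<theta> \<theta>' st r))"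
proof -
  interpret S: prob_space "iid_seq ring_law" by (rule prob_space_rings)
  obtain B where B: "\<And>v. \<bar>fst v - fst st\<bar> \<le> int (Suc n) \<Longrightarrow> \<bar>snd v - fst (snd st)\<bar> \<le> int (Suc n) \<Longrightarrow> \<bar>f v\<bar> \<le> B"
    and B0: "0 \<le> B" using bounded_near by metis
  have "(\<lambda>z. f (pos (lazy \<theta> \<theta>' (ring_step \<theta> \<theta>' st (fst z)) (snd z) n))) \<in> borel_measurable (ring_law \<Otimes>\<^sub>M iid_seq ring_law)"
    by (rule measurable_compose[OF measurable_lazy[OF measurable_ring_step] measurable_fun_of_pos]) auto
  then have "(\<lambda>r. expect \<theta> \<theta>' f n (ring_step \<theta> \<theta>' st r)) \<in> borel_measurable ring_law"
    unfolding expect_def by (intro S.borel_measurable_lebesgue_integral) (simp add: case_prod_beta')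
  moreover have "\<bar>expect \<theta> \<theta>' f n (ring_step \<theta> \<theta>' st r)\<bar> \<le> B" for r
    unfolding expect_def
  proof (intro abs_integral_le prob_space_rings AE_I2 B0 B)
    fix w
    show "\<bar>fst (pos (lazy \<theta> \<theta>' (ring_step \<theta> \<theta>' st r) w n)) - fst st\<bar> \<le> int (Suc n)"
      "\<bar>snd (pos (lazy \<theta> \<theta>' (ring_step \<theta> \<theta>' st r) w n)) - fst (snd st)\<bar> \<le> int (Suc n)"
      using lazy_range[of \<theta> \<theta>' "ring_step \<theta> \<theta>' st r" w n] ring_step_range[of \<theta> \<theta>' st r] by simp_all linarith+
  qed
  ultimately show ?thesis by (intro integrable_bounded prob_space_ring_law)
qed

lemma expect_Suc:
  "expect \<theta> \<theta>' f (Suc n) st = (\<integral>r. expect \<theta> \<theta>' f n (ring_step \<theta> \<theta>' st r) \<partial>ring_law)"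
proof -
  have "expect \<theta> \<theta>' f (Suc n) st = (\<integral>r. \<integral>w. f (pos (lazy \<theta> \<theta>' st (case_nat r w) (Suc n))) \<partial>iid_seq ring_law \<partial>ring_law)"
    unfolding expect_def
    by (rule integral_iid_seq_first_integrable[OF prob_space_ring_law integrable_lazy_fun])
  then show ?thesis by (simp add: expect_def)
qed

lemma expect_linear:
  "expect \<theta> \<theta>' (\<lambda>v. a * f v + b * g v + c) n st = a * expect \<theta> \<theta>' f n st + b * expect \<theta> \<theta>' g n st + c"
proof -
  interpret S: prob_space "iid_seq ring_law" by (rule prob_space_rings)
  show ?thesis
    unfolding expect_def using integrable_lazy_fun[of f \<theta> \<theta>' st n] integrable_lazy_fun[of g \<theta> \<theta>' st n]
    by (simp add: S.prob_space)
qed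

lemma expect_mono:
  assumes "\<And>v. \<bar>fst v - fst st\<bar> \<le> int n \<Longrightarrow> \<bar>snd v - fst (snd st)\<bar> \<le> int n \<Longrightarrow> f v \<le> g v"
  shows "expect \<theta> \<theta>' f n st \<le> expect \<theta> \<theta>' g n st"
  unfolding expect_def using lazy_range by (intro integral_mono integrable_lazy_fun assms) auto

lemma expect_const: "expect \<theta> \<theta>' (\<lambda>_. c) n st = c"
  using expect_linear[of \<theta> \<theta>' 0 "\<lambda>_. 0" 0 "\<lambda>_. 0" c n st] by simp

abbreviation "X \<equiv> \<lambda>v. real_of_int (fst v)"
abbreviation "Y \<equiv> \<lambda>v. real_of_int (snd v)"

lemma jump_chain_range: "\<bar>jump_chain w n\<bar> \<le> int n"
  using walker_shift_bound[of "snd (snd w)" _ _ _ 0 n] jump_chain_eq_walker[of "fst w" "fst (snd w)" "snd (snd w)" n]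
  by (cases w) (auto simp: prod_eq_iff)

lemma expect_forgotten:
  fixes h :: "int \<Rightarrow> real"
  assumes K: "forgotten (snd (snd st))"
  shows "0 \<le> \<theta> \<Longrightarrow> expect \<theta> \<theta>' (\<lambda>v. h (fst v - fst st)) n st = walk_expectation (exp (- \<theta>)) h n"
    and "0 \<le> \<theta>' \<Longrightarrow> expect \<theta> \<theta>' (\<lambda>v. h (snd v - fst (snd st))) n st = walk_expectation (exp (- \<theta>')) h n"
proof -
  \<comment> \<open>The transfer to the walk needs bounded functions; truncation outside the range
    of \<open>n\<close> rings changes neither side.\<close>
  define k where "k z = (if \<bar>z\<bar> \<le> int n then h z else 0)" for z
  obtain B where B: "\<And>v. \<bar>fst v - 0\<bar> \<le> int n \<Longrightarrow> \<bar>snd v - 0\<bar> \<le> int n \<Longrightarrow> \<bar>h (fst v)\<bar> \<le> B" "0 \<le> B"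
    using bounded_near[of 0 n 0 "\<lambda>v. h (fst v)"] by metis
  have kB: "\<bar>k z\<bar> \<le> B" for z using B(1)[of "(z, 0)"] B(2) by (auto simp: k_def)
  have wk: "walk_expectation q k n = walk_expectation q h n" for q
    unfolding walk_expectation_def k_def using jump_chain_range[of _ n] by simp
  have st: "st = (fst st, fst (snd st), snd (snd st))" by simp
  have e1: "expect \<theta> \<theta>' (\<lambda>v. h (fst v - fst st)) n st = expect \<theta> \<theta>' (\<lambda>v. k (fst v - fst st)) n st"
    unfolding expect_def k_def using lazy_range[of \<theta> \<theta>' st _ n] by simp
  have e2: "expect \<theta> \<theta>' (\<lambda>v. h (snd v - fst (snd st))) n st = expect \<theta> \<theta>' (\<lambda>v. k (snd v - fst (snd st))) n st"
    unfolding expect_def k_def using lazy_range[of \<theta> \<theta>' st _ n] by simp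
  show "0 \<le> \<theta> \<Longrightarrow> expect \<theta> \<theta>' (\<lambda>v. h (fst v - fst st)) n st = walk_expectation (exp (- \<theta>)) h n"
    using lazy_expectation(1)[where h=k and B=B and \<theta>=\<theta> and \<theta>'=\<theta>' and x="fst st" and y="fst (snd st)" and n=n, OF K kB] e1 wk
    by (simp add: expect_def)
  show "0 \<le> \<theta>' \<Longrightarrow> expect \<theta> \<theta>' (\<lambda>v. h (snd v - fst (snd st))) n st = walk_expectation (exp (- \<theta>')) h n"
    using lazy_expectation(2)[where h=k and B=B and \<theta>=\<theta> and \<theta>'=\<theta>' and x="fst st" and y="fst (snd st)" and n=n, OF K kB] e2 wk
    by (simp add: expect_def)
qed

definition mean :: "real \<Rightarrow> nat \<Rightarrow> real" where
  "mean \<theta> n = walk_expectation (exp (- \<theta>)) real_of_int n"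

lemma expect_X_forgotten:
  assumes "forgotten (snd (snd st))" "0 \<le> \<theta>"
  shows "expect \<theta> \<theta>' X n st = real_of_int (fst st) + mean \<theta> n"
  using expect_forgotten(1)[OF assms(1,2), of \<theta>' real_of_int n]
    expect_linear[of \<theta> \<theta>' 1 X 0 X "- real_of_int (fst st)" n st]
  by (simp add: mean_def)

lemma expect_Y_forgotten:
  assumes "forgotten (snd (snd st))" "0 \<le> \<theta>'"
  shows "expect \<theta> \<theta>' Y n st = real_of_int (fst (snd st)) + mean \<theta>' n"
  using expect_forgotten(2)[OF assms(1,2), of \<theta> real_of_int n]
    expect_linear[of \<theta> \<theta>' 1 Y 0 Y "- real_of_int (fst (snd st))" n st]
  by (simp add: mean_def)

end

text \<open>The constants of \<open>lyapunov_drift\<close> are fixed here so that definitions can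
  depend on them. They do not depend on the thresholds, which makes all later bounds uniform in the
  bias.\<close>

locale percolation_drift = percolation +
  fixes A \<rho> :: real
  assumes A: "1 \<le> A" and \<rho>: "0 < \<rho>" "\<rho> < 1"
    and drift: "\<And>w. (\<integral>r. (if 0 < next_load w r then A + exp (rate * next_load w r) else 0) \<partial>ring_law)
      \<le> \<rho> * (A + exp (rate * w))"
begin

definition V :: "real \<Rightarrow> real" where "V w = A + exp (rate * w)"

lemma V_ge_1: "1 \<le> V w"
  using A by (simp add: V_def add_increasing2)

lemma integrable_V: "integrable ring_law (\<lambda>r. V (next_load w r))"
proof -
  interpret prob_space ring_law by (rule prob_space_ring_law)
  show ?thesis unfolding V_def using exp_next_load(1) by simp
qed

lemma integrable_V_pos: "integrable ring_law (\<lambda>r. if 0 < next_load w r then V (next_load w r) else 0)"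
proof (rule Bochner_Integration.integrable_bound[OF integrable_V])
  have "0 \<le> V z" for z using V_ge_1[of z] by simp
  then show "AE r in ring_law. norm (if 0 < next_load w r then V (next_load w r) else 0) \<le> norm (V (next_load w r))"
    by simp
  have [measurable]: "(\<lambda>r. V (next_load w r)) \<in> borel_measurable ring_law" by (rule borel_measurable_integrable[OF integrable_V])
  show "(\<lambda>r. if 0 < next_load w r then V (next_load w r) else 0) \<in> borel_measurable ring_law"
    by measurable
qed

lemma drift_V: "(\<integral>r. (if 0 < next_load w r then V (next_load w r) else 0) \<partial>ring_law) \<le> \<rho> * V w"
  unfolding V_def by (rule drift)

text \<open>In contrast to \<open>drift_V\<close> the expectation includes nonpositive loads, at the
  price of an additive constant. The second moment needs this form, since its error accumulates over
  all rings.\<close>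

lemma growth_V: "(\<integral>r. V (next_load w r) \<partial>ring_law) \<le> V w / (1 + rate) + (A + 4)"
proof -
  interpret prob_space ring_law by (rule prob_space_ring_law)
  have "(\<integral>r. V (next_load w r) \<partial>ring_law) = A + (\<integral>r. exp (rate * next_load w r) \<partial>ring_law)"
    unfolding V_def using exp_next_load(1) by (simp add: prob_space)
  also have "\<dots> \<le> A + (exp (rate * w) + 4) / (1 + rate)"
    using exp_next_load(2)[of w] by simp
  also have "\<dots> \<le> V w / (1 + rate) + (A + 4)"
  proof -
    have "4 / (1 + rate) \<le> 4" "0 \<le> A / (1 + rate)"
      using rate_pos A by (simp_all add: pos_divide_le_eq)
    then show ?thesis by (simp add: V_def add_divide_distrib)
  qed
  finally show ?thesis .
qed

section \<open>Geometric convergence of the expected displacement per ring\<close>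

definition drift_at :: "real \<Rightarrow> real \<Rightarrow> nat \<Rightarrow> state \<Rightarrow> real" where
  "drift_at \<theta> \<theta>' m st = expect \<theta> \<theta>' X (Suc m) st - expect \<theta> \<theta>' X m st"

lemma drift_at_Suc:
  "drift_at \<theta> \<theta>' (Suc m) st = (\<integral>r. drift_at \<theta> \<theta>' m (ring_step \<theta> \<theta>' st r) \<partial>ring_law)"
  "integrable ring_law (\<lambda>r. drift_at \<theta> \<theta>' m (ring_step \<theta> \<theta>' st r))"
  unfolding drift_at_def expect_Suc[of _ _ _ "Suc m"] expect_Suc[of _ _ _ m st]
  using integrable_expect_step by simp_all

lemma drift_at_forgotten:
  "forgotten (snd (snd st)) \<Longrightarrow> 0 \<le> \<theta> \<Longrightarrow> drift_at \<theta> \<theta>' m st = mean \<theta> (Suc m) - mean \<theta> m"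
  by (simp add: drift_at_def expect_X_forgotten)

lemma drift_at_bound: "\<bar>drift_at \<theta> \<theta>' m st\<bar> \<le> 1"
proof -
  have "- 1 \<le> drift_at \<theta> \<theta>' m st \<and> drift_at \<theta> \<theta>' m st \<le> 1"
  proof (induction m arbitrary: st)
    case 0
    have "expect \<theta> \<theta>' X (Suc 0) st \<le> real_of_int (fst st) + 1"
      using expect_mono[of st "Suc 0" X "\<lambda>_. real_of_int (fst st) + 1" \<theta> \<theta>'] by (simp add: expect_const)
    moreover have "real_of_int (fst st) - 1 \<le> expect \<theta> \<theta>' X (Suc 0) st"
      using expect_mono[of st "Suc 0" "\<lambda>_. real_of_int (fst st) - 1" X \<theta> \<theta>'] by (simp add: expect_const)
    ultimately show ?case by (simp add: drift_at_def expect_0)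
  next
    case (Suc m)
    interpret prob_space ring_law by (rule prob_space_ring_law)
    have "drift_at \<theta> \<theta>' (Suc m) st \<le> (\<integral>r. 1 \<partial>ring_law)"
      unfolding drift_at_Suc(1) using Suc.IH by (intro integral_mono drift_at_Suc(2)) auto
    moreover have "(\<integral>r. - 1 \<partial>ring_law) \<le> drift_at \<theta> \<theta>' (Suc m) st"
      unfolding drift_at_Suc(1) using Suc.IH
      by (intro integral_mono drift_at_Suc(2)) auto
    ultimately show ?case by (simp add: prob_space)
  qed
  then show ?thesis by linarith
qed

text \<open>
  Both runs use the same rings, and once the load is not positive both memories are empty and the
  two drifts agree.
\<close>

lemma drift_at_close:
  assumes "load_le st w" "load_le st' w" and \<theta>: "0 \<le> \<theta>"
  shows "\<bar>drift_at \<theta> \<theta>' m st - drift_at \<theta> \<theta>' m st'\<bar> \<le> (if 0 < w then 2 * \<rho> ^ m * V w else 0)"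
  using assms(1,2)
proof (induction m arbitrary: st st' w)
  case 0
  have "2 \<le> 2 * V w" using V_ge_1[of w] by simp
  then show ?case
    using drift_at_bound[of \<theta> \<theta>' 0 st] drift_at_bound[of \<theta> \<theta>' 0 st'] 0
    by (cases "0 < w") (auto simp: drift_at_forgotten[OF load_le_forgotten] \<theta>)
next
  case (Suc m)
  show ?case
  proof (cases "0 < w")
    case False
    then show ?thesis using Suc.prems by (simp add: drift_at_forgotten[OF load_le_forgotten] \<theta>)
  next
    case True
    have "\<bar>drift_at \<theta> \<theta>' (Suc m) st - drift_at \<theta> \<theta>' (Suc m) st'\<bar>
      = \<bar>\<integral>r. drift_at \<theta> \<theta>' m (ring_step \<theta> \<theta>' st r) - drift_at \<theta> \<theta>' m (ring_step \<theta> \<theta>' st' r) \<partial>ring_law\<bar>"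
      unfolding drift_at_Suc(1) using drift_at_Suc(2) by simp
    also have "\<dots> \<le> (\<integral>r. \<bar>drift_at \<theta> \<theta>' m (ring_step \<theta> \<theta>' st r) - drift_at \<theta> \<theta>' m (ring_step \<theta> \<theta>' st' r)\<bar> \<partial>ring_law)"
      by (rule integral_abs_bound)
    also have "\<dots> \<le> (\<integral>r. (2 * \<rho> ^ m) * (if 0 < next_load w r then V (next_load w r) else 0) \<partial>ring_law)"
    proof (rule integral_mono)
      show "integrable ring_law (\<lambda>r. \<bar>drift_at \<theta> \<theta>' m (ring_step \<theta> \<theta>' st r) - drift_at \<theta> \<theta>' m (ring_step \<theta> \<theta>' st' r)\<bar>)"
        using drift_at_Suc(2) by (intro integrable_abs Bochner_Integration.integrable_diff)
      show "integrable ring_law (\<lambda>r. (2 * \<rho> ^ m) * (if 0 < next_load w r then V (next_load w r) else 0))"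
        by (intro integrable_mult_right integrable_V_pos)
      fix r
      show "\<bar>drift_at \<theta> \<theta>' m (ring_step \<theta> \<theta>' st r) - drift_at \<theta> \<theta>' m (ring_step \<theta> \<theta>' st' r)\<bar>
        \<le> (2 * \<rho> ^ m) * (if 0 < next_load w r then V (next_load w r) else 0)"
        using Suc.IH[OF load_le_ring_step[OF Suc.prems(1)] load_le_ring_step[OF Suc.prems(2)], of \<theta> \<theta>' r \<theta> \<theta>']
        by (simp split: if_splits)
    qed
    also have "\<dots> \<le> (2 * \<rho> ^ m) * (\<rho> * V w)"
      using \<rho> drift_V[of w] by (simp add: mult_left_mono)
    finally show ?thesis using True by (simp add: mult_ac)
  qed
qed

definition st0 :: state where "st0 = (0, 0, \<lambda>_. (False, 0))"

lemma st0: "load_le st0 0" "0 \<le> w \<Longrightarrow> load_le st0 w" "forgotten (snd (snd st0))" "fst st0 = 0" "fst (snd st0) = 0"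
  by (auto simp: st0_def load_le_def forgotten_def)

definition C0 :: real where "C0 = 2 * \<rho> * V 0 / (1 - \<rho>)"

text \<open>The drift at index \<open>m + 1\<close> averages the drifts at index \<open>m\<close>
  from the states after one ring. Those states have load at most \<open>next_load 0 r\<close>, so
  \<open>drift_at_close\<close> compares them with \<open>st0\<close> and makes successive
  differences geometrically small.\<close>

lemma mean_increments_converge:
  assumes \<theta>: "0 \<le> \<theta>"
  shows "\<exists>v. \<forall>m. \<bar>(mean \<theta> (Suc m) - mean \<theta> m) - v\<bar> \<le> C0 * \<rho> ^ m"
proof -
  let ?d = "\<lambda>m. drift_at \<theta> \<theta> m st0"
  interpret prob_space ring_law by (rule prob_space_ring_law)
  have "\<bar>?d (Suc m) - ?d m\<bar> \<le> (2 * \<rho> * V 0) * \<rho> ^ m" for m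
  proof -
    have "\<bar>?d (Suc m) - ?d m\<bar> = \<bar>\<integral>r. drift_at \<theta> \<theta> m (ring_step \<theta> \<theta> st0 r) - ?d m \<partial>ring_law\<bar>"
      unfolding drift_at_Suc(1) using drift_at_Suc(2) by (simp add: prob_space)
    also have "\<dots> \<le> (\<integral>r. \<bar>drift_at \<theta> \<theta> m (ring_step \<theta> \<theta> st0 r) - ?d m\<bar> \<partial>ring_law)"
      by (rule integral_abs_bound)
    also have "\<dots> \<le> (\<integral>r. (2 * \<rho> ^ m) * (if 0 < next_load 0 r then V (next_load 0 r) else 0) \<partial>ring_law)"
    proof (rule integral_mono)
      show "integrable ring_law (\<lambda>r. \<bar>drift_at \<theta> \<theta> m (ring_step \<theta> \<theta> st0 r) - ?d m\<bar>)"
        using drift_at_Suc(2) by (intro integrable_abs Bochner_Integration.integrable_diff) auto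
      show "integrable ring_law (\<lambda>r. (2 * \<rho> ^ m) * (if 0 < next_load 0 r then V (next_load 0 r) else 0))"
        by (intro integrable_mult_right integrable_V_pos)
      fix r
      note l = load_le_ring_step[OF st0(1), of \<theta> \<theta> r]
      show "\<bar>drift_at \<theta> \<theta> m (ring_step \<theta> \<theta> st0 r) - ?d m\<bar>
        \<le> (2 * \<rho> ^ m) * (if 0 < next_load 0 r then V (next_load 0 r) else 0)"
      proof (cases "0 < next_load 0 r")
        case True
        then show ?thesis using drift_at_close[OF l st0(2) \<theta>, of \<theta> m] by simp
      next
        case False
        then show ?thesis using st0(3) by (simp add: drift_at_forgotten[OF load_le_forgotten[OF l]] drift_at_forgotten \<theta>)
      qed
    qed
    also have "\<dots> \<le> (2 * \<rho> ^ m) * (\<rho> * V 0)"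
      using \<rho> drift_V[of 0] by (simp add: mult_left_mono)
    finally show ?thesis by (simp add: mult_ac)
  qed
  from geometric_increments_converge[OF less_imp_le[OF \<rho>(1)] \<rho>(2) this]
  show ?thesis using st0(3) by (simp add: drift_at_forgotten \<theta> C0_def)
qed

definition limit_speed :: "real \<Rightarrow> real" where
  "limit_speed \<theta> = (SOME v. \<forall>m. \<bar>(mean \<theta> (Suc m) - mean \<theta> m) - v\<bar> \<le> C0 * \<rho> ^ m)"

lemma limit_speed: "0 \<le> \<theta> \<Longrightarrow> \<bar>(mean \<theta> (Suc m) - mean \<theta> m) - limit_speed \<theta>\<bar> \<le> C0 * \<rho> ^ m"
  unfolding limit_speed_def using someI_ex[OF mean_increments_converge] by blast

definition C1 :: real where "C1 = (2 + C0) / (1 - \<rho>)"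

lemma C0_nonneg: "0 \<le> C0"
  using \<rho> V_ge_1[of 0] by (simp add: C0_def)

lemma C1_nonneg: "0 \<le> C1"
  using \<rho> C0_nonneg by (simp add: C1_def)

lemma drift_at_limit:
  assumes st: "load_le st w" and \<theta>: "0 \<le> \<theta>"
  shows "\<bar>drift_at \<theta> \<theta>' m st - limit_speed \<theta>\<bar> \<le> (2 + C0) * V w * \<rho> ^ m"
proof -
  have V: "1 \<le> V w" "0 \<le> \<rho> ^ m" using V_ge_1 \<rho> by auto
  have d0: "\<bar>drift_at \<theta> \<theta>' m st0 - limit_speed \<theta>\<bar> \<le> C0 * \<rho> ^ m"
    using limit_speed[OF \<theta>, of m] st0(3) by (simp add: drift_at_forgotten \<theta>)
  have "\<bar>drift_at \<theta> \<theta>' m st - drift_at \<theta> \<theta>' m st0\<bar> \<le> 2 * \<rho> ^ m * V w"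
  proof (cases "0 < w")
    case True
    then show ?thesis using drift_at_close[OF st st0(2) \<theta>, of \<theta>' m] by simp
  next
    case False
    then show ?thesis using st0(3) V by (simp add: drift_at_forgotten[OF load_le_forgotten[OF st]] drift_at_forgotten \<theta>)
  qed
  moreover have "C0 * \<rho> ^ m \<le> C0 * \<rho> ^ m * V w"
    using mult_left_mono[OF V(1), of "C0 * \<rho> ^ m"] V(2) C0_nonneg by simp
  ultimately show ?thesis using d0 by (simp add: algebra_simps)
qed

text \<open>The errors of the drifts sum to a geometric series, so the total error is bounded in
  \<open>n\<close> and depends on the start only through \<open>V w\<close>.\<close>

lemma expect_X_limit:
  assumes st: "load_le st w" and \<theta>: "0 \<le> \<theta>"
  shows "\<bar>expect \<theta> \<theta>' X n st - fst st - limit_speed \<theta> * real n\<bar> \<le> C1 * V w"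
proof -
  have "expect \<theta> \<theta>' X n st - real_of_int (fst st) - limit_speed \<theta> * real n
      = (\<Sum>m<n. drift_at \<theta> \<theta>' m st - limit_speed \<theta>)"
    by (induction n) (simp_all add: expect_0 drift_at_def algebra_simps)
  also have "\<bar>\<dots>\<bar> \<le> (\<Sum>m<n. (2 + C0) * V w * \<rho> ^ m)"
    by (intro order_trans[OF sum_abs] sum_mono drift_at_limit[OF st \<theta>])
  also have "\<dots> = (2 + C0) * V w * ((1 - \<rho> ^ n) / (1 - \<rho>))"
    using \<rho> sum_gp_strict[of \<rho> n] by (simp add: sum_distrib_left[symmetric])
  also have "\<dots> \<le> (2 + C0) * V w * (1 / (1 - \<rho>))"
    using \<rho> C0_nonneg V_ge_1[of w] by (intro mult_left_mono divide_right_mono) auto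
  finally show ?thesis by (simp add: C1_def)
qed

section \<open>Second moments and the law of large numbers for the jump chain\<close>

lemma limit_speed_bound:
  assumes \<theta>: "0 \<le> \<theta>"
  shows "\<bar>limit_speed \<theta>\<bar> \<le> 1"
proof -
  have "(\<lambda>m. C0 * \<rho> ^ m) \<longlonglongrightarrow> C0 * 0" using \<rho> by (intro tendsto_mult tendsto_const LIMSEQ_realpow_zero) auto
  then have z: "(\<lambda>m. C0 * \<rho> ^ m + 1) \<longlonglongrightarrow> 0 + 1" by (intro tendsto_add tendsto_const) simp
  have "\<bar>limit_speed \<theta>\<bar> \<le> C0 * \<rho> ^ m + 1" for m
    using limit_speed[OF \<theta>, of m] drift_at_bound[of \<theta> \<theta> m st0] st0(3)
    by (simp add: drift_at_forgotten \<theta>)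
  then show ?thesis using LIMSEQ_le_const[OF z] by simp
qed

text \<open>The constants close the induction of \<open>expect_second_moment\<close>:
  \<open>b2\<close> solves \<open>(b2 + 4 * C1) / (1 + rate) = b2\<close>, and \<open>a2\<close> is
  the cost per ring that remains.\<close>

definition b2 :: real where "b2 = 4 * C1 / rate"
definition a2 :: real where "a2 = (b2 + 4 * C1) * (A + 4) + 4"

text \<open>Conditioning on the first ring and expanding the square leaves a cross term. It is not
  zero as for independent increments, but \<open>expect_X_limit\<close> bounds it by a multiple of
  \<open>V\<close>, whose growth is controlled.\<close>

lemma expect_second_moment:
  assumes st: "load_le st w" and \<theta>: "0 \<le> \<theta>"
  shows "expect \<theta> \<theta>' (\<lambda>v. (X v - fst st - limit_speed \<theta> * real n)\<^sup>2) n st \<le> a2 * real n + b2 * V w"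
  using st
proof (induction n arbitrary: st w)
  case 0
  have "0 \<le> b2 * V w" using C1_nonneg rate_pos V_ge_1[of w] by (simp add: b2_def)
  then show ?case by (simp add: expect_0)
next
  case (Suc n)
  let ?v = "limit_speed \<theta>" and ?s = "ring_step \<theta> \<theta>' st"
  interpret prob_space ring_law by (rule prob_space_ring_law)
  have "expect \<theta> \<theta>' (\<lambda>v. (X v - fst st - ?v * real (Suc n))\<^sup>2) (Suc n) st
    = (\<integral>r. expect \<theta> \<theta>' (\<lambda>v. (X v - fst st - ?v * real (Suc n))\<^sup>2) n (?s r) \<partial>ring_law)"
    by (rule expect_Suc)
  also have "\<dots> \<le> (\<integral>r. a2 * real n + (b2 + 4 * C1) * V (next_load w r) + 4 \<partial>ring_law)"
  proof (rule integral_mono)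
    show "integrable ring_law (\<lambda>r. a2 * real n + (b2 + 4 * C1) * V (next_load w r) + 4)"
      using integrable_V by simp
    fix r
    note l = load_le_ring_step[OF Suc.prems, of \<theta> \<theta>' r]
    define c where "c = real_of_int (fst (?s r)) - fst st - ?v"
    have c: "\<bar>c\<bar> \<le> 2"
      using ring_step_range(1)[of \<theta> \<theta>' st r] limit_speed_bound[OF \<theta>] unfolding c_def by linarith
    let ?f = "\<lambda>v. (X v - fst (?s r) - ?v * real n)\<^sup>2"
    \<comment> \<open>\<open>c\<close> is the centred displacement of the first ring; the square is
      rewritten as a combination of the later square and the later position.\<close>
    have sq: "(X v - fst st - ?v * real (Suc n))\<^sup>2
       = 1 * ?f v + (2 * c) * X v + (c\<^sup>2 - 2 * c * (real_of_int (fst (?s r)) + ?v * real n))" for v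
      unfolding c_def by (simp add: power2_eq_square algebra_simps)
    have "expect \<theta> \<theta>' (\<lambda>v. (X v - fst st - ?v * real (Suc n))\<^sup>2) n (?s r)
      = expect \<theta> \<theta>' ?f n (?s r) + 2 * c * (expect \<theta> \<theta>' X n (?s r) - fst (?s r) - ?v * real n) + c\<^sup>2"
      unfolding sq expect_linear by (simp add: algebra_simps)
    moreover have "expect \<theta> \<theta>' ?f n (?s r) \<le> a2 * real n + b2 * V (next_load w r)"
      by (rule Suc.IH[OF l])
    moreover have "2 * c * (expect \<theta> \<theta>' X n (?s r) - fst (?s r) - ?v * real n) \<le> 4 * (C1 * V (next_load w r))"
    proof -
      have "2 * c * (expect \<theta> \<theta>' X n (?s r) - fst (?s r) - ?v * real n)
        \<le> \<bar>2 * c\<bar> * \<bar>expect \<theta> \<theta>' X n (?s r) - fst (?s r) - ?v * real n\<bar>"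
        by (simp add: abs_mult[symmetric])
      also have "\<dots> \<le> 4 * (C1 * V (next_load w r))"
        using c by (intro mult_mono expect_X_limit[OF l \<theta>]) auto
      finally show ?thesis .
    qed
    moreover have "c\<^sup>2 \<le> 4" using c abs_le_square_iff[of c 2] by simp
    ultimately show "expect \<theta> \<theta>' (\<lambda>v. (X v - fst st - ?v * real (Suc n))\<^sup>2) n (?s r)
      \<le> a2 * real n + (b2 + 4 * C1) * V (next_load w r) + 4"
      by (simp add: algebra_simps)
  qed (rule integrable_expect_step)
  also have "\<dots> = a2 * real n + (b2 + 4 * C1) * (\<integral>r. V (next_load w r) \<partial>ring_law) + 4"
    using integrable_V by (simp add: prob_space)
  also have "\<dots> \<le> a2 * real n + (b2 + 4 * C1) * (V w / (1 + rate) + (A + 4)) + 4"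
    using mult_left_mono[OF growth_V[of w], of "b2 + 4 * C1"] C1_nonneg rate_pos by (simp add: b2_def)
  also have "\<dots> = a2 * real (Suc n) + b2 * V w"
  proof -
    have "(b2 + 4 * C1) / (1 + rate) = b2"
    proof -
      have "b2 * rate = 4 * C1" using rate_pos by (simp add: b2_def)
      then have "b2 + 4 * C1 = b2 * (1 + rate)" by (simp add: distrib_left)
      then show ?thesis using rate_pos by simp
    qed
    then have "(b2 + 4 * C1) * (V w / (1 + rate)) = b2 * V w" by (metis times_divide_eq_left times_divide_eq_right)
    then show ?thesis by (simp add: a2_def distrib_left algebra_simps)
  qed
  finally show ?case .
qed

lemma mean_limit: "0 \<le> \<theta> \<Longrightarrow> \<bar>mean \<theta> n - limit_speed \<theta> * real n\<bar> \<le> C1 * V 0"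
  using expect_X_limit[OF st0(1), of \<theta> \<theta> n] st0 by (simp add: expect_X_forgotten)

lemma walk_second_moment:
  "0 \<le> \<theta> \<Longrightarrow> walk_expectation (exp (- \<theta>)) (\<lambda>z. (real_of_int z - limit_speed \<theta> * real n)\<^sup>2) n \<le> a2 * real n + b2 * V 0"
  using expect_second_moment[OF st0(1), of \<theta> \<theta> n] st0
    expect_forgotten(1)[OF st0(3), of \<theta> \<theta> "\<lambda>z. (real_of_int z - limit_speed \<theta> * real n)\<^sup>2" n] by simp

text \<open>The position is not monotone, but position plus number of rings is, because a ring
  lowers the position by at most 1. The law of large numbers is applied to this sum, with limit
  increased by 1.\<close>

lemma AE_jump_chain_LIMSEQ:
  assumes \<theta>: "0 \<le> \<theta>"
  shows "AE w in biased_measure (exp (- \<theta>)). (\<lambda>n. real_of_int (jump_chain w n) / real n) \<longlonglongrightarrow> limit_speed \<theta>"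
proof -
  let ?v = "limit_speed \<theta>"
  interpret prob_space "biased_measure (exp (- \<theta>))" by (rule prob_space_biased_measure)
  have eq: "(real_of_int (jump_chain w n) + real n - (?v + 1) * real n)\<^sup>2 = (real_of_int (jump_chain w n) - ?v * real n)\<^sup>2" for w n
    by (simp add: algebra_simps)
  have "AE w in biased_measure (exp (- \<theta>)). (\<lambda>n. (real_of_int (jump_chain w n) + real n) / real n) \<longlonglongrightarrow> ?v + 1"
  proof (rule AE_LIMSEQ_of_second_moment[where C=a2 and D="b2 * V 0"])
    fix n
    have m: "(\<lambda>w. (real_of_int (jump_chain w n) - ?v * real n)\<^sup>2) \<in> borel_measurable (biased_measure (exp (- \<theta>)))"
      by (rule measurable_compose[OF measurable_jump_chain]) simp
    have "\<bar>(real_of_int (jump_chain w n) - ?v * real n)\<^sup>2\<bar> \<le> (2 * real n)\<^sup>2" for w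
    proof -
      have "\<bar>real_of_int (jump_chain w n)\<bar> \<le> real n" using jump_chain_range[of w n] by linarith
      moreover have "\<bar>?v * real n\<bar> \<le> real n"
        using limit_speed_bound[OF \<theta>] by (simp add: abs_mult mult_left_le_one_le)
      ultimately have "\<bar>real_of_int (jump_chain w n) - ?v * real n\<bar> \<le> \<bar>2 * real n\<bar>" by linarith
      then show ?thesis by (simp only: abs_le_square_iff abs_power2)
    qed
    then show "integrable (biased_measure (exp (- \<theta>))) (\<lambda>w. (real_of_int (jump_chain w n) + real n - (?v + 1) * real n)\<^sup>2)"
      unfolding eq by (intro integrable_bounded[OF prob_space_axioms m])
    show "(\<integral>w. (real_of_int (jump_chain w n) + real n - (?v + 1) * real n)\<^sup>2 \<partial>biased_measure (exp (- \<theta>))) \<le> a2 * real n + b2 * V 0"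
      unfolding eq using walk_second_moment[OF \<theta>] by (simp add: walk_expectation_def)
  next
    have "jump_chain w n \<le> jump_chain w (Suc n) + 1" for w :: "env_sample \<times> walker_sample" and n
      by (cases w, cases "snd w") (simp add: Let_def)
    then show "AE w in biased_measure (exp (- \<theta>)). \<forall>n. real_of_int (jump_chain w n) + real n \<le> real_of_int (jump_chain w (Suc n)) + real (Suc n)"
      by (intro AE_I2 allI) (simp add: add.commute flip: of_int_le_iff, smt (verit) of_int_1 of_int_add of_int_le_iff)
  qed (rule prob_space_axioms)
  then show ?thesis
  proof eventually_elim
    case (elim w)
    have "(\<lambda>n. (real_of_int (jump_chain w n) + real n) / real n - 1) \<longlonglongrightarrow> ?v + 1 - 1"
      by (intro tendsto_diff elim tendsto_const)
    moreover have "\<forall>\<^sub>F n in sequentially. (real_of_int (jump_chain w n) + real n) / real n - 1 = real_of_int (jump_chain w n) / real n"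
      using eventually_gt_at_top[of 0] by eventually_elim (simp add: add_divide_distrib)
    ultimately show ?case by (simp add: tendsto_cong)
  qed
qed

end

section \<open>Strict monotonicity and the limit of the speed\<close>

context percolation
begin

lemma integral_u_component:
  fixes f :: "real \<Rightarrow> real"
  assumes "integrable (exp_law 1) f"
  shows "integrable ring_law (\<lambda>r. f (fst (snd r)))" "(\<integral>r. f (fst (snd r)) \<partial>ring_law) = (\<integral>x. f x \<partial>exp_law 1)"
proof -
  note a = integral_fst_component[OF prob_spaces(1) prob_space_tokens_law assms]
  note b = integral_snd_component[OF prob_spaces(1) prob_space_pair[OF prob_spaces(1) prob_space_tokens_law] a(1)]
  show "integrable ring_law (\<lambda>r. f (fst (snd r)))" "(\<integral>r. f (fst (snd r)) \<partial>ring_law) = (\<integral>x. f x \<partial>exp_law 1)"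
    using a b by (simp_all add: ring_law_def)
qed

lemma AE_ring_pos:
  "AE r in ring_law. 0 < fst r \<and> 0 < fst (snd r) \<and> 0 < fst (fst (snd (snd r))) \<and> 0 < fst (snd (snd (snd r)))"
proof -
  have T: "AE t in token_law. 0 < fst t"
    unfolding token_law_def by (intro AE_fst_component prob_spaces AE_exp_law_pos \<mu>)
  have TT: "AE t in tokens_law. 0 < fst (fst t)" "AE t in tokens_law. 0 < fst (snd t)"
    unfolding tokens_law_def using T
    by (auto intro: AE_fst_component[where P="\<lambda>t. 0 < fst t"] AE_snd_component[where P="\<lambda>t. 0 < fst t"] prob_space_token_law)
  have U: "AE v in exp_law 1 \<Otimes>\<^sub>M tokens_law. 0 < fst v \<and> 0 < fst (fst (snd v)) \<and> 0 < fst (snd (snd v))"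
    using AE_fst_component[OF prob_space_tokens_law AE_exp_law_pos[OF zero_less_one]]
      AE_snd_component[OF prob_spaces(1) prob_space_tokens_law TT(1)]
      AE_snd_component[OF prob_spaces(1) prob_space_tokens_law TT(2)]
    by eventually_elim auto
  show ?thesis
    unfolding ring_law_def
    using AE_fst_component[OF prob_space_pair[OF prob_spaces(1) prob_space_tokens_law] AE_exp_law_pos[OF zero_less_one]]
      AE_snd_component[OF prob_spaces(1) prob_space_pair[OF prob_spaces(1) prob_space_tokens_law] U]
    by eventually_elim auto
qed

text \<open>
  Two walkers at the same site query the same edge when they choose the same direction, and they get
  the same answer.
\<close>

lemma ring_step_order:
  assumes "fst st \<le> fst (snd st)" "\<theta>' \<le> \<theta>" "0 < fst (fst (snd (snd r)))"
  shows "fst (ring_step \<theta> \<theta>' st r) \<le> fst (snd (ring_step \<theta> \<theta>' st r))"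
proof -
  obtain x y K where st: "st = (x, y, K)" by (cases st) auto
  obtain g u L B L' B' where r: "r = (g, u, (L, B), (L', B'))" by (cases r) auto
  consider "x = y" | "x + 1 = y" | "x + 2 \<le> y" using assms(1) by (fastforce simp: st)
  then show ?thesis
  proof cases
    case 1
    have "\<theta> < u \<Longrightarrow> \<theta>' < u" using assms(2) by simp
    then show ?thesis using 1 assms(3)
      by (cases "\<theta> < u"; cases "\<theta>' < u")
        (auto simp: st r ring_step_def step_def Let_def move_def edge_def answer_def)
  next
    case 2
    have "\<theta> < u \<Longrightarrow> \<theta>' < u" using assms(2) by simp
    then show ?thesis using 2
      by (cases "\<theta> < u"; cases "\<theta>' < u")
        (auto simp: st r ring_step_def step_def Let_def move_def)
  next
    case 3
    then show ?thesis
      using ring_step_range[of \<theta> \<theta>' st r] by (simp add: st)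
  qed
qed

lemma ring_step_same:
  assumes "fst st = fst (snd st)" "\<theta> < fst (snd r)" "\<theta>' < fst (snd r)" "0 < fst (fst (snd (snd r)))"
  shows "fst (ring_step \<theta> \<theta>' st r) = fst (snd (ring_step \<theta> \<theta>' st r))"
  using assms by (simp add: ring_step_def step_def Let_def move_def edge_def answer_def)

section \<open>Growth and smallness of the gap between two coupled walkers\<close>

abbreviation "gap \<equiv> \<lambda>v. Y v - X v"

lemma expect_gap: "expect \<theta> \<theta>' gap n st = expect \<theta> \<theta>' Y n st - expect \<theta> \<theta>' X n st"
  using expect_linear[of \<theta> \<theta>' 1 Y "- 1" X 0 n st] by simp

text \<open>The gap won at one ring from an empty memory, counted only if the load is spent right
  after it, so that this gap survives as a pure translation of a fresh start.\<close>

definition kick :: "real \<Rightarrow> real \<Rightarrow> real \<times> real \<times> token \<times> token \<Rightarrow> real" where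
  "kick \<theta> \<theta>' r = (if next_load 0 r \<le> 0 then gap (pos (ring_step \<theta> \<theta>' (0, 0, \<lambda>_. (False, 0)) r)) else 0)"

lemma integrable_kick: "integrable ring_law (kick \<theta> \<theta>')"
proof -
  have "integrable ring_law (\<lambda>r. gap (pos (ring_step \<theta> \<theta>' (0, 0, \<lambda>_. (False, 0)) r)))"
    using integrable_expect_step[of \<theta> \<theta>' gap 0] by (simp add: expect_0)
  then have [measurable]: "(\<lambda>r. gap (pos (ring_step \<theta> \<theta>' (0, 0, \<lambda>_. (False, 0)) r))) \<in> borel_measurable ring_law"
    by (rule borel_measurable_integrable)
  have m: "kick \<theta> \<theta>' \<in> borel_measurable ring_law" unfolding kick_def[abs_def] by measurable
  have "\<bar>kick \<theta> \<theta>' r\<bar> \<le> 2" for r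
  proof -
    let ?s = "ring_step \<theta> \<theta>' (0, 0, \<lambda>_. (False, 0)) r"
    have "\<bar>fst (snd ?s) - fst ?s\<bar> \<le> 2"
      using ring_step_range[of \<theta> \<theta>' "(0, 0, \<lambda>_. (False, 0))" r] unfolding fst_conv snd_conv by linarith
    then have "\<bar>real_of_int (fst (snd ?s) - fst ?s)\<bar> \<le> 2" by linarith
    then show ?thesis by (simp add: kick_def)
  qed
  then show ?thesis using m by (intro integrable_bounded[OF prob_space_ring_law])
qed

text \<open>A gap of at least 1 arises if the direction variable separates the thresholds, the edge
  to the right is open for the second walker, and the clock gap exceeds 1 while both validity times
  do not. The walkers query different edges then, so the second one uses its own coin.\<close>

lemma kick_positive:
  assumes "0 \<le> \<theta>'" "\<theta>' < \<theta>"
  shows "0 < (\<integral>r. kick \<theta> \<theta>' r \<partial>ring_law)"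
proof -
  interpret E1: prob_space "exp_law 1" by (rule prob_spaces)
  interpret E\<mu>: prob_space "exp_law \<mu>" by (rule prob_spaces)
  let ?f = "\<lambda>x. if 1 < x then 1 else 0 :: real"
  \<comment> \<open>As the thresholds are ordered, this difference is the indicator of the interval
    between them.\<close>
  let ?k = "\<lambda>u. (if \<theta>' < u then 1 else 0) - (if \<theta> < u then 1 else 0) :: real"
  let ?h = "\<lambda>l. if 1 < l then 0 else 1 :: real"
  let ?b = "\<lambda>B. if B then 1 else 0 :: real"
  have fi: "integrable (exp_law 1) ?f" and ki: "integrable (exp_law 1) ?k" and hi: "integrable (exp_law \<mu>) ?h"
    by (intro integrable_bounded[of _ _ 1] prob_spaces; auto)+
  have bi: "integrable bern ?b" by (intro integrable_bounded[of _ _ 1] prob_spaces) auto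
  have kv: "(\<integral>u. ?k u \<partial>exp_law 1) = exp (- \<theta>') - exp (- \<theta>)"
  proof (subst Bochner_Integration.integral_diff)
    show "integrable (exp_law 1) (\<lambda>u. if \<theta>' < u then 1 else 0 :: real)"
      "integrable (exp_law 1) (\<lambda>u. if \<theta> < u then 1 else 0 :: real)"
      by (intro integrable_bounded[of _ _ 1] prob_spaces; auto)+
  qed (use assms in \<open>simp add: integral_exp_law_if_less\<close>)
  note t1 = integral_fst_component[OF prob_spaces(2,3) hi]
  note t2 = integral_prod_fst_snd[OF prob_spaces(2,3) hi bi]
  note tt = integral_prod_fst_snd[OF prob_space_token_law prob_space_token_law, unfolded token_law_def, OF t1(1) t2(1)]
  note ut = integral_prod_fst_snd[OF prob_spaces(1) prob_space_tokens_law[unfolded tokens_law_def token_law_def] ki tt(1)]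
  note rr = integral_prod_fst_snd[OF prob_spaces(1) prob_space_pair[OF prob_spaces(1)
      prob_space_tokens_law[unfolded tokens_law_def token_law_def]] fi ut(1)]
  let ?F = "\<lambda>r. ?f (fst r) * (?k (fst (snd r)) * (?h (fst (fst (snd (snd r)))) *
      (?h (fst (snd (snd (snd r)))) * ?b (snd (snd (snd (snd r)))))))"
  have F: "integrable ring_law ?F"
    "(\<integral>r. ?F r \<partial>ring_law) = (\<integral>x. ?f x \<partial>exp_law 1) * ((\<integral>u. ?k u \<partial>exp_law 1) * ((\<integral>x. ?h x \<partial>exp_law \<mu>) *
       ((\<integral>x. ?h x \<partial>exp_law \<mu>) * (\<integral>B. ?b B \<partial>bern))))"
    using rr ut(2) tt(2) t1(2) t2(2) unfolding ring_law_def tokens_law_def token_law_def by simp_all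
  have "0 < (\<integral>r. ?F r \<partial>ring_law)"
    unfolding F(2) kv using assms \<mu> p by (simp add: integral_exp_law_if_less integral_bern)
  also have "\<dots> \<le> (\<integral>r. kick \<theta> \<theta>' r \<partial>ring_law)"
  proof (rule integral_mono_AE[OF F(1) integrable_kick])
    show "AE r in ring_law. ?F r \<le> kick \<theta> \<theta>' r"
      using AE_ring_pos
    proof eventually_elim
      case (elim r)
      let ?st = "(0, 0, \<lambda>_. (False, 0)) :: state"
      have "0 \<le> gap (pos (ring_step \<theta> \<theta>' ?st r))"
        using ring_step_order[of ?st \<theta>' \<theta> r] assms elim by simp
      then have k0: "0 \<le> kick \<theta> \<theta>' r" by (simp add: kick_def)
      show ?case
      proof (cases "1 < fst r \<and> \<theta>' < fst (snd r) \<and> \<not> \<theta> < fst (snd r) \<and> \<not> 1 < fst (fst (snd (snd r))) \<and>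
          \<not> 1 < fst (snd (snd (snd r))) \<and> snd (snd (snd (snd r)))")
        case True
        then have "next_load 0 r \<le> 0" by (simp add: next_load_def)
        moreover have "1 \<le> gap (pos (ring_step \<theta> \<theta>' ?st r))"
          using True by (simp add: ring_step_def step_def Let_def move_def edge_def answer_def)
        ultimately show ?thesis using True by (simp add: kick_def)
      next
        case False
        have "?F r \<le> 0" using False assms by (auto split: if_splits)
        then show ?thesis using k0 by simp
      qed
    qed
  qed
  finally show ?thesis .
qed

text \<open>Walkers at a common site stay together as long as the direction variable exceeds
  \<theta>. A ring at which this fails has probability \<open>1 - exp (- \<theta>)\<close> and costs
  at most twice the number of rings left, itself included; summation gives the square.\<close>

lemma expect_gap_small:
  assumes \<theta>: "0 \<le> \<theta>" and st: "fst st = fst (snd st)"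
  shows "expect \<theta> 0 gap n st \<le> 2 * (real n)\<^sup>2 * (1 - exp (- \<theta>))"
  using st
proof (induction n arbitrary: st)
  case 0
  then show ?case by (simp add: expect_0)
next
  case (Suc n)
  let ?e = "1 - exp (- \<theta>)"
  have e: "0 \<le> ?e" "?e \<le> 1" using \<theta> by auto
  let ?k = "\<lambda>u. if \<theta> < u then 2 * (real n)\<^sup>2 * ?e else 2 * real (Suc n)"
  have "(\<lambda>u. ?k u) \<in> borel_measurable (exp_law 1)" by measurable
  then have ki: "integrable (exp_law 1) ?k"
    using e by (intro integrable_bounded[of _ _ "2 * (real n)\<^sup>2 + 2 * real (Suc n)"] prob_spaces)
      (auto simp: abs_mult mult_left_le intro: add_increasing add_increasing2)
  have "expect \<theta> 0 gap (Suc n) st = (\<integral>r. expect \<theta> 0 gap n (ring_step \<theta> 0 st r) \<partial>ring_law)"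
    by (rule expect_Suc)
  also have "\<dots> \<le> (\<integral>r. ?k (fst (snd r)) \<partial>ring_law)"
  proof (rule integral_mono_AE[OF integrable_expect_step integral_u_component(1)[OF ki]])
    show "AE r in ring_law. expect \<theta> 0 gap n (ring_step \<theta> 0 st r) \<le> ?k (fst (snd r))"
      using AE_ring_pos
    proof eventually_elim
      case (elim r)
      show ?case
      proof (cases "\<theta> < fst (snd r)")
        case True
        then show ?thesis using Suc.IH[OF ring_step_same[OF Suc.prems True]] elim by simp
      next
        case False
        have "expect \<theta> 0 gap n (ring_step \<theta> 0 st r) \<le> expect \<theta> 0 (\<lambda>_. 2 * real (Suc n)) n (ring_step \<theta> 0 st r)"
        proof (rule expect_mono)
          fix v :: "int \<times> int"
          assume v: "\<bar>fst v - fst (ring_step \<theta> 0 st r)\<bar> \<le> int n" "\<bar>snd v - fst (snd (ring_step \<theta> 0 st r))\<bar> \<le> int n"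
          have "snd v \<le> fst (snd (ring_step \<theta> 0 st r)) + int n" using v(2) by linarith
          moreover have "fst (ring_step \<theta> 0 st r) \<le> fst v + int n" using v(1) by linarith
          moreover have "fst (snd (ring_step \<theta> 0 st r)) \<le> fst (snd st) + 1"
            using ring_step_range(2)[of \<theta> 0 st r] by linarith
          moreover have "fst st \<le> fst (ring_step \<theta> 0 st r) + 1"
            using ring_step_range(1)[of \<theta> 0 st r] by linarith
          ultimately have "snd v - fst v \<le> 2 * int (Suc n)" using Suc.prems by simp
          then show "gap v \<le> 2 * real (Suc n)" by linarith
        qed
        then show ?thesis using False by (simp add: expect_const)
      qed
    qed
  qed
  also have "\<dots> = exp (- \<theta>) * (2 * (real n)\<^sup>2 * ?e) + ?e * (2 * real (Suc n))"
    unfolding integral_u_component(2)[OF ki] using integral_exp_law_if_less[of 1 \<theta>] \<theta> by simp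
  also have "\<dots> \<le> 1 * (2 * (real n)\<^sup>2 * ?e) + ?e * (2 * real (Suc n))"
    using \<theta> e by (intro add_mono mult_right_mono) auto
  also have "\<dots> \<le> 2 * (real (Suc n))\<^sup>2 * ?e"
  proof -
    have "2 * (real n)\<^sup>2 + 2 * real (Suc n) \<le> 2 * (real (Suc n))\<^sup>2" by (simp add: power2_eq_square algebra_simps)
    from mult_right_mono[OF this e(1)] show ?thesis by (simp add: algebra_simps)
  qed
  finally show ?case .
qed

subsection \<open>The totally biased walk\<close>

text \<open>The clock of rate 1 rings before a validity time of rate \<mu> ends with probability
  \<open>1 / (1 + \<mu>)\<close>. The coin is that of the first token and the validity that of the
  second: for coinciding walkers the first finds the answer and the second rewrites its
  validity.\<close>

lemma integral_ring_race:
  fixes f :: "bool \<Rightarrow> bool \<Rightarrow> real"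
  shows "integrable ring_law (\<lambda>r. f (snd (fst (snd (snd r)))) (fst r < fst (snd (snd (snd r)))))"
    and "(\<integral>r. f (snd (fst (snd (snd r)))) (fst r < fst (snd (snd (snd r)))) \<partial>ring_law)
      = p * (f True True / (1 + \<mu>) + f True False * (\<mu> / (1 + \<mu>)))
        + (1 - p) * (f False True / (1 + \<mu>) + f False False * (\<mu> / (1 + \<mu>)))"
proof -
  define B where "B = Max (range (\<lambda>(b, c). \<bar>f b c\<bar>))"
  have B: "\<bar>f b c\<bar> \<le> B" for b c
  proof -
    have "finite (range (\<lambda>(b, c). \<bar>f b c\<bar>))" by simp
    then show ?thesis unfolding B_def by (rule Max_ge) (auto intro: range_eqI[of _ _ "(b, c)"])
  qed
  let ?F = "\<lambda>r. f (snd (fst (snd (snd r)))) (fst r < fst (snd (snd (snd r))))"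
  have Fm: "?F \<in> borel_measurable ring_law"
  proof -
    have [measurable]: "(\<lambda>r. (snd (fst (snd (snd r))), fst r < fst (snd (snd (snd r))))) \<in> measurable ring_law (count_space UNIV)"
    proof -
      have "(\<lambda>r. (snd (fst (snd (snd r))), fst r < fst (snd (snd (snd r))))) \<in> measurable ring_law (count_space UNIV \<Otimes>\<^sub>M count_space UNIV)"
        by measurable
      then show ?thesis by (simp add: pair_measure_countable)
    qed
    have "(\<lambda>r. (\<lambda>(b, c). f b c) (snd (fst (snd (snd r))), fst r < fst (snd (snd (snd r))))) \<in> borel_measurable ring_law"
      by (rule measurable_compose[where N="count_space UNIV"]) auto
    then show ?thesis by simp
  qed
  then show "integrable ring_law ?F" by (intro integrable_bounded[OF prob_space_ring_law _ B])
  let ?q = "\<lambda>b g. exp (- \<mu> * g) * f b True + (1 - exp (- \<mu> * g)) * f b False"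
  have in1: "(\<integral>T'. f b (g < fst T') \<partial>token_law) = ?q b g" if g: "0 \<le> g" for b g
  proof -
    have i: "integrable (exp_law \<mu>) (\<lambda>l. if g < l then f b True else f b False)"
      by (intro integrable_bounded[of _ _ B] prob_spaces) (auto simp: B)
    have "(\<integral>T'. f b (g < fst T') \<partial>token_law) = (\<integral>T'. (if g < fst T' then f b True else f b False) \<partial>token_law)"
      by (intro Bochner_Integration.integral_cong) auto
    also have "\<dots> = (\<integral>l. (if g < l then f b True else f b False) \<partial>exp_law \<mu>)"
      unfolding token_law_def by (rule integral_fst_component(2)[OF prob_spaces(2,3) i])
    also have "\<dots> = ?q b g" by (rule integral_exp_law_if_less[OF \<mu> g])
    finally show ?thesis .
  qed
  have in2: "(\<integral>T. h (snd T) \<partial>token_law) = p * h True + (1 - p) * h False" for h :: "bool \<Rightarrow> real"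
  proof -
    have "integrable bern h"
      by (intro integrable_bounded[of _ _ "\<bar>h True\<bar> + \<bar>h False\<bar>"] prob_spaces) (auto, metis (full_types) abs_ge_zero add_increasing add_increasing2 order_refl)
    from integral_snd_component(2)[OF prob_spaces(2,3) this] show ?thesis
      by (simp add: token_law_def integral_bern)
  qed
  have m2: "(\<lambda>v. f (snd (fst (snd v))) (g < fst (snd (snd v)))) \<in> borel_measurable (exp_law 1 \<Otimes>\<^sub>M tokens_law)" for g
    using measurable_compose[OF measurable_Pair1'[of g "exp_law 1" "exp_law 1 \<Otimes>\<^sub>M tokens_law"] Fm[unfolded ring_law_def]] by simp
  have m3: "(\<lambda>t. f (snd (fst t)) (g < fst (snd t))) \<in> borel_measurable (token_law \<Otimes>\<^sub>M token_law)" for g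
    using measurable_compose[OF measurable_Pair1'[of 0 "exp_law 1" tokens_law] m2[of g]] by (simp add: tokens_law_def)
  interpret E1: prob_space "exp_law 1" by (rule prob_spaces)
  interpret ET: prob_space "exp_law 1 \<Otimes>\<^sub>M tokens_law" by (intro prob_space_pair prob_spaces prob_space_tokens_law)
  have inner: "(\<integral>v. f (snd (fst (snd v))) (g < fst (snd (snd v))) \<partial>(exp_law 1 \<Otimes>\<^sub>M tokens_law))
      = p * ?q True g + (1 - p) * ?q False g" if g: "0 \<le> g" for g
  proof -
    have "(\<integral>v. f (snd (fst (snd v))) (g < fst (snd (snd v))) \<partial>(exp_law 1 \<Otimes>\<^sub>M tokens_law))
      = (\<integral>u. \<integral>t. f (snd (fst t)) (g < fst (snd t)) \<partial>tokens_law \<partial>exp_law 1)"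
      using integral_pair_iterated(1)[OF prob_spaces(1) prob_space_tokens_law m2[of g] B] by simp
    also have "\<dots> = (\<integral>t. f (snd (fst t)) (g < fst (snd t)) \<partial>(token_law \<Otimes>\<^sub>M token_law))"
      using E1.prob_space by (simp add: tokens_law_def)
    also have "\<dots> = (\<integral>T. \<integral>T'. f (snd T) (g < fst T') \<partial>token_law \<partial>token_law)"
      using integral_pair_iterated(1)[OF prob_space_token_law prob_space_token_law m3[of g] B] by simp
    also have "\<dots> = p * ?q True g + (1 - p) * ?q False g"
      unfolding in1[OF g] by (rule in2)
    finally show ?thesis .
  qed
  have em: "integrable (exp_law 1) (\<lambda>x. exp (- \<mu> * x))" "(\<integral>x. exp (- \<mu> * x) \<partial>exp_law 1) = 1 / (1 + \<mu>)"
    using exp_law_exponential_moment[of 1 "- \<mu>"] \<mu> by simp_all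
  have iq: "(\<integral>g. c * exp (- \<mu> * g) + d \<partial>exp_law 1) = c / (1 + \<mu>) + d" for c d
    using em E1.prob_space by simp
  have "(\<integral>r. ?F r \<partial>ring_law) = (\<integral>g. \<integral>v. f (snd (fst (snd v))) (g < fst (snd (snd v))) \<partial>(exp_law 1 \<Otimes>\<^sub>M tokens_law) \<partial>exp_law 1)"
    using integral_pair_iterated(1)[OF prob_spaces(1) ET.prob_space_axioms Fm[unfolded ring_law_def] B] by (simp add: ring_law_def)
  also have "\<dots> = (\<integral>g. p * ?q True g + (1 - p) * ?q False g \<partial>exp_law 1)"
  proof (rule integral_cong_AE)
    have "(\<lambda>z. f (snd (fst (snd (snd z)))) (fst z < fst (snd (snd (snd z))))) \<in> borel_measurable (exp_law 1 \<Otimes>\<^sub>M (exp_law 1 \<Otimes>\<^sub>M tokens_law))"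
      using Fm by (simp add: ring_law_def)
    then show "(\<lambda>g. \<integral>v. f (snd (fst (snd v))) (g < fst (snd (snd v))) \<partial>(exp_law 1 \<Otimes>\<^sub>M tokens_law)) \<in> borel_measurable (exp_law 1)"
      by (intro ET.borel_measurable_lebesgue_integral) (simp add: case_prod_beta')
    show "AE g in exp_law 1. (\<integral>v. f (snd (fst (snd v))) (g < fst (snd (snd v))) \<partial>(exp_law 1 \<Otimes>\<^sub>M tokens_law))
        = p * ?q True g + (1 - p) * ?q False g"
      using AE_exp_law_pos[OF zero_less_one] by eventually_elim (rule inner, simp)
  qed measurable
  also have "\<dots> = (\<integral>g. (p * (f True True - f True False) + (1 - p) * (f False True - f False False)) * exp (- \<mu> * g)
      + (p * f True False + (1 - p) * f False False) \<partial>exp_law 1)"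
    by (intro Bochner_Integration.integral_cong refl) (simp add: algebra_simps)
  also have "\<dots> = p * (f True True / (1 + \<mu>) + f True False * (\<mu> / (1 + \<mu>)))
        + (1 - p) * (f False True / (1 + \<mu>) + f False False * (\<mu> / (1 + \<mu>)))"
  proof -
    have m: "\<mu> / (1 + \<mu>) = 1 - inverse (1 + \<mu>)" using \<mu> by (simp add: field_simps)
    have d: "x / (1 + \<mu>) = x * inverse (1 + \<mu>)" for x by (rule divide_inverse)
    show ?thesis unfolding iq m unfolding d by (simp add: algebra_simps)
  qed
  finally show "(\<integral>r. ?F r \<partial>ring_law) = p * (f True True / (1 + \<mu>) + f True False * (\<mu> / (1 + \<mu>)))
        + (1 - p) * (f False True / (1 + \<mu>) + f False False * (\<mu> / (1 + \<mu>)))" .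
qed

text \<open>
  With total bias, the only remembered answer that can matter is a closed edge ahead. The value \<open>c\<close>
  of an unexplored edge ahead is chosen such that \<open>front_value c\<close> increases by exactly \<open>v\<close> per ring
  in expectation.
\<close>

definition front :: "state \<Rightarrow> bool" where
  "front st \<longleftrightarrow> fst st = fst (snd st) \<and> (\<forall>e>fst st. snd (snd (snd st) e) \<le> 0) \<and>
    (0 < snd (snd (snd st) (fst st)) \<longrightarrow> \<not> fst (snd (snd st) (fst st)))"

definition front_value :: "real \<Rightarrow> state \<Rightarrow> real" where
  "front_value c st = real_of_int (fst st) + (if snd (snd (snd st) (fst st)) \<le> 0 then c else 0)"

text \<open>An open answer moves both walkers to a site whose edge ahead is unexplored, and the open
  edge lies behind them. A closed answer stays known at the next ring exactly if its new validity
  time outlasts the clock gap.\<close>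

lemma front_step:
  assumes "front st" "0 < fst r" "0 < fst (snd r)" "0 < fst (fst (snd (snd r)))" "0 < fst (snd (snd (snd r)))"
  shows "front (ring_step 0 0 st r)"
    and "front_value c (ring_step 0 0 st r) =
      (if snd (snd (snd st) (fst st)) \<le> 0 \<and> snd (fst (snd (snd r))) then real_of_int (fst st) + 1 + c
       else if fst r < fst (snd (snd (snd r))) then real_of_int (fst st) else real_of_int (fst st) + c)"
proof -
  obtain x y K where st: "st = (x, y, K)" by (cases st) auto
  obtain g u L B L' B' where r: "r = (g, u, (L, B), (L', B'))" by (cases r) auto
  have y: "y = x" and K: "\<And>e. x < e \<Longrightarrow> snd (K e) \<le> 0" "0 < snd (K x) \<Longrightarrow> \<not> fst (K x)"
    using assms(1) by (auto simp: front_def st)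
  define b where "b = answer K x B"
  have s: "ring_step 0 0 st r = (move x True b, move x True b, elapse g (K(x := (b, L'))))"
    using assms by (simp add: st r y ring_step_def step_def Let_def edge_def answer_def b_def)
  have b: "b \<longleftrightarrow> snd (K x) \<le> 0 \<and> B"
    using K(2) by (auto simp: b_def answer_def)
  have K1: "snd (K (x + 1)) \<le> g" using K(1)[of "x + 1"] assms(2) by (simp add: r)
  have Ke: "snd (K e) \<le> g" if "x < e" for e using K(1)[OF that] assms(2) by (simp add: r)
  show "front (ring_step 0 0 st r)"
    unfolding s front_def using K1 by (auto simp: move_def elapse_def intro!: Ke)
  show "front_value c (ring_step 0 0 st r) =
      (if snd (snd (snd st) (fst st)) \<le> 0 \<and> snd (fst (snd (snd r))) then real_of_int (fst st) + 1 + c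
       else if fst r < fst (snd (snd (snd r))) then real_of_int (fst st) else real_of_int (fst st) + c)"
    unfolding s front_value_def using K1 b by (auto simp: move_def elapse_def st r)
qed

text \<open>\<open>v\<close> and \<open>c\<close> solve the balance equations of the two states of
  the edge ahead. Position and \<open>front_value\<close> differ by 0 or \<open>c\<close>, whence an
  error that does not grow with \<open>n\<close>.\<close>

lemma expect_front:
  assumes "front st"
  defines "v \<equiv> \<mu> * p / (1 - p + \<mu>)" and "c \<equiv> p * (1 + \<mu>) / (1 - p + \<mu>)"
  shows "\<bar>expect 0 0 X n st - (front_value c st + v * real n)\<bar> \<le> c"
proof -
  have pos: "0 < 1 - p + \<mu>" "0 < 1 + \<mu>" using p \<mu> by auto
  have c0: "0 \<le> c" using p \<mu> by (simp add: c_def)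
  \<comment> \<open>Known closed edge ahead: the value \<open>c\<close> is gained if the answer
    expires before the next ring.\<close>
  have ct: "c * (\<mu> / (1 + \<mu>)) = v" using pos by (simp add: c_def v_def)
  have st: "1 / (1 + \<mu>) + \<mu> / (1 + \<mu>) = 1" using pos by (simp add: add_divide_distrib[symmetric])
  \<comment> \<open>Unexplored edge ahead: with probability \<open>p\<close> a step is made and
    \<open>c\<close> is kept; otherwise the situation is that of a known closed edge.\<close>
  have bal: "p * (1 + c) + (1 - p) * v = c + v"
  proof -
    have "c * (1 - p + \<mu>) = p * (1 + \<mu>)" "v * (1 - p + \<mu>) = \<mu> * p"
      using pos by (simp_all add: c_def v_def)
    then have "(p * (1 + c) + (1 - p) * v) * (1 - p + \<mu>) = (c + v) * (1 - p + \<mu>)"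
      by algebra
    then show ?thesis using pos by simp
  qed
  have step: "integrable ring_law (\<lambda>r. F r) \<and> (\<integral>r. F r \<partial>ring_law) = front_value c st + v"
    if "F = (\<lambda>r. if snd (snd (snd st) (fst st)) \<le> 0 \<and> snd (fst (snd (snd r))) then real_of_int (fst st) + 1 + c
       else if fst r < fst (snd (snd (snd r))) then real_of_int (fst st) else real_of_int (fst st) + c)"
    for F :: "real \<times> real \<times> token \<times> token \<Rightarrow> real" and st :: state
  proof -
    let ?x = "real_of_int (fst st)" and ?d = "snd (snd (snd st) (fst st)) \<le> 0"
    define f where "f B l = (if ?d \<and> B then ?x + 1 + c else if l then ?x else ?x + c)" for B l
    have F: "F = (\<lambda>r. f (snd (fst (snd (snd r)))) (fst r < fst (snd (snd (snd r)))))"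
      by (simp add: that f_def)
    have split: "a / (1 + \<mu>) + b * (\<mu> / (1 + \<mu>)) = a + (b - a) * (\<mu> / (1 + \<mu>))" for a b
    proof -
      define t where "t = \<mu> / (1 + \<mu>)"
      have "1 / (1 + \<mu>) = 1 - t" using st unfolding t_def by linarith
      then have "a / (1 + \<mu>) = a * (1 - t)" by (metis times_divide_eq_right mult.right_neutral)
      then show ?thesis unfolding t_def[symmetric] by (simp add: algebra_simps)
    qed
    have "(\<integral>r. F r \<partial>ring_law) = front_value c st + v"
    proof (cases ?d)
      case True
      then have "(\<integral>r. F r \<partial>ring_law) = p * (?x + 1 + c) + (1 - p) * (?x + c * (\<mu> / (1 + \<mu>)))"
        unfolding F integral_ring_race(2)[of f] split by (simp add: f_def)
      then show ?thesis using True bal unfolding ct by (simp add: front_value_def algebra_simps)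
    next
      case False
      then have "(\<integral>r. F r \<partial>ring_law) = p * (?x + c * (\<mu> / (1 + \<mu>))) + (1 - p) * (?x + c * (\<mu> / (1 + \<mu>)))"
        unfolding F integral_ring_race(2)[of f] split by (simp add: f_def)
      then show ?thesis using False unfolding ct by (simp add: front_value_def algebra_simps)
    qed
    then show ?thesis unfolding F using integral_ring_race(1)[of f] by simp
  qed
  have "expect 0 0 X n st \<le> front_value c st + v * real n \<and> front_value c st + v * real n - c \<le> expect 0 0 X n st"
    using assms(1)
  proof (induction n arbitrary: st)
    case 0
    then show ?case using c0 by (simp add: expect_0 front_value_def)
  next
    case (Suc n)
    interpret prob_space ring_law by (rule prob_space_ring_law)
    define F :: "real \<times> real \<times> token \<times> token \<Rightarrow> real" where "F = (\<lambda>r. if snd (snd (snd st) (fst st)) \<le> 0 \<and> snd (fst (snd (snd r))) then real_of_int (fst st) + 1 + c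
       else if fst r < fst (snd (snd (snd r))) then real_of_int (fst st) else real_of_int (fst st) + c)"
    have Fi: "integrable ring_law F" and Fe: "(\<integral>r. F r \<partial>ring_law) = front_value c st + v"
      using step[OF F_def] by auto
    have b: "AE r in ring_law. expect 0 0 X n (ring_step 0 0 st r) \<le> F r + v * real n \<and>
        F r + v * real n - c \<le> expect 0 0 X n (ring_step 0 0 st r)"
      using AE_ring_pos
    proof eventually_elim
      case (elim r)
      have eq: "front_value c (ring_step 0 0 st r) = F r"
        unfolding F_def by (rule front_step(2)[OF Suc.prems]) (use elim in auto)
      have fr: "front (ring_step 0 0 st r)"
        by (rule front_step(1)[OF Suc.prems]) (use elim in auto)
      show ?case using Suc.IH[OF fr] unfolding eq .
    qed
    have "expect 0 0 X (Suc n) st \<le> (\<integral>r. F r + v * real n \<partial>ring_law)"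
      unfolding expect_Suc using b Fi
      by (intro integral_mono_AE integrable_expect_step) (auto elim!: eventually_mono)
    moreover have "(\<integral>r. F r + v * real n - c \<partial>ring_law) \<le> expect 0 0 X (Suc n) st"
      unfolding expect_Suc using b Fi
      by (intro integral_mono_AE integrable_expect_step) (auto elim!: eventually_mono)
    ultimately show ?case using Fi Fe by (simp add: prob_space algebra_simps)
  qed
  then show ?thesis using c0 by (simp add: abs_le_iff)
qed

end

context percolation_drift
begin

section \<open>The limit speed as a function of the threshold\<close>

lemma limit_speed_0: "limit_speed 0 = \<mu> * p / (1 - p + \<mu>)"
proof -
  let ?v = "\<mu> * p / (1 - p + \<mu>)"
  define c where "c = p * (1 + \<mu>) / (1 - p + \<mu>)"
  have fr: "front st0" by (auto simp: front_def st0_def)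
  have fv: "front_value c st0 = c" by (simp add: front_value_def st0_def)
  have m: "\<bar>mean 0 n - (c + ?v * real n)\<bar> \<le> c" for n
    using expect_front[OF fr, of n] st0 by (simp add: expect_X_forgotten c_def[symmetric] fv)
  have "limit_speed 0 \<le> ?v"
  proof (rule eq_of_linear_bound[where C="2 * c + C1 * V 0"])
    fix n show "limit_speed 0 * real n \<le> ?v * real n + (2 * c + C1 * V 0)"
      using m[of n] mean_limit[of 0 n] by linarith
  qed
  moreover have "?v \<le> limit_speed 0"
  proof (rule eq_of_linear_bound[where C="C1 * V 0"])
    fix n show "?v * real n \<le> limit_speed 0 * real n + C1 * V 0"
      using m[of n] mean_limit[of 0 n] by linarith
  qed
  ultimately show ?thesis by simp
qed

text \<open>
  The expected gap grows by \<open>\<epsilon>\<close> per ring, up to a correction by the Lyapunov function. This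
  is a form of the renewal theorem that does not mention the renewal times.
\<close>

lemma expect_gap_large:
  assumes \<theta>: "0 \<le> \<theta>'" "\<theta>' < \<theta>"
  shows "\<exists>\<epsilon>>0. \<forall>n. \<epsilon> * real n \<le> mean \<theta>' n - mean \<theta> n"
proof -
  \<comment> \<open>With this \<open>c\<close>, one ring releases
    \<open>c * V w - c * \<rho> * V w = V w\<close>, which is at least 1 and pays for one \<epsilon>
    at positive load.\<close>
  define c where "c = 1 / (1 - \<rho>)"
  define k where "k = (\<integral>r. kick \<theta> \<theta>' r \<partial>ring_law)"
  \<comment> \<open>Chosen so that at a fresh start the expected kick \<open>k\<close> pays exactly
    for one \<epsilon> and for the correction \<open>\<epsilon> * c * \<rho> * V 0\<close>.\<close>
  define \<epsilon> where "\<epsilon> = k / (1 + c * \<rho> * V 0)"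
  interpret prob_space ring_law by (rule prob_space_ring_law)
  have k: "0 < k" unfolding k_def by (rule kick_positive[OF \<theta>])
  have c: "0 < c" using \<rho> by (simp add: c_def)
  have d: "0 < 1 + c * \<rho> * V 0"
    using c \<rho> V_ge_1[of 0] by (intro add_pos_nonneg mult_nonneg_nonneg) auto
  have \<epsilon>: "0 < \<epsilon>" using k d by (simp add: \<epsilon>_def)
  have \<epsilon>k: "\<epsilon> + \<epsilon> * c * \<rho> * V 0 = k"
  proof -
    have "\<epsilon> * (1 + c * \<rho> * V 0) = k" using d by (simp add: \<epsilon>_def)
    then show ?thesis by (simp add: algebra_simps)
  qed
  have c1: "1 \<le> c * V w - c * \<rho> * V w" for w
  proof -
    have "c * V w - c * \<rho> * V w = V w * (c * (1 - \<rho>))" by (simp add: algebra_simps)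
    also have "c * (1 - \<rho>) = 1" using \<rho> by (simp add: c_def)
    finally show ?thesis using V_ge_1[of w] by simp
  qed
  have th: "0 \<le> \<theta>" using \<theta> by simp
  let ?W = "\<lambda>w r. if 0 < next_load w r then V (next_load w r) else 0"
  \<comment> \<open>At positive load a correction is charged and the initial gap, which is
    nonnegative, is dropped; at nonpositive load the initial gap counts in full, so that a kick is
    not lost.\<close>
  have main: "\<epsilon> * real n - (if 0 < w then \<epsilon> * c * V w else 0)
      + (if w \<le> 0 then real_of_int (fst (snd st)) - real_of_int (fst st) else 0) \<le> expect \<theta> \<theta>' gap n st"
    if "fst st \<le> fst (snd st)" "load_le st w" for n st w
    using that
  proof (induction n arbitrary: st w)
    case 0
    have "0 \<le> \<epsilon> * c * V w" using \<epsilon> c V_ge_1[of w] by simp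
    moreover have "real_of_int (fst st) \<le> real_of_int (fst (snd st))" using 0 by simp
    ultimately show ?case by (simp add: expect_0)
  next
    case (Suc n)
    have ord: "AE r in ring_law. fst (ring_step \<theta> \<theta>' s r) \<le> fst (snd (ring_step \<theta> \<theta>' s r))"
      if "fst s \<le> fst (snd s)" for s
      using AE_ring_pos by eventually_elim (rule ring_step_order[OF that less_imp_le[OF \<theta>(2)]], simp)
    show ?case
    proof (cases "0 < w")
      case True
      have "\<epsilon> * real n - (\<epsilon> * c) * (\<rho> * V w) \<le> \<epsilon> * real n - (\<epsilon> * c) * (\<integral>r. ?W w r \<partial>ring_law)"
        using drift_V[of w] \<epsilon> c by (intro diff_left_mono mult_left_mono) auto
      also have "\<dots> = (\<integral>r. \<epsilon> * real n - (\<epsilon> * c) * ?W w r \<partial>ring_law)"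
        using integrable_V_pos[of w] by (simp add: prob_space)
      also have "\<dots> \<le> expect \<theta> \<theta>' gap (Suc n) st"
        unfolding expect_Suc
      proof (rule integral_mono_AE)
        show "integrable ring_law (\<lambda>r. \<epsilon> * real n - (\<epsilon> * c) * ?W w r)"
          using integrable_V_pos[of w] by simp
        show "AE r in ring_law. \<epsilon> * real n - (\<epsilon> * c) * ?W w r \<le> expect \<theta> \<theta>' gap n (ring_step \<theta> \<theta>' st r)"
          using ord[OF Suc.prems(1)]
        proof eventually_elim
          case (elim r)
          show ?case using Suc.IH[OF elim load_le_ring_step[OF Suc.prems(2)]] elim by (simp split: if_splits)
        qed
      qed (rule integrable_expect_step)
      finally have "\<epsilon> * real n - \<epsilon> * (c * \<rho> * V w) \<le> expect \<theta> \<theta>' gap (Suc n) st" by (simp add: mult.assoc)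
      moreover have "\<epsilon> * 1 \<le> \<epsilon> * (c * V w - c * \<rho> * V w)"
        using \<epsilon> c1[of w] by (intro mult_left_mono) auto
      ultimately show ?thesis using True by (simp add: algebra_simps)
    next
      case False
      \<comment> \<open>From an empty memory the expected growth of the gap is the difference of the
        two means, the same as from \<open>st0\<close>; so it suffices to bound it there, where the
        first ring offers the kick.\<close>
      have fg: "forgotten (snd (snd st))" using load_le_forgotten[OF Suc.prems(2)] False by simp
      have ord0: "fst st0 \<le> fst (snd st0)" using st0 by simp
      have "\<epsilon> * real (Suc n) \<le> \<epsilon> * real n - (\<epsilon> * c) * (\<rho> * V 0) + k"
        using \<epsilon>k by (simp add: algebra_simps)
      also have "\<dots> \<le> \<epsilon> * real n - (\<epsilon> * c) * (\<integral>r. ?W 0 r \<partial>ring_law) + k"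
        using drift_V[of 0] \<epsilon> c by (intro add_right_mono diff_left_mono mult_left_mono) auto
      also have "\<dots> = (\<integral>r. \<epsilon> * real n - (\<epsilon> * c) * ?W 0 r + kick \<theta> \<theta>' r \<partial>ring_law)"
        using integrable_V_pos[of 0] integrable_kick[of \<theta> \<theta>'] by (simp add: prob_space k_def)
      also have "\<dots> \<le> expect \<theta> \<theta>' gap (Suc n) st0"
        unfolding expect_Suc
      proof (rule integral_mono_AE)
        show "integrable ring_law (\<lambda>r. \<epsilon> * real n - (\<epsilon> * c) * ?W 0 r + kick \<theta> \<theta>' r)"
          using integrable_V_pos[of 0] integrable_kick[of \<theta> \<theta>'] by simp
        show "AE r in ring_law. \<epsilon> * real n - (\<epsilon> * c) * ?W 0 r + kick \<theta> \<theta>' r \<le> expect \<theta> \<theta>' gap n (ring_step \<theta> \<theta>' st0 r)"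
          using ord[OF ord0]
        proof eventually_elim
          case (elim r)
          \<comment> \<open>If the load is spent, the induction hypothesis contains the new gap,
            which is the kick; otherwise the kick is 0 and the correction is charged.\<close>
          show ?case using Suc.IH[OF elim load_le_ring_step[OF st0(1)]] elim
            by (auto simp: kick_def st0_def split: if_splits)
        qed
      qed (rule integrable_expect_step)
      also have "\<dots> = mean \<theta>' (Suc n) - mean \<theta> (Suc n)"
        using st0 \<theta> th by (simp add: expect_gap expect_X_forgotten expect_Y_forgotten)
      finally show ?thesis
        using False fg \<theta> th by (simp add: expect_gap expect_X_forgotten expect_Y_forgotten)
    qed
  qed
  have "\<epsilon> * real n \<le> mean \<theta>' n - mean \<theta> n" for n
    using main[OF _ st0(1), of n] st0 \<theta> th by (simp add: expect_gap expect_X_forgotten expect_Y_forgotten)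
  then show ?thesis using \<epsilon> by blast
qed

lemma limit_speed_strict:
  assumes "0 \<le> \<theta>'" "\<theta>' < \<theta>"
  shows "limit_speed \<theta> < limit_speed \<theta>'"
proof -
  obtain \<epsilon> where \<epsilon>: "0 < \<epsilon>" "\<And>n. \<epsilon> * real n \<le> mean \<theta>' n - mean \<theta> n"
    using expect_gap_large[OF assms] by blast
  have "limit_speed \<theta> + \<epsilon> \<le> limit_speed \<theta>'"
  proof (rule eq_of_linear_bound[where C="2 * (C1 * V 0)"])
    fix n show "(limit_speed \<theta> + \<epsilon>) * real n \<le> limit_speed \<theta>' * real n + 2 * (C1 * V 0)"
      using \<epsilon>(2)[of n] mean_limit[of \<theta> n] mean_limit[of \<theta>' n] assms
      unfolding distrib_right by linarith
  qed
  then show ?thesis using \<epsilon>(1) by linarith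
qed

text \<open>The error in \<open>mean_limit\<close> is uniform in \<theta>. Hence \<open>n\<close> is
  chosen first, to make this error small relative to \<open>n\<close>; for this fixed
  \<open>n\<close> the means are close once \<theta> is small.\<close>

lemma limit_speed_continuous: "(limit_speed \<longlongrightarrow> limit_speed 0) (at_right 0)"
proof (rule tendstoI)
  fix e :: real assume e: "0 < e"
  let ?C = "2 * (C1 * V 0)"
  have C: "0 \<le> ?C" using C1_nonneg V_ge_1[of 0] by simp
  have "0 < e / 2" using e by simp
  from ex_less_of_nat_mult[OF this] obtain n where n: "?C < real n * (e / 2)" by blast
  have n0: "0 < real n"
  proof (cases "n = 0")
    case True
    then show ?thesis using n C by simp
  qed simp
  \<comment> \<open>This bound on \<theta> turns the factor \<open>2 * n * n\<close> of
    \<open>expect_gap_small\<close> into \<open>n * (e / 2)\<close>.\<close>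
  have "0 < e / (4 * real n)" using n0 e by simp
  then have "\<forall>\<^sub>F \<theta> in at_right 0. \<theta> < e / (4 * real n)"
    by (rule order_tendstoD(2)[OF tendsto_ident_at])
  moreover have "\<forall>\<^sub>F \<theta> in at_right 0. 0 < (\<theta> :: real)"
    by (rule eventually_at_right_less)
  ultimately show "\<forall>\<^sub>F \<theta> in at_right 0. dist (limit_speed \<theta>) (limit_speed 0) < e"
  proof eventually_elim
    case (elim \<theta>)
    have small: "2 * (real n)\<^sup>2 * (1 - exp (- \<theta>)) \<le> real n * (e / 2)"
    proof -
      have "1 - exp (- \<theta>) \<le> \<theta>" using exp_ge_add_one_self[of "- \<theta>"] by linarith
      also have "\<dots> \<le> e / (4 * real n)" using elim(1) by (rule less_imp_le)
      finally have "2 * (real n)\<^sup>2 * (1 - exp (- \<theta>)) \<le> 2 * (real n)\<^sup>2 * (e / (4 * real n))"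
        by (rule mult_left_mono) simp
      also have "\<dots> = real n * (e / 2)" using n0 by (simp add: power2_eq_square)
      finally show ?thesis .
    qed
    have "expect \<theta> 0 gap n st0 \<le> 2 * (real n)\<^sup>2 * (1 - exp (- \<theta>))"
      using elim(2) by (intro expect_gap_small) (simp_all add: st0(4,5))
    then have m: "mean 0 n - mean \<theta> n \<le> 2 * (real n)\<^sup>2 * (1 - exp (- \<theta>))"
      using elim(2) by (simp add: expect_gap expect_X_forgotten expect_Y_forgotten st0(3,4,5))
    have "0 \<le> \<theta>" using elim(2) by simp
    then have "\<bar>mean \<theta> n - limit_speed \<theta> * real n\<bar> \<le> C1 * V 0" by (rule mean_limit)
    moreover have "\<bar>mean 0 n - limit_speed 0 * real n\<bar> \<le> C1 * V 0" by (rule mean_limit) simp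
    ultimately have "limit_speed 0 * real n - limit_speed \<theta> * real n < real n * (e / 2) + real n * (e / 2)"
      using m small n by linarith
    then have "(limit_speed 0 - limit_speed \<theta>) * real n < e * real n"
      by (simp add: algebra_simps)
    from this of_nat_0_le_iff have "limit_speed 0 - limit_speed \<theta> < e" by (rule mult_right_less_imp_less)
    moreover have "limit_speed \<theta> < limit_speed 0" using elim(2) by (intro limit_speed_strict) simp_all
    ultimately show ?case unfolding dist_real_def by linarith
  qed
qed

end

subsection \<open>From the clock rings to continuous time\<close>

text \<open>Time \<open>t\<close> lies between the last ring up to \<open>t\<close>, of index
  \<open>num_arrivals g t - 1\<close>, and the next one; so the number of rings divided by
  \<open>t\<close> tends to 1, and the limit along rings carries over.\<close>

lemma walk_LIMSEQ:
  assumes g: "\<And>i. 0 < g i" and clock: "(\<lambda>n. arrival g n / real n) \<longlonglongrightarrow> 1"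
    and J: "(\<lambda>n. real_of_int (J n) / real n) \<longlonglongrightarrow> v"
  shows "((\<lambda>t. real_of_int (J (num_arrivals g t)) / t) \<longlongrightarrow> v) at_top"
proof -
  let ?N = "num_arrivals g"
  have inc: "arrival g m < arrival g n" if "m < n" for m n
  proof (rule lift_Suc_mono_less[of "arrival g", OF _ that])
    show "arrival g n < arrival g (Suc n)" for n using g[of "Suc n"] by (simp add: arrival_def)
  qed
  have fin: "finite {n. arrival g n \<le> t}" for t
    by (rule finite_arrivals[OF clock]) simp
  have set: "{n. arrival g n \<le> t} = {..<?N t}" for t
  proof -
    have down: "m \<in> {n. arrival g n \<le> t}" if "n \<in> {n. arrival g n \<le> t}" "m \<le> n" for m n
      using that inc[of m n] by (cases "m = n") auto
    have sub: "{n. arrival g n \<le> t} \<subseteq> {..<?N t}"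
    proof
      fix n assume n: "n \<in> {n. arrival g n \<le> t}"
      then have "{..n} \<subseteq> {n. arrival g n \<le> t}" using down by auto
      then have "card {..n} \<le> ?N t" unfolding num_arrivals_def by (intro card_mono fin)
      then show "n \<in> {..<?N t}" by simp
    qed
    show ?thesis by (rule card_subset_eq[OF _ sub]) (simp_all add: num_arrivals_def)
  qed
  have le: "arrival g n \<le> t \<longleftrightarrow> n < ?N t" for n t using set[of t] by auto
  have Ninf: "filterlim ?N at_top at_top"
    unfolding filterlim_at_top
  proof
    fix Z
    show "\<forall>\<^sub>F t in at_top. Z \<le> ?N t"
      using eventually_ge_at_top[of "arrival g Z"] by eventually_elim (use le in \<open>auto simp: less_imp_le\<close>)
  qed
  have Npos: "\<forall>\<^sub>F t in at_top. 1 \<le> ?N t" using Ninf unfolding filterlim_at_top by blast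
  have t1: "((\<lambda>t. t / real (?N t)) \<longlongrightarrow> 1) at_top"
  proof (rule tendsto_sandwich)
    have a: "(\<lambda>n. arrival g (n - 1) / real (n - 1)) \<longlonglongrightarrow> 1"
      by (rule filterlim_compose[OF clock filterlim_minus_const_nat_at_top])
    have b: "(\<lambda>n. real (n - 1) / real n) \<longlonglongrightarrow> 1"
    proof (rule LIMSEQ_offset)
      have "(\<lambda>n. real n / (real n + 1)) \<longlonglongrightarrow> 1" by real_asymp
      then show "(\<lambda>n. real (n + 1 - 1) / real (n + 1)) \<longlonglongrightarrow> 1" by (simp add: add.commute)
    qed
    from tendsto_mult[OF a b] have "(\<lambda>n. arrival g (n - 1) / real (n - 1) * (real (n - 1) / real n)) \<longlonglongrightarrow> 1"
      by (simp only: mult_1_right)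
    from filterlim_compose[OF this Ninf]
    show "((\<lambda>t. arrival g (?N t - 1) / real (?N t - 1) * (real (?N t - 1) / real (?N t))) \<longlongrightarrow> 1) at_top" .
    show "((\<lambda>t. arrival g (?N t) / real (?N t)) \<longlongrightarrow> 1) at_top"
      by (rule filterlim_compose[OF clock Ninf])
    \<comment> \<open>At least two rings are needed because \<open>?N t - 1\<close> occurs as a
      denominator.\<close>
    have "\<forall>\<^sub>F t in at_top. 2 \<le> ?N t" using Ninf unfolding filterlim_at_top by blast
    then show "\<forall>\<^sub>F t in at_top. arrival g (?N t - 1) / real (?N t - 1) * (real (?N t - 1) / real (?N t)) \<le> t / real (?N t)"
    proof eventually_elim
      case (elim t)
      then have "arrival g (?N t - 1) \<le> t" by (simp add: le)
      then show ?case using elim by (simp add: divide_right_mono)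
    qed
    show "\<forall>\<^sub>F t in at_top. t / real (?N t) \<le> arrival g (?N t) / real (?N t)"
    proof (rule always_eventually, rule allI)
      fix t have "t \<le> arrival g (?N t)" using le[of "?N t" t] by simp
      then show "t / real (?N t) \<le> arrival g (?N t) / real (?N t)" by (simp add: divide_right_mono)
    qed
  qed
  have "((\<lambda>t. real_of_int (J (?N t)) / real (?N t) * inverse (t / real (?N t))) \<longlongrightarrow> v * inverse 1) at_top"
    by (intro tendsto_mult tendsto_inverse t1 filterlim_compose[OF J Ninf]) simp
  moreover have "\<forall>\<^sub>F t in at_top. real_of_int (J (?N t)) / real (?N t) * inverse (t / real (?N t)) = real_of_int (J (?N t)) / t"
    using Npos by eventually_elim (simp add: field_simps)
  ultimately have "((\<lambda>t. real_of_int (J (?N t)) / t) \<longlongrightarrow> v * inverse 1) at_top"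
    by (rule Lim_transform_eventually)
  then show ?thesis by simp
qed

text \<open>Minus the logarithm of the probability of a step to the right; it decreases to 0 as the
  bias grows.\<close>

definition threshold :: "real \<Rightarrow> real" where
  "threshold l = ln (1 + exp (- 2 * l))"

lemma threshold_bias: "exp (- threshold l) = exp l / (exp l + exp (- l))"
proof -
  have p: "0 < 1 + exp (- 2 * l)" by (simp add: add_pos_pos)
  have "exp l + exp (- l) = exp l * (1 + exp (- 2 * l))"
    by (simp add: distrib_left mult_exp_exp)
  then show ?thesis using p by (simp add: threshold_def exp_minus field_simps)
qed

lemma threshold_pos: "0 < threshold l"
  by (simp add: threshold_def ln_gt_zero)

lemma threshold_less: "l < l' \<Longrightarrow> threshold l' < threshold l"
  by (simp add: threshold_def add_pos_pos)

lemma threshold_at_right: "filterlim threshold (at_right 0) at_top"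
proof -
  have "((\<lambda>l. ln (1 + exp (- 2 * l))) \<longlongrightarrow> 0) (at_top :: real filter)" by real_asymp
  then show ?thesis
    unfolding filterlim_at using threshold_pos by (simp add: threshold_def[abs_def] less_imp_neq[symmetric])
qed

context percolation_drift
begin

text \<open>The strong laws for the jump chain and for the clock hold jointly almost surely and
  combine path by path.\<close>

lemma speed_eq: "speed \<mu> p l = limit_speed (threshold l)"
proof -
  let ?M = "walk_measure \<mu> p l" and ?v = "limit_speed (threshold l)"
  have M: "?M = biased_measure (exp (- threshold l))"
    by (simp add: walk_measure_eq threshold_bias)
  interpret prob_space ?M unfolding M by (rule prob_space_biased_measure)
  have J: "AE w in ?M. (\<lambda>n. real_of_int (jump_chain w n) / real n) \<longlonglongrightarrow> ?v"
    unfolding M by (rule AE_jump_chain_LIMSEQ) (simp add: threshold_pos less_imp_le)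
  have "AE c in poisson_gaps 1. (\<lambda>n. arrival c n / real n) \<longlonglongrightarrow> 1"
    using AE_arrival_LIMSEQ[of 1] by simp
  moreover have "AE c in poisson_gaps 1. \<forall>i. 0 < c i"
    using AE_poisson_gaps_regular[of 1] by (auto elim: eventually_mono)
  ultimately have "AE c in poisson_gaps 1. (\<lambda>n. arrival c n / real n) \<longlonglongrightarrow> 1 \<and> (\<forall>i. 0 < c i)"
    by eventually_elim simp
  then have "AE w in ?M. (\<lambda>n. arrival (fst (snd w)) n / real n) \<longlonglongrightarrow> 1 \<and> (\<forall>i. 0 < fst (snd w) i)"
    unfolding M biased_measure_def
    by (intro AE_snd_component[OF prob_space_env_measure prob_space_pair[OF prob_space_poisson_gaps prob_space_coin_flips]]
        AE_fst_component[OF prob_space_coin_flips, where P="\<lambda>c. (\<lambda>n. arrival c n / real n) \<longlonglongrightarrow> 1 \<and> (\<forall>i. 0 < c i)"]) auto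
  with J have lim: "AE w in ?M. ((\<lambda>t. of_int (walk w t) / t) \<longlongrightarrow> ?v) at_top"
    by eventually_elim (auto simp: walk_def intro!: walk_LIMSEQ)
  show ?thesis
    unfolding speed_def
  proof (rule the_equality, rule lim)
    fix v assume "AE w in ?M. ((\<lambda>t. real_of_int (walk w t) / t) \<longlongrightarrow> v) at_top"
    \<comment> \<open>Two almost sure limits agree on at least one path, as the measure is a
      probability.\<close>
    with lim have "AE w in ?M. v = ?v"
      by eventually_elim (rule tendsto_unique[OF trivial_limit_at_top_linorder])
    then show "v = ?v" by simp
  qed
qed

end

theorem proposition4p5:
  fixes p \<mu> :: real
  assumes "0 < p" and "p < 1" and "\<mu> > 0"
  shows "strict_mono_on {0<..} (\<lambda>l. speed \<mu> p l) \<and>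
    ((\<lambda>l. speed \<mu> p l) \<longlongrightarrow> \<mu> * p / (1 - p + \<mu>)) at_top"
proof -
  interpret percolation \<mu> p by standard (use assms in auto)
  obtain A \<rho> :: real where A: "1 \<le> A" "0 < \<rho>" "\<rho> < 1"
    "\<forall>w. (\<integral>r. (if 0 < next_load w r then A + exp (rate * next_load w r) else 0) \<partial>ring_law)
      \<le> \<rho> * (A + exp (rate * w))"
    using lyapunov_drift by (elim exE conjE)
  interpret percolation_drift \<mu> p A \<rho> by standard (use A in auto)
  \<comment> \<open>Two reversals: the threshold decreases in the bias and the limit speed decreases
    in the threshold.\<close>
  have "strict_mono_on {0<..} (\<lambda>l. speed \<mu> p l)"
    by (rule strict_mono_onI) (simp add: speed_eq limit_speed_strict threshold_less threshold_pos less_imp_le)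
  \<comment> \<open>Infinite bias corresponds to the threshold 0, approached from the right.\<close>
  moreover have "((\<lambda>l. limit_speed (threshold l)) \<longlongrightarrow> limit_speed 0) at_top"
    by (rule filterlim_compose[OF limit_speed_continuous threshold_at_right])
  ultimately show ?thesis by (simp add: speed_eq limit_speed_0)
qed

end
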